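(* There exist compact metrizable spaces $X$, $Y$, a closed set $E\subseteq X\times Y$ and a pair $(\mu,\nu)$ of finite Borel measures on $X$ and $Y$ such that $E$ is a set of spectral synthesis for the Varopoulos algebra $V(X,Y)$, but $E$ is not a set of $\mu\times\nu$-synthesis.
   Context: $V(X,Y)=C(X)\hat\otimes C(Y)$ is the algebra of functions $\Phi\in C(X\times Y)$ with a representation $\Phi(x,y)=\sum_i f_i(x)g_i(y)$, $f_i\in C(X)$, $g_i\in C(Y)$, $\sum_i\|f_i\|\|g_i\|<\infty$ (sup norms), with norm the infimum of such sums. A closed set $E\subseteq X\times Y$ is a set of spectral synthesis for $V(X,Y)$ if every $\Phi\in V(X,Y)$ vanishing on $E$ is a norm limit in $V(X,Y)$ of elements of $V(X,Y)$ each vanishing in a neighbourhood of $E$. Operator synthesis. Let $\mu,\nu$ be finite (positive) Borel measures on $X,Y$. A subset of $X\times Y$ is marginally null if it is contained in $(N\times Y)\cup(X\times M)$ with $\mu(N)=\nu(M)=0$; "m.a.e." means outside a marginally null set. A set is pseudo-open if, up to a marginally null set, it is a countable union of measurable rectangles; pseudo-closed sets are complements of pseudo-open sets. $\Gamma(X,Y)=L_2(X,\mu)\hat\otimes L_2(Y,\nu)$ is the space of functions (identified when equal m.a.e.) $F(x,y)=\sum_{n}f_n(x)g_n(y)$ with $f_n\in L_2(X,\mu)$, $g_n\in L_2(Y,\nu)$, $\sum_n\|f_n\|\|g_n\|<\infty$, normed by $\|F\|_\Gamma=\inf\sum_n\|f_n\|\|g_n\|$. $F$ vanishes on $K$ if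 $F\chi_K=0$ m.a.e. $\Phi(K)$ is the set of $F\in\Gamma(X,Y)$ vanishing on $K$; $\Phi_0(K)$ is the norm closure of the set of $F\in\Gamma(X,Y)$ vanishing on some pseudo-open set containing $K$. A pseudo-closed set $K$ is a set of $\mu\times\nu$-synthesis if $\Phi_0(K)=\Phi(K)$. *)

theory Defs
  imports "HOL-Analysis.Analysis"
begin

text \<open>
  Spaces are values of type \<^typ>\<open>'a topology\<close> and measures are values of type \<^typ>\<open>'a measure\<close>.
  Functions on a product are total functions on pairs; only their values on
  \<open>topspace X \<times> topspace Y\<close> (resp. \<open>space \<mu> \<times> space \<nu>\<close>) matter. All functions are complex valued.
\<close>

subsection \<open>The Varopoulos algebra\<close>

definition C_space :: "'a topology \<Rightarrow> ('a \<Rightarrow> complex) set" where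
  "C_space X = {f. continuous_map X euclidean f}"

text \<open>Inserting \<open>0\<close> only matters for the empty space.\<close>

definition sup_norm :: "'a topology \<Rightarrow> ('a \<Rightarrow> complex) \<Rightarrow> real" where
  "sup_norm X f = Sup (insert 0 ((\<lambda>x. norm (f x)) ` topspace X))"

definition V_rep ::
  "'a topology \<Rightarrow> 'b topology \<Rightarrow> (nat \<Rightarrow> 'a \<Rightarrow> complex) \<Rightarrow> (nat \<Rightarrow> 'b \<Rightarrow> complex)
    \<Rightarrow> ('a \<times> 'b \<Rightarrow> complex) \<Rightarrow> bool" where
  "V_rep X Y f g \<Phi> \<longleftrightarrow>
     (\<forall>i. f i \<in> C_space X \<and> g i \<in> C_space Y) \<and>
     summable (\<lambda>i. sup_norm X (f i) * sup_norm Y (g i)) \<and>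
     (\<forall>x\<in>topspace X. \<forall>y\<in>topspace Y. (\<lambda>i. f i x * g i y) sums \<Phi> (x, y))"

definition V_space :: "'a topology \<Rightarrow> 'b topology \<Rightarrow> ('a \<times> 'b \<Rightarrow> complex) set" where
  "V_space X Y = {\<Phi> \<in> C_space (prod_topology X Y). \<exists>f g. V_rep X Y f g \<Phi>}"

definition V_norm :: "'a topology \<Rightarrow> 'b topology \<Rightarrow> ('a \<times> 'b \<Rightarrow> complex) \<Rightarrow> real" where
  "V_norm X Y \<Phi> =
     Inf {\<Sum>i. sup_norm X (f i) * sup_norm Y (g i) | f g. V_rep X Y f g \<Phi>}"

definition vanishes_near ::
  "'a topology \<Rightarrow> 'b topology \<Rightarrow> ('a \<times> 'b) set \<Rightarrow> ('a \<times> 'b \<Rightarrow> complex) \<Rightarrow> bool" where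
  "vanishes_near X Y E \<Psi> \<longleftrightarrow>
     (\<exists>U. openin (prod_topology X Y) U \<and> E \<subseteq> U \<and> (\<forall>p\<in>U. \<Psi> p = 0))"

definition spectral_synthesis ::
  "'a topology \<Rightarrow> 'b topology \<Rightarrow> ('a \<times> 'b) set \<Rightarrow> bool" where
  "spectral_synthesis X Y E \<longleftrightarrow>
     (\<forall>\<Phi>\<in>V_space X Y. (\<forall>p\<in>E. \<Phi> p = 0) \<longrightarrow>
        (\<exists>\<Psi> :: nat \<Rightarrow> 'a \<times> 'b \<Rightarrow> complex.
           (\<forall>n. \<Psi> n \<in> V_space X Y \<and> vanishes_near X Y E (\<Psi> n)) \<and>
           (\<lambda>n. V_norm X Y (\<lambda>p. \<Phi> p - \<Psi> n p)) \<longlonglongrightarrow> 0))"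

subsection \<open>Operator synthesis\<close>

definition finite_Borel_measure :: "'a topology \<Rightarrow> 'a measure \<Rightarrow> bool" where
  "finite_Borel_measure X \<mu> \<longleftrightarrow>
     space \<mu> = topspace X \<and>
     sets \<mu> = sigma_sets (topspace X) {U. openin X U} \<and>
     finite_measure \<mu>"

definition marginally_null ::
  "'a measure \<Rightarrow> 'b measure \<Rightarrow> ('a \<times> 'b) set \<Rightarrow> bool" where
  "marginally_null \<mu> \<nu> S \<longleftrightarrow>
     (\<exists>N\<in>null_sets \<mu>. \<exists>M\<in>null_sets \<nu>. S \<subseteq> (N \<times> space \<nu>) \<union> (space \<mu> \<times> M))"

definition mae :: "'a measure \<Rightarrow> 'b measure \<Rightarrow> ('a \<times> 'b \<Rightarrow> bool) \<Rightarrow> bool" where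
  "mae \<mu> \<nu> P \<longleftrightarrow> marginally_null \<mu> \<nu> {p \<in> space \<mu> \<times> space \<nu>. \<not> P p}"

definition pseudo_open ::
  "'a measure \<Rightarrow> 'b measure \<Rightarrow> ('a \<times> 'b) set \<Rightarrow> bool" where
  "pseudo_open \<mu> \<nu> G \<longleftrightarrow>
     G \<subseteq> space \<mu> \<times> space \<nu> \<and>
     (\<exists>A B. (\<forall>n::nat. A n \<in> sets \<mu> \<and> B n \<in> sets \<nu>) \<and>
        marginally_null \<mu> \<nu> ((G - (\<Union>n. A n \<times> B n)) \<union> ((\<Union>n. A n \<times> B n) - G)))"

definition pseudo_closed ::
  "'a measure \<Rightarrow> 'b measure \<Rightarrow> ('a \<times> 'b) set \<Rightarrow> bool" where
  "pseudo_closed \<mu> \<nu> K \<longleftrightarrow>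
     K \<subseteq> space \<mu> \<times> space \<nu> \<and> pseudo_open \<mu> \<nu> (space \<mu> \<times> space \<nu> - K)"

definition L2_space :: "'a measure \<Rightarrow> ('a \<Rightarrow> complex) set" where
  "L2_space \<mu> = {f \<in> borel_measurable \<mu>. integrable \<mu> (\<lambda>x. (norm (f x))\<^sup>2)}"

definition L2_norm :: "'a measure \<Rightarrow> ('a \<Rightarrow> complex) \<Rightarrow> real" where
  "L2_norm \<mu> f = sqrt (\<integral>x. (norm (f x))\<^sup>2 \<partial>\<mu>)"

text \<open>
  An element of \<open>\<Gamma>(X,Y)\<close> is a class of functions that agree marginally almost everywhere. It is
  represented here by any function of its class: the notions below do not change when a
  function is modified on a marginally null set.
\<close>

definition Gamma_rep ::
  "'a measure \<Rightarrow> 'b measure \<Rightarrow> (nat \<Rightarrow> 'a \<Rightarrow> complex) \<Rightarrow> (nat \<Rightarrow> 'b \<Rightarrow> complex)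
    \<Rightarrow> ('a \<times> 'b \<Rightarrow> complex) \<Rightarrow> bool" where
  "Gamma_rep \<mu> \<nu> f g F \<longleftrightarrow>
     (\<forall>n. f n \<in> L2_space \<mu> \<and> g n \<in> L2_space \<nu>) \<and>
     summable (\<lambda>n. L2_norm \<mu> (f n) * L2_norm \<nu> (g n)) \<and>
     mae \<mu> \<nu> (\<lambda>(x, y). (\<lambda>n. f n x * g n y) sums F (x, y))"

definition Gamma_space :: "'a measure \<Rightarrow> 'b measure \<Rightarrow> ('a \<times> 'b \<Rightarrow> complex) set" where
  "Gamma_space \<mu> \<nu> = {F. \<exists>f g. Gamma_rep \<mu> \<nu> f g F}"

definition Gamma_norm :: "'a measure \<Rightarrow> 'b measure \<Rightarrow> ('a \<times> 'b \<Rightarrow> complex) \<Rightarrow> real" where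
  "Gamma_norm \<mu> \<nu> F =
     Inf {\<Sum>n. L2_norm \<mu> (f n) * L2_norm \<nu> (g n) | f g. Gamma_rep \<mu> \<nu> f g F}"

definition Gamma_closure ::
  "'a measure \<Rightarrow> 'b measure \<Rightarrow> ('a \<times> 'b \<Rightarrow> complex) set \<Rightarrow> ('a \<times> 'b \<Rightarrow> complex) set" where
  "Gamma_closure \<mu> \<nu> S =
     {F \<in> Gamma_space \<mu> \<nu>. \<forall>\<epsilon>>0. \<exists>H\<in>S. Gamma_norm \<mu> \<nu> (\<lambda>p. F p - H p) < \<epsilon>}"

definition vanishes_on ::
  "'a measure \<Rightarrow> 'b measure \<Rightarrow> ('a \<times> 'b) set \<Rightarrow> ('a \<times> 'b \<Rightarrow> complex) \<Rightarrow> bool" where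
  "vanishes_on \<mu> \<nu> K F \<longleftrightarrow> mae \<mu> \<nu> (\<lambda>p. F p * indicator K p = 0)"

definition Phi :: "'a measure \<Rightarrow> 'b measure \<Rightarrow> ('a \<times> 'b) set \<Rightarrow> ('a \<times> 'b \<Rightarrow> complex) set" where
  "Phi \<mu> \<nu> K = {F \<in> Gamma_space \<mu> \<nu>. vanishes_on \<mu> \<nu> K F}"

definition Phi0 :: "'a measure \<Rightarrow> 'b measure \<Rightarrow> ('a \<times> 'b) set \<Rightarrow> ('a \<times> 'b \<Rightarrow> complex) set" where
  "Phi0 \<mu> \<nu> K =
     Gamma_closure \<mu> \<nu>
       {F \<in> Gamma_space \<mu> \<nu>. \<exists>G. pseudo_open \<mu> \<nu> G \<and> K \<subseteq> G \<and> vanishes_on \<mu> \<nu> G F}"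

text \<open>
  This notion is meant for pseudo-closed \<open>K\<close>. Pseudo-closedness is not a conjunct of the definition,
  so a set cannot fail to be of synthesis merely by not being pseudo-closed. Lemma
  \<open>closedin_imp_pseudo_closed\<close> below shows that closed subsets of products of compact metrizable
  spaces are pseudo-closed for any finite Borel measures.
\<close>

definition operator_synthesis ::
  "'a measure \<Rightarrow> 'b measure \<Rightarrow> ('a \<times> 'b) set \<Rightarrow> bool" where
  "operator_synthesis \<mu> \<nu> K \<longleftrightarrow> Phi0 \<mu> \<nu> K = Phi \<mu> \<nu> K"

lemma compact_in_open_finite_rectangles:
  assumes C: "compactin (prod_topology X Y) C" and W: "openin (prod_topology X Y) W"
    and CW: "C \<subseteq> W"
  shows "\<exists>R. finite R \<and> (\<forall>(U, V)\<in>R. openin X U \<and> openin Y V \<and> U \<times> V \<subseteq> W)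
           \<and> C \<subseteq> (\<Union>(U, V)\<in>R. U \<times> V)"
proof -
  define P where "P = {(U, V). openin X U \<and> openin Y V \<and> U \<times> V \<subseteq> W}"
  have "C \<subseteq> (\<Union>(U, V)\<in>P. U \<times> V)"
  proof
    fix p assume "p \<in> C"
    then have "p \<in> W" using CW by blast
    then obtain U V where "openin X U" "openin Y V" "fst p \<in> U" "snd p \<in> V" "U \<times> V \<subseteq> W"
      using W by (cases p) (force simp: openin_prod_topology_alt)
    then show "p \<in> (\<Union>(U, V)\<in>P. U \<times> V)"
      by (intro UN_I[of "(U, V)"]) (auto simp: P_def mem_Times_iff)
  qed
  then have "C \<subseteq> \<Union>((\<lambda>(U, V). U \<times> V) ` P)"
    by simp
  moreover have "\<And>B. B \<in> (\<lambda>(U, V). U \<times> V) ` P \<Longrightarrow> openin (prod_topology X Y) B"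
    by (auto simp: P_def openin_prod_Times_iff)
  ultimately obtain \<F> where \<F>: "finite \<F>" "\<F> \<subseteq> (\<lambda>(U, V). U \<times> V) ` P" "C \<subseteq> \<Union>\<F>"
    using C unfolding compactin_def by metis
  then obtain R where "R \<subseteq> P" "finite R" "\<F> = (\<lambda>(U, V). U \<times> V) ` R"
    by (meson finite_subset_image)
  with \<F> show ?thesis
    by (intro exI[of _ R]) (auto simp: P_def)
qed

lemma closedin_imp_pseudo_closed:
  assumes X: "compact_space X" "metrizable_space X" and Y: "compact_space Y" "metrizable_space Y"
    and E: "closedin (prod_topology X Y) E"
    and \<mu>: "finite_Borel_measure X \<mu>" and \<nu>: "finite_Borel_measure Y \<nu>"
  shows "pseudo_closed \<mu> \<nu> E"
proof -
  let ?Z = "prod_topology X Y"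
  define W where "W = topspace ?Z - E"
  have W: "openin ?Z W" unfolding W_def using E by (intro openin_diff openin_topspace)
  have "metrizable_space ?Z" using X Y by (simp add: metrizable_space_prod_topology)
  then have "fsigma_in ?Z W"
    using W by (simp add: open_imp_fsigma_in)
  then obtain D where D: "countable D" "D \<subseteq> Collect (closedin ?Z)" "\<Union>D = W"
    by (auto simp: fsigma_in_def union_of_def)
  have "compact_space ?Z" using X Y by (simp add: compact_space_prod_topology)
  then have "\<forall>C\<in>D. \<exists>R. finite R \<and> (\<forall>(U, V)\<in>R. openin X U \<and> openin Y V \<and> U \<times> V \<subseteq> W)
           \<and> C \<subseteq> (\<Union>(U, V)\<in>R. U \<times> V)"
    using D W by (intro ballI compact_in_open_finite_rectangles)
      (auto intro: closedin_compact_space)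
  from bchoice[OF this] obtain R
    where "\<forall>C\<in>D. finite (R C) \<and> (\<forall>(U, V)\<in>R C. openin X U \<and> openin Y V \<and> U \<times> V \<subseteq> W)
           \<and> C \<subseteq> (\<Union>(U, V)\<in>R C. U \<times> V)"
    by (elim exE)
  then have R: "\<And>C. C \<in> D \<Longrightarrow> finite (R C)"
      "\<And>C. C \<in> D \<Longrightarrow> \<forall>(U, V)\<in>R C. openin X U \<and> openin Y V \<and> U \<times> V \<subseteq> W"
      "\<And>C. C \<in> D \<Longrightarrow> C \<subseteq> (\<Union>(U, V)\<in>R C. U \<times> V)"
    by simp_all
  define Q where "Q = insert ({}, {}) (\<Union>C\<in>D. R C)"
  have "countable Q" unfolding Q_def using D(1) R(1)
    by (intro countable_insert countable_UN) (simp_all add: countable_finite)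
  then have range: "range (from_nat_into Q) = Q"
    by (simp add: Q_def)
  have QW: "openin X U \<and> openin Y V \<and> U \<times> V \<subseteq> W" if UV: "(U, V) \<in> Q" for U V
  proof (cases "(U, V) = ({}, {})")
    case False
    then obtain C where "C \<in> D" "(U, V) \<in> R C" using UV by (auto simp: Q_def)
    then show ?thesis using R(2) by blast
  qed simp
  then have Q: "openin X U" "openin Y V" "U \<times> V \<subseteq> W" if "(U, V) \<in> Q" for U V
    using that by blast+
  define A where "A n = fst (from_nat_into Q n)" for n
  define B where "B n = snd (from_nat_into Q n)" for n
  have AB: "(A n, B n) \<in> Q" for n
    unfolding A_def B_def using range by (metis prod.collapse rangeI)
  have "(\<Union>n. A n \<times> B n) = (\<Union>q\<in>range (from_nat_into Q). fst q \<times> snd q)"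
    by (auto simp: A_def B_def)
  also have "\<dots> = (\<Union>q\<in>Q. fst q \<times> snd q)"
    by (simp only: range)
  also have "\<dots> = W"
  proof
    show "(\<Union>q\<in>Q. fst q \<times> snd q) \<subseteq> W" using Q(3) by fastforce
    show "W \<subseteq> (\<Union>q\<in>Q. fst q \<times> snd q)"
    proof
      fix p assume "p \<in> W"
      then obtain C where "C \<in> D" "p \<in> C" using D by blast
      then obtain U V where "(U, V) \<in> R C" "p \<in> U \<times> V" using R(3) by fast
      then show "p \<in> (\<Union>q\<in>Q. fst q \<times> snd q)"
        using \<open>C \<in> D\<close> by (intro UN_I[of "(U, V)"]) (auto simp: Q_def)
    qed
  qed
  finally have U: "(\<Union>n. A n \<times> B n) = W" .
  have sp: "space \<mu> = topspace X" "space \<nu> = topspace Y"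
    using \<mu> \<nu> by (simp_all add: finite_Borel_measure_def)
  have "A n \<in> sets \<mu> \<and> B n \<in> sets \<nu>" for n
    using \<mu> \<nu> Q(1,2)[OF AB] by (auto simp: finite_Borel_measure_def)
  moreover have "marginally_null \<mu> \<nu> {}"
    by (auto simp: marginally_null_def)
  ultimately have "pseudo_open \<mu> \<nu> W"
    unfolding pseudo_open_def using openin_subset[OF W]
    by (intro conjI exI[of _ A] exI[of _ B]) (simp_all add: U sp)
  moreover have "E \<subseteq> space \<mu> \<times> space \<nu>"
    using closedin_subset[OF E] by (simp add: sp)
  ultimately show ?thesis
    by (simp add: pseudo_closed_def W_def sp)
qed

end

theory Submission
  imports Defs "HOL-Probability.Probability" "HOL-Library.Discrete_Functions"
begin

text \<open>
  Spectral synthesis in \<open>V(X,Y)\<close> tests a set at all of its points, while \<open>\<mu> \<times> \<nu>\<close>-synthesis only sees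
  the part of it that \<open>\<mu>\<close> and \<open>\<nu>\<close> charge. So a closed set \<open>K\<close> without \<open>\<mu> \<times> \<nu>\<close>-synthesis is enlarged by
  points of measure zero which accumulate at \<open>K\<close> and which force spectral synthesis.

  Here \<open>X = Y\<close> is the infinite binary tree together with its boundary: the vertices are isolated
  points, the infinite branches form a Cantor set, and \<open>\<mu> = \<nu>\<close> is the fair coin measure on the
  branches. The map \<open>prune n\<close> sends a branch or a deep vertex to its ancestor at level \<open>n\<close>. These maps
  have finite range and converge uniformly to the identity. The set \<open>E\<close> consists of \<open>K\<close>, a closed set
  of pairs of branches, and of the pairs of points that are compatible with pairs in \<open>K\<close> in every
  finite window; it is mapped into itself by pruning both coordinates. If \<open>\<Phi>\<close> in \<open>V(X,X)\<close> vanishes on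
  \<open>E\<close>, then \<open>\<Phi>\<close> composed with pruning vanishes near \<open>E\<close>, because pruning is locally constant, and
  tends to \<open>\<Phi>\<close> in the norm of \<open>V(X,X)\<close> (lemma \<open>spectral_synthesis_by_inner_maps\<close>). This works for
  every \<open>K\<close>.

  It remains to find \<open>K\<close>, and here the idea is Malliavin's. Let \<open>\<phi>\<close> be a unimodular function on pairs
  of branches such that the integral operator with kernel \<open>\<phi> ^ n\<close> has a norm that decays fast in \<open>n\<close>,
  and let \<open>K = {\<phi> = 1}\<close>. The Fourier series \<open>(\<Sum>n. n * (\<phi> ^ n - cnj \<phi> ^ n))\<close> is, up to a constant, the
  derivative of the point mass at \<open>1\<close>, pulled back by \<open>\<phi>\<close>. It converges in operator norm, so it acts
  on \<open>\<Gamma>(X,X)\<close>, the predual of the bounded operators. Its Abel means tend to \<open>0\<close> uniformly on \<open>{|\<phi> - 1| \<ge> d}\<close>,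
  so they annihilate in the limit every element of \<open>\<Gamma>(X,X)\<close> that vanishes on a pseudo-open set
  containing \<open>K\<close> (lemma \<open>abel_pairing_small\<close>). But their pairing with \<open>\<phi> - 1\<close>, which vanishes on \<open>K\<close>,
  stays away from \<open>0\<close>: the main term is the integral of \<open>- cnj \<phi> * \<phi> = -1\<close> from the first summand, and
  all the others are small (lemma \<open>norm_abel_pairing_ge\<close>).

  A phase \<open>\<phi>\<close> of this kind is \<open>cis (\<Sum>k. angle k * x k * y k)\<close> with bits \<open>x k\<close> and \<open>y k\<close>. Its powers are
  products of functions of single bits, and every \<open>k\<close> with \<open>cos (n * angle k) \<le> 0\<close> contributes a
  factor \<open>15/16\<close> to the operator norm of \<open>\<phi> ^ n\<close> (lemma \<open>kernel_norm_le_bit\<close>). The angles \<open>\<pi> / 2 ^ j\<close>,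
  each of them repeated about \<open>100 * j\<close> times, are summable, which makes \<open>\<phi>\<close> continuous and an
  element of \<open>\<Gamma>(X,X)\<close>, and still provide for every \<open>n\<close> so many factors that the norms decay.
\<close>


section \<open>Interleaved series\<close>

definition interleave :: "(nat \<Rightarrow> 'a) \<Rightarrow> (nat \<Rightarrow> 'a) \<Rightarrow> nat \<Rightarrow> 'a" where
  "interleave f g n = (if even n then f (n div 2) else g (n div 2))"

lemma sum_interleave:
  fixes f g :: "nat \<Rightarrow> 'a::comm_monoid_add"
  shows "sum (interleave f g) {..<m} = sum f {..<(m + 1) div 2} + sum g {..<m div 2}"
proof (induction m)
  case (Suc m)
  show ?case
  proof (cases "even m")
    case True
    then have "(Suc m + 1) div 2 = Suc (m div 2)" "Suc m div 2 = m div 2" "(m + 1) div 2 = m div 2"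
      by auto
    then show ?thesis using True Suc by (simp add: interleave_def ac_simps)
  next
    case False
    then have "(Suc m + 1) div 2 = Suc (m div 2)" "Suc m div 2 = Suc (m div 2)"
      "(m + 1) div 2 = Suc (m div 2)" by (auto elim!: oddE)
    then show ?thesis using False Suc by (simp add: interleave_def ac_simps)
  qed
qed simp

lemma sums_interleave:
  fixes f g :: "nat \<Rightarrow> 'a::real_normed_vector"
  assumes "f sums a" "g sums b"
  shows "interleave f g sums (a + b)"
proof -
  have "filterlim (\<lambda>m::nat. (m + 1) div 2) sequentially sequentially"
    unfolding filterlim_at_top eventually_sequentially
    by (metis (no_types, lifting) add_leE div_le_mono nonzero_mult_div_cancel_right zero_neq_numeral trans_le_add1)
  moreover have "filterlim (\<lambda>m::nat. m div 2) sequentially sequentially"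
    unfolding filterlim_at_top eventually_sequentially
    by (metis div_le_mono nonzero_mult_div_cancel_right zero_neq_numeral)
  ultimately show ?thesis
    using assms unfolding sums_def sum_interleave
    by (intro tendsto_add) (auto intro: filterlim_compose)
qed

section \<open>Square-integrable functions and kernels of integral operators\<close>

lemma L2_norm_nonneg [simp]: "0 \<le> L2_norm M u"
  by (simp add: L2_norm_def)

lemma L2_norm_power2: "(L2_norm M u)\<^sup>2 = (\<integral>x. (norm (u x))\<^sup>2 \<partial>M)"
  by (simp add: L2_norm_def)

lemma L2_space_measurable: "u \<in> L2_space M \<Longrightarrow> u \<in> borel_measurable M"
  by (simp add: L2_space_def)

lemma L2_space_imp_integrable:
  assumes "prob_space M" and u: "u \<in> L2_space M"
  shows "integrable M u" and "(\<integral>x. norm (u x) \<partial>M) \<le> L2_norm M u"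
proof -
  interpret prob_space M by fact
  have [measurable]: "u \<in> borel_measurable M" and sq: "integrable M (\<lambda>x. (norm (u x))\<^sup>2)"
    using u by (auto simp: L2_space_def)
  show int: "integrable M u"
  proof (rule Bochner_Integration.integrable_bound)
    show "integrable M (\<lambda>x. 1 + (norm (u x))\<^sup>2)" using sq by simp
    show "AE x in M. norm (u x) \<le> norm (1 + (norm (u x))\<^sup>2)"
    proof (intro AE_I2)
      fix x
      have "0 \<le> (norm (u x) - 1)\<^sup>2" "0 \<le> (norm (u x))\<^sup>2" by simp_all
      then show "norm (u x) \<le> norm (1 + (norm (u x))\<^sup>2)"
        by (simp add: power2_diff abs_of_nonneg) (use norm_ge_zero[of "u x"] in linarith)
    qed
  qed simp
  have "0 \<le> variance (\<lambda>x. norm (u x))" by simp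
  then have "(\<integral>x. norm (u x) \<partial>M)\<^sup>2 \<le> (L2_norm M u)\<^sup>2"
    using variance_eq[of "\<lambda>x. norm (u x)"] int sq by (simp add: L2_norm_power2)
  then show "(\<integral>x. norm (u x) \<partial>M) \<le> L2_norm M u"
    by (rule power2_le_imp_le) simp
qed

lemma L2_space_bounded:
  assumes "finite_measure M" and [measurable]: "u \<in> borel_measurable M"
    and b: "\<And>x. x \<in> space M \<Longrightarrow> norm (u x) \<le> B"
  shows "u \<in> L2_space M"
proof -
  interpret finite_measure M by fact
  have "integrable M (\<lambda>x. (norm (u x))\<^sup>2)"
    by (rule integrable_const_bound[of _ "B\<^sup>2"]) (auto intro!: AE_I2 power_mono b)
  then show ?thesis by (simp add: L2_space_def)
qed

lemma L2_space_mult_bounded: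
  assumes u: "u \<in> L2_space M" and [measurable]: "w \<in> borel_measurable M"
    and b: "\<And>x. x \<in> space M \<Longrightarrow> norm (w x) \<le> 1"
  shows "(\<lambda>x. w x * u x) \<in> L2_space M" "L2_norm M (\<lambda>x. w x * u x) \<le> L2_norm M u"
proof -
  have [measurable]: "u \<in> borel_measurable M" and sq: "integrable M (\<lambda>x. (norm (u x))\<^sup>2)"
    using u by (auto simp: L2_space_def)
  have le: "norm (w x * u x) \<le> norm (u x)" if "x \<in> space M" for x
    using b[OF that] by (simp add: norm_mult mult_left_le_one_le)
  have i: "integrable M (\<lambda>x. (norm (w x * u x))\<^sup>2)"
    by (rule Bochner_Integration.integrable_bound[OF sq]) (auto intro!: AE_I2 le)
  then show "(\<lambda>x. w x * u x) \<in> L2_space M" by (simp add: L2_space_def)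
  show "L2_norm M (\<lambda>x. w x * u x) \<le> L2_norm M u"
    unfolding L2_norm_def by (intro real_sqrt_le_mono integral_mono i sq power_mono le) simp_all
qed

lemma L2_space_add:
  assumes u: "u \<in> L2_space M" and v: "v \<in> L2_space M"
  shows "(\<lambda>x. u x + v x) \<in> L2_space M"
proof -
  have [measurable]: "u \<in> borel_measurable M" "v \<in> borel_measurable M"
    and sq: "integrable M (\<lambda>x. (norm (u x))\<^sup>2)" "integrable M (\<lambda>x. (norm (v x))\<^sup>2)"
    using u v by (auto simp: L2_space_def)
  have "integrable M (\<lambda>x. (norm (u x + v x))\<^sup>2)"
  proof (rule Bochner_Integration.integrable_bound)
    show "integrable M (\<lambda>x. 2 * (norm (u x))\<^sup>2 + 2 * (norm (v x))\<^sup>2)" using sq by simp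
    show "AE x in M. norm ((norm (u x + v x))\<^sup>2) \<le> norm (2 * (norm (u x))\<^sup>2 + 2 * (norm (v x))\<^sup>2)"
    proof (intro AE_I2)
      fix x
      have "(norm (u x + v x))\<^sup>2 \<le> (norm (u x) + norm (v x))\<^sup>2"
        by (intro power_mono norm_triangle_ineq) simp
      also have "\<dots> \<le> 2 * (norm (u x))\<^sup>2 + 2 * (norm (v x))\<^sup>2"
        using zero_le_power2[of "norm (u x) - norm (v x)"] by (simp add: power2_sum power2_diff)
      finally show "norm ((norm (u x + v x))\<^sup>2) \<le> norm (2 * (norm (u x))\<^sup>2 + 2 * (norm (v x))\<^sup>2)"
        by simp
    qed
  qed simp
  then show ?thesis by (simp add: L2_space_def)
qed

lemma tensor_integrable:
  assumes "prob_space M" "prob_space N" and u: "u \<in> L2_space M" and v: "v \<in> L2_space N"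
  shows "integrable (M \<Otimes>\<^sub>M N) (\<lambda>p. u (fst p) * v (snd p))"
    and "(\<integral>p. norm (u (fst p) * v (snd p)) \<partial>(M \<Otimes>\<^sub>M N)) \<le> L2_norm M u * L2_norm N v"
proof -
  interpret M: prob_space M by fact
  interpret N: prob_space N by fact
  interpret pair_prob_space M N ..
  note [measurable] = L2_space_measurable[OF u] L2_space_measurable[OF v]
  note iu = L2_space_imp_integrable[OF M.prob_space_axioms u]
    and iv = L2_space_imp_integrable[OF N.prob_space_axioms v]
  show int: "integrable (M \<Otimes>\<^sub>M N) (\<lambda>p. u (fst p) * v (snd p))"
    by (rule Fubini_integrable) (use iu(1) iv(1) in \<open>simp_all add: norm_mult\<close>)
  have "(\<integral>p. norm (u (fst p) * v (snd p)) \<partial>(M \<Otimes>\<^sub>M N)) =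
      (\<integral>x. norm (u x) \<partial>M) * (\<integral>y. norm (v y) \<partial>N)"
    by (subst integral_fst'[symmetric]) (use integrable_norm[OF int] in \<open>simp_all add: norm_mult\<close>)
  also have "\<dots> \<le> L2_norm M u * L2_norm N v"
    using iu(2) iv(2) by (intro mult_mono) simp_all
  finally show "(\<integral>p. norm (u (fst p) * v (snd p)) \<partial>(M \<Otimes>\<^sub>M N)) \<le> L2_norm M u * L2_norm N v" .
qed

text \<open>
  A bounded kernel defines an operator from \<open>L\<^sub>2(N)\<close> to \<open>L\<^sub>2(M)\<close>. Only its bilinear form and upper bounds
  for its norm are needed, and these are stated without reference to operators.
\<close>

definition bounded_kernel :: "'a measure \<Rightarrow> 'b measure \<Rightarrow> ('a \<times> 'b \<Rightarrow> complex) \<Rightarrow> real \<Rightarrow> bool" where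
  "bounded_kernel M N K B \<longleftrightarrow> K \<in> borel_measurable (M \<Otimes>\<^sub>M N) \<and> (\<forall>p\<in>space (M \<Otimes>\<^sub>M N). norm (K p) \<le> B)"

definition kernel_form ::
  "'a measure \<Rightarrow> 'b measure \<Rightarrow> ('a \<times> 'b \<Rightarrow> complex) \<Rightarrow> ('a \<Rightarrow> complex) \<Rightarrow> ('b \<Rightarrow> complex) \<Rightarrow> complex" where
  "kernel_form M N K u v = (\<integral>p. K p * (u (fst p) * v (snd p)) \<partial>(M \<Otimes>\<^sub>M N))"

definition kernel_norm_le :: "'a measure \<Rightarrow> 'b measure \<Rightarrow> ('a \<times> 'b \<Rightarrow> complex) \<Rightarrow> real \<Rightarrow> bool" where
  "kernel_norm_le M N K c \<longleftrightarrow>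
     (\<forall>u\<in>L2_space M. \<forall>v\<in>L2_space N. norm (kernel_form M N K u v) \<le> c * (L2_norm M u * L2_norm N v))"

lemma integrable_bounded_kernel_mult:
  assumes K: "bounded_kernel M N K B" and f: "integrable (M \<Otimes>\<^sub>M N) f"
  shows "integrable (M \<Otimes>\<^sub>M N) (\<lambda>p. K p * f p)"
    and "norm (\<integral>p. K p * f p \<partial>(M \<Otimes>\<^sub>M N)) \<le> B * (\<integral>p. norm (f p) \<partial>(M \<Otimes>\<^sub>M N))"
proof -
  have [measurable]: "K \<in> borel_measurable (M \<Otimes>\<^sub>M N)" "f \<in> borel_measurable (M \<Otimes>\<^sub>M N)"
    and b: "\<And>p. p \<in> space (M \<Otimes>\<^sub>M N) \<Longrightarrow> norm (K p) \<le> B"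
    using K f by (auto simp: bounded_kernel_def)
  have le: "norm (K p * f p) \<le> B * norm (f p)" if "p \<in> space (M \<Otimes>\<^sub>M N)" for p
    using b[OF that] by (simp add: norm_mult mult_right_mono)
  show int: "integrable (M \<Otimes>\<^sub>M N) (\<lambda>p. K p * f p)"
    by (rule Bochner_Integration.integrable_bound[of _ "\<lambda>p. B * norm (f p)"])
       (use f in \<open>auto intro!: AE_I2 order_trans[OF le]\<close>)
  have "norm (\<integral>p. K p * f p \<partial>(M \<Otimes>\<^sub>M N)) \<le> (\<integral>p. norm (K p * f p) \<partial>(M \<Otimes>\<^sub>M N))"
    by (rule integral_norm_bound)
  also have "\<dots> \<le> (\<integral>p. B * norm (f p) \<partial>(M \<Otimes>\<^sub>M N))"
    using int f le by (intro integral_mono) auto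
  finally show "norm (\<integral>p. K p * f p \<partial>(M \<Otimes>\<^sub>M N)) \<le> B * (\<integral>p. norm (f p) \<partial>(M \<Otimes>\<^sub>M N))" by simp
qed

lemma kernel_norm_le_bounded:
  assumes "prob_space M" "prob_space N" and K: "bounded_kernel M N K B" and "0 \<le> B"
  shows "kernel_norm_le M N K B"
  unfolding kernel_norm_le_def kernel_form_def
proof (intro ballI)
  fix u v assume uv: "u \<in> L2_space M" "v \<in> L2_space N"
  note t = tensor_integrable[OF assms(1,2) uv]
  show "norm (\<integral>p. K p * (u (fst p) * v (snd p)) \<partial>(M \<Otimes>\<^sub>M N)) \<le> B * (L2_norm M u * L2_norm N v)"
    using integrable_bounded_kernel_mult(2)[OF K t(1)] mult_left_mono[OF t(2) \<open>0 \<le> B\<close>] by linarith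
qed

section \<open>One oscillating bit\<close>

lemma integral_pair_preserving:
  fixes G :: "'a \<times> 'b \<Rightarrow> complex"
  assumes "prob_space N"
    and s: "\<sigma> \<in> measurable M M" "distr M M \<sigma> = M" and t: "\<tau> \<in> measurable N N" "distr N N \<tau> = N"
    and G: "integrable (M \<Otimes>\<^sub>M N) G"
  shows "integrable (M \<Otimes>\<^sub>M N) (\<lambda>p. G (\<sigma> (fst p), \<tau> (snd p)))"
    and "(\<integral>p. G (\<sigma> (fst p), \<tau> (snd p)) \<partial>(M \<Otimes>\<^sub>M N)) = integral\<^sup>L (M \<Otimes>\<^sub>M N) G"
proof -
  interpret N: prob_space N by fact
  note [measurable] = s(1) t(1)
  have "distr (M \<Otimes>\<^sub>M N) (M \<Otimes>\<^sub>M N) (\<lambda>(x, y). (\<sigma> x, \<tau> y)) = distr M M \<sigma> \<Otimes>\<^sub>M distr N N \<tau>"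
    by (rule pair_measure_distr[symmetric]) (simp_all add: t N.sigma_finite_measure_axioms)
  then have d: "distr (M \<Otimes>\<^sub>M N) (M \<Otimes>\<^sub>M N) (\<lambda>p. (\<sigma> (fst p), \<tau> (snd p))) = M \<Otimes>\<^sub>M N"
    by (simp add: s t case_prod_beta')
  have [measurable]: "G \<in> borel_measurable (M \<Otimes>\<^sub>M N)" using G by simp
  have m[measurable]: "(\<lambda>p. (\<sigma> (fst p), \<tau> (snd p))) \<in> measurable (M \<Otimes>\<^sub>M N) (M \<Otimes>\<^sub>M N)" by simp
  show "integrable (M \<Otimes>\<^sub>M N) (\<lambda>p. G (\<sigma> (fst p), \<tau> (snd p)))"
    by (rule integrable_distr[OF m]) (simp add: d G)
  show "(\<integral>p. G (\<sigma> (fst p), \<tau> (snd p)) \<partial>(M \<Otimes>\<^sub>M N)) = integral\<^sup>L (M \<Otimes>\<^sub>M N) G"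
    using integral_distr[OF m, of G] by (simp add: d)
qed

text \<open>
  The cross terms add up to \<open>2 * Re (cnj p * (1 + w) * q)\<close>. For \<open>w = 1\<close> the best constant is \<open>4\<close>; the gap
  between \<open>7 / 2\<close> and \<open>4\<close> is what makes the norm of the kernel drop.
\<close>

lemma two_point_matrix_bound:
  fixes p q w :: complex
  assumes w: "norm w = 1" "norm (1 + w) \<le> 3 / 2"
  shows "(norm (p + q))\<^sup>2 + (norm (p + w * q))\<^sup>2 \<le> 7 / 2 * ((norm p)\<^sup>2 + (norm q)\<^sup>2)"
proof -
  have e: "(norm (p + z))\<^sup>2 = (norm p)\<^sup>2 + (norm z)\<^sup>2 + 2 * Re (cnj p * z)" for z
    unfolding cmod_power2 by (simp add: power2_eq_square algebra_simps)
  have "Re (cnj p * q) + Re (cnj p * (w * q)) = Re (cnj p * ((1 + w) * q))"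
    by (simp add: algebra_simps)
  also have "\<dots> \<le> norm (cnj p * ((1 + w) * q))" by (rule complex_Re_le_cmod)
  also have "\<dots> = norm (1 + w) * (norm p * norm q)" by (simp add: norm_mult)
  also have "\<dots> \<le> 3 / 2 * (norm p * norm q)" by (intro mult_right_mono w) simp
  finally have "2 * (Re (cnj p * q) + Re (cnj p * (w * q))) \<le> 3 * (norm p * norm q)" by simp
  moreover have "2 * (norm p * norm q) \<le> (norm p)\<^sup>2 + (norm q)\<^sup>2"
    using zero_le_power2[of "norm p - norm q"] by (simp add: power2_diff)
  moreover have "(norm (w * q))\<^sup>2 = (norm q)\<^sup>2" by (simp add: norm_mult w)
  ultimately show ?thesis unfolding e by (simp add: algebra_simps)
qed

text \<open>
  If the map \<open>\<sigma>\<close> flips the bit \<open>b\<close>, then \<open>bit_part c b \<sigma> u\<close> is \<open>u\<close> with the bit of the argument set to \<open>c\<close>.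
\<close>

definition bit_part :: "bool \<Rightarrow> ('a \<Rightarrow> bool) \<Rightarrow> ('a \<Rightarrow> 'a) \<Rightarrow> ('a \<Rightarrow> complex) \<Rightarrow> 'a \<Rightarrow> complex" where
  "bit_part c b \<sigma> u x = (if b x = c then u x else u (\<sigma> x))"

lemma bit_part_L2:
  assumes s: "\<sigma> \<in> measurable M M" "distr M M \<sigma> = M" and b[measurable]: "Measurable.pred M b"
    and u: "u \<in> L2_space M"
  shows "bit_part c b \<sigma> u \<in> L2_space M"
    and "integrable M (\<lambda>x. (norm (bit_part False b \<sigma> u x))\<^sup>2 + (norm (bit_part True b \<sigma> u x))\<^sup>2)"
    and "(\<integral>x. (norm (bit_part False b \<sigma> u x))\<^sup>2 + (norm (bit_part True b \<sigma> u x))\<^sup>2 \<partial>M) =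
      2 * (L2_norm M u)\<^sup>2"
proof -
  note [measurable] = s(1)
  have [measurable]: "u \<in> borel_measurable M" and sq: "integrable M (\<lambda>x. (norm (u x))\<^sup>2)"
    using u by (auto simp: L2_space_def)
  have sq': "integrable M (\<lambda>x. (norm (u (\<sigma> x)))\<^sup>2)"
    by (rule integrable_distr[OF s(1)]) (simp add: s sq)
  have eq: "(\<integral>x. (norm (u (\<sigma> x)))\<^sup>2 \<partial>M) = (\<integral>x. (norm (u x))\<^sup>2 \<partial>M)"
    using integral_distr[OF s(1), of "\<lambda>x. (norm (u x))\<^sup>2"] by (simp add: s)
  have sum: "(norm (bit_part False b \<sigma> u x))\<^sup>2 + (norm (bit_part True b \<sigma> u x))\<^sup>2 =
      (norm (u x))\<^sup>2 + (norm (u (\<sigma> x)))\<^sup>2" for x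
    by (simp add: bit_part_def)
  show "integrable M (\<lambda>x. (norm (bit_part False b \<sigma> u x))\<^sup>2 + (norm (bit_part True b \<sigma> u x))\<^sup>2)"
    unfolding sum using sq sq' by simp
  show "(\<integral>x. (norm (bit_part False b \<sigma> u x))\<^sup>2 + (norm (bit_part True b \<sigma> u x))\<^sup>2 \<partial>M) =
      2 * (L2_norm M u)\<^sup>2"
    unfolding sum using sq sq' eq by (simp add: L2_norm_power2)
  have [measurable]: "bit_part c b \<sigma> u \<in> borel_measurable M"
    unfolding bit_part_def by measurable
  have "integrable M (\<lambda>x. (norm (bit_part c b \<sigma> u x))\<^sup>2)"
    by (rule Bochner_Integration.integrable_bound[of _ "\<lambda>x. (norm (u x))\<^sup>2 + (norm (u (\<sigma> x)))\<^sup>2"])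
       (use sq sq' in \<open>auto simp: bit_part_def\<close>)
  then show "bit_part c b \<sigma> u \<in> L2_space M" by (simp add: L2_space_def)
qed

text \<open>
  The kernel is the tensor product of \<open>W\<close> and the two-by-two matrix with rows \<open>(1, 1)\<close> and \<open>(1, w)\<close> in
  the bit \<open>b\<close>, so its norm is the product of both norms. On the two-point space with masses \<open>1 / 2\<close> the
  matrix has norm at most \<open>sqrt 14 / 4\<close>, which is less than \<open>15 / 16\<close>. The tensor product is handled
  by the measure-preserving flip \<open>\<sigma>\<close> alone, without a product decomposition of \<open>M\<close>.
\<close>

lemma kernel_norm_le_bit:
  assumes M: "prob_space M" and s: "\<sigma> \<in> measurable M M" "distr M M \<sigma> = M"
    and b[measurable]: "Measurable.pred M b"
    and flip: "\<And>x. x \<in> space M \<Longrightarrow> b (\<sigma> x) \<longleftrightarrow> \<not> b x"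
    and W: "bounded_kernel M M W B" "kernel_norm_le M M W c" "0 \<le> c"
    and inv: "\<And>x y. x \<in> space M \<Longrightarrow> y \<in> space M \<Longrightarrow> W (\<sigma> x, y) = W (x, y)"
      "\<And>x y. x \<in> space M \<Longrightarrow> y \<in> space M \<Longrightarrow> W (x, \<sigma> y) = W (x, y)"
    and w: "norm w = 1" "norm (1 + w) \<le> 3 / 2"
  shows "kernel_norm_le M M (\<lambda>p. W p * (if b (fst p) \<and> b (snd p) then w else 1)) (15 / 16 * c)"
  unfolding kernel_norm_le_def
proof (intro ballI)
  fix u v assume u: "u \<in> L2_space M" and v: "v \<in> L2_space M"
  define K where "K p = W p * (if b (fst p) \<and> b (snd p) then w else 1)" for p
  define G where "G p = K p * (u (fst p) * v (snd p))" for p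
  let ?P = "M \<Otimes>\<^sub>M M"
  have [measurable]: "W \<in> borel_measurable ?P" using W by (simp add: bounded_kernel_def)
  have "bounded_kernel M M K B"
    using W(1) w unfolding bounded_kernel_def K_def by (auto simp: norm_mult)
  then have G: "integrable ?P G"
    unfolding G_def by (intro integrable_bounded_kernel_mult tensor_integrable M u v)
  have id: "(\<lambda>x. x) \<in> measurable M M" "distr M M (\<lambda>x. x) = M" by (simp_all add: distr_id)
  note i10 = integral_pair_preserving[OF M s id G]
  note i01 = integral_pair_preserving[OF M id s G]
  note i11 = integral_pair_preserving[OF M s s G]
  define u0 where "u0 = bit_part False b \<sigma> u"
  define u1 where "u1 = bit_part True b \<sigma> u"
  define v0 where "v0 = bit_part False b \<sigma> v"
  define v1 where "v1 = bit_part True b \<sigma> v"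
  note parts = u0_def u1_def v0_def v1_def
  have L: "u0 \<in> L2_space M" "u1 \<in> L2_space M" "v0 \<in> L2_space M" "v1 \<in> L2_space M"
    unfolding parts by (intro bit_part_L2 s b u v)+
  define s0 where "s0 x = u0 x + u1 x" for x
  define s1 where "s1 x = u0 x + w * u1 x" for x
  have S: "s0 \<in> L2_space M" "s1 \<in> L2_space M"
    unfolding s0_def s1_def using L L2_space_mult_bounded(1)[OF L(2), of "\<lambda>_. w"] w
    by (auto intro!: L2_space_add)
  \<comment> \<open>Averaging over the flips of both variables leaves the two-by-two matrix \<open>((1, 1), (1, w))\<close>
    acting on the two parts of \<open>u\<close>.\<close>
  have four: "G p + G (\<sigma> (fst p), snd p) + G (fst p, \<sigma> (snd p)) + G (\<sigma> (fst p), \<sigma> (snd p)) =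
      W p * (s0 (fst p) * v0 (snd p)) + W p * (s1 (fst p) * v1 (snd p))"
    if "p \<in> space ?P" for p
  proof -
    obtain x y where p: "p = (x, y)" "x \<in> space M" "y \<in> space M"
      using \<open>p \<in> space ?P\<close> by (auto simp: space_pair_measure)
    have "\<sigma> x \<in> space M" using s(1) p by (auto dest: measurable_space)
    then have "W (\<sigma> x, \<sigma> y) = W (x, y)" using inv p by simp
    then show ?thesis
      using p flip inv
      by (cases "b x"; cases "b y")
         (simp_all add: G_def K_def s0_def s1_def parts bit_part_def algebra_simps)
  qed
  have "4 * integral\<^sup>L ?P G =
    (\<integral>p. G p + G (\<sigma> (fst p), snd p) + G (fst p, \<sigma> (snd p)) + G (\<sigma> (fst p), \<sigma> (snd p)) \<partial>?P)"
    using G i10 i01 i11 by simp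
  also have "\<dots> = (\<integral>p. W p * (s0 (fst p) * v0 (snd p)) + W p * (s1 (fst p) * v1 (snd p)) \<partial>?P)"
    by (intro Bochner_Integration.integral_cong four refl)
  also have "\<dots> = kernel_form M M W s0 v0 + kernel_form M M W s1 v1"
    unfolding kernel_form_def
    by (intro Bochner_Integration.integral_add integrable_bounded_kernel_mult(1)[OF W(1)]
        tensor_integrable M S L)
  finally have "4 * norm (integral\<^sup>L ?P G) = norm (kernel_form M M W s0 v0 + kernel_form M M W s1 v1)"
    by (metis norm_mult norm_numeral)
  also have "\<dots> \<le> c * (L2_norm M s0 * L2_norm M v0) + c * (L2_norm M s1 * L2_norm M v1)"
    using W(2) S L unfolding kernel_norm_le_def by (intro norm_triangle_mono) auto
  also have "\<dots> = c * (L2_norm M s0 * L2_norm M v0 + L2_norm M s1 * L2_norm M v1)"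
    by (simp add: algebra_simps)
  also have "L2_norm M s0 * L2_norm M v0 + L2_norm M s1 * L2_norm M v1 \<le>
      15 / 4 * (L2_norm M u * L2_norm M v)"
  proof (rule power2_le_imp_le)
    have sqi: "integrable M (\<lambda>x. (norm (f x))\<^sup>2)" if "f \<in> L2_space M" for f :: "'a \<Rightarrow> complex"
      using that by (simp add: L2_space_def)
    have "(L2_norm M s0)\<^sup>2 + (L2_norm M s1)\<^sup>2 = (\<integral>x. (norm (s0 x))\<^sup>2 + (norm (s1 x))\<^sup>2 \<partial>M)"
      unfolding L2_norm_power2 using sqi[OF S(1)] sqi[OF S(2)] by simp
    also have "\<dots> \<le> (\<integral>x. 7 / 2 * ((norm (u0 x))\<^sup>2 + (norm (u1 x))\<^sup>2) \<partial>M)"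
      using sqi[OF S(1)] sqi[OF S(2)] sqi[OF L(1)] sqi[OF L(2)] unfolding s0_def s1_def
      by (intro integral_mono two_point_matrix_bound w) auto
    also have "\<dots> = 7 / 2 * (2 * (L2_norm M u)\<^sup>2)"
      unfolding parts by (subst integral_mult_right_zero) (simp only: bit_part_L2(3)[OF s b u])
    also have "\<dots> = 7 * (L2_norm M u)\<^sup>2" by simp
    finally have A: "(L2_norm M s0)\<^sup>2 + (L2_norm M s1)\<^sup>2 \<le> 7 * (L2_norm M u)\<^sup>2" .
    have B: "(L2_norm M v0)\<^sup>2 + (L2_norm M v1)\<^sup>2 = 2 * (L2_norm M v)\<^sup>2"
      using bit_part_L2(3)[OF s b v] sqi[OF L(3)] sqi[OF L(4)] by (simp add: L2_norm_power2 parts)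
    have "(L2_norm M s0 * L2_norm M v0 + L2_norm M s1 * L2_norm M v1)\<^sup>2 \<le>
        ((L2_norm M s0)\<^sup>2 + (L2_norm M s1)\<^sup>2) * ((L2_norm M v0)\<^sup>2 + (L2_norm M v1)\<^sup>2)"
      using zero_le_power2[of "L2_norm M s0 * L2_norm M v1 - L2_norm M s1 * L2_norm M v0"]
      by (simp add: power2_eq_square algebra_simps)
    also have "\<dots> \<le> (7 * (L2_norm M u)\<^sup>2) * (2 * (L2_norm M v)\<^sup>2)"
      unfolding B by (intro mult_right_mono A) simp
    also have "\<dots> \<le> (15 / 4 * (L2_norm M u * L2_norm M v))\<^sup>2"
      by (simp add: power_mult_distrib power2_eq_square)
    finally show "(L2_norm M s0 * L2_norm M v0 + L2_norm M s1 * L2_norm M v1)\<^sup>2 \<le>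
        (15 / 4 * (L2_norm M u * L2_norm M v))\<^sup>2" .
  qed simp
  finally have "4 * norm (integral\<^sup>L ?P G) \<le> c * (15 / 4 * (L2_norm M u * L2_norm M v))"
    using W(3) by (simp add: mult_left_mono)
  then show "norm (kernel_form M M (\<lambda>p. W p * (if b (fst p) \<and> b (snd p) then w else 1)) u v)
      \<le> 15 / 16 * c * (L2_norm M u * L2_norm M v)"
    by (simp add: kernel_form_def G_def[abs_def] K_def[abs_def])
qed

section \<open>Abel sums of the powers of a phase\<close>

lemma sums_n_power:
  fixes w :: "'a::{real_normed_field,banach}"
  assumes "norm w < 1"
  shows "(\<lambda>n. of_nat n * w ^ n) sums (w / (1 - w)\<^sup>2)"
proof -
  have "(\<lambda>n. w * (of_nat (Suc n) * w ^ n)) sums (w * (1 / (1 - w)\<^sup>2))"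
    by (intro sums_mult geometric_deriv_sums assms)
  then have "(\<lambda>n. of_nat (Suc n) * w ^ Suc n) sums (w / (1 - w)\<^sup>2)"
    by (simp add: algebra_simps)
  then show ?thesis
    using sums_Suc[of "\<lambda>n. of_nat n * w ^ n"] by simp
qed

text \<open>
  Abel means of the Fourier series of the derivative of the point mass at \<open>1\<close>, up to a constant: with
  \<open>z = cis t\<close> the sum is \<open>2 * \<i> * (\<Sum>n. n * r ^ n * sin (n * t))\<close>, a multiple of the derivative of the
  Poisson kernel.
\<close>

definition abel_coeff :: "real \<Rightarrow> complex \<Rightarrow> nat \<Rightarrow> complex" where
  "abel_coeff r z n = of_real (real n * r ^ n) * (z ^ n - cnj z ^ n)"

definition abel_sum :: "real \<Rightarrow> complex \<Rightarrow> complex" where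
  "abel_sum r z = (\<Sum>n. abel_coeff r z n)"

lemma abel_weights_summable:
  assumes "0 \<le> r" "r < 1"
  shows "summable (\<lambda>n. 2 * (real n * r ^ n))"
  using sums_n_power[of r] assms by (intro summable_mult) (simp add: sums_iff)

lemma norm_abel_coeff:
  assumes "0 \<le> r" "norm z = 1"
  shows "norm (abel_coeff r z n) \<le> 2 * (real n * r ^ n)"
proof -
  have "norm (z ^ n - cnj z ^ n) \<le> norm (z ^ n) + norm (cnj z ^ n)" by (rule norm_triangle_ineq4)
  also have "\<dots> = 2" using assms by (simp add: norm_power)
  finally have "norm (z ^ n - cnj z ^ n) \<le> 2" .
  then have "(real n * r ^ n) * norm (z ^ n - cnj z ^ n) \<le> (real n * r ^ n) * 2"
    using assms by (intro mult_left_mono) auto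
  then show ?thesis using assms by (simp add: abel_coeff_def norm_mult norm_power mult.commute)
qed

text \<open>
  The sum is \<open>w / (1 - w)\<^sup>2\<close> minus its conjugate. Since \<open>z / (1 - z)\<^sup>2\<close> is real on the unit circle, a factor
  \<open>1 - r\<^sup>2\<close> appears, and the Abel means tend to \<open>0\<close> away from \<open>z = 1\<close>.
\<close>

lemma abel_sum_closed_form:
  assumes r: "0 \<le> r" "r < 1" and z: "norm z = 1"
  defines "w \<equiv> of_real r * z"
  shows "abel_sum r z = (w - cnj w) * of_real (1 - r\<^sup>2) / of_real (norm (1 - w) ^ 4)"
proof -
  have nw: "norm w = r" using r z by (simp add: w_def norm_mult)
  have "w \<noteq> 1" using nw r by auto
  moreover have "norm (cnj w) = r" using nw by simp
  then have "cnj w \<noteq> 1" using r by (metis less_irrefl norm_one)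
  ultimately have neq: "1 - w \<noteq> 0" "1 - cnj w \<noteq> 0" by simp_all
  have "(\<lambda>n. of_nat n * w ^ n - of_nat n * cnj w ^ n) sums (w / (1 - w)\<^sup>2 - cnj w / (1 - cnj w)\<^sup>2)"
    using nw r by (intro sums_diff sums_n_power) simp_all
  moreover have "of_nat n * w ^ n - of_nat n * cnj w ^ n = abel_coeff r z n" for n
    by (simp add: abel_coeff_def w_def power_mult_distrib algebra_simps)
  ultimately have "abel_sum r z = w / (1 - w)\<^sup>2 - cnj w / (1 - cnj w)\<^sup>2"
    by (simp add: abel_sum_def sums_iff)
  also have "\<dots> = (w * (1 - cnj w)\<^sup>2 - cnj w * (1 - w)\<^sup>2) / ((1 - w) * (1 - cnj w))\<^sup>2"
    using neq by (simp add: diff_frac_eq power_mult_distrib)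
  also have "w * (1 - cnj w)\<^sup>2 - cnj w * (1 - w)\<^sup>2 = (w - cnj w) * (1 - w * cnj w)"
    by (simp add: power2_eq_square algebra_simps)
  also have "w * cnj w = of_real (r\<^sup>2)"
    by (simp only: complex_norm_square[symmetric] nw)
  also have "(1 - w) * (1 - cnj w) = of_real ((norm (1 - w))\<^sup>2)"
    using complex_norm_square[of "1 - w"] by simp
  finally show ?thesis by (simp add: power_mult[symmetric] flip: of_real_power)
qed

lemma norm_abel_sum_le:
  assumes r: "0 \<le> r" "r < 1" and z: "norm z = 1" and d: "0 < d" "d \<le> norm (z - 1)" "1 - r \<le> d / 2"
  shows "norm (abel_sum r z) \<le> 2 * (1 - r\<^sup>2) / (d / 2) ^ 4"
proof -
  define w where "w = of_real r * z"
  have nw: "norm w = r" using r z by (simp add: w_def norm_mult)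
  have "norm (1 - z) \<le> norm (1 - w) + norm (w - z)"
    using norm_triangle_ineq[of "1 - w" "w - z"] by simp
  also have "w - z = of_real (r - 1) * z" by (simp add: w_def algebra_simps)
  also have "norm \<dots> = 1 - r" using r z by (simp add: norm_mult del: of_real_diff)
  finally have "d / 2 \<le> norm (1 - w)" using d by (simp add: norm_minus_commute)
  then have "(d / 2) ^ 4 \<le> norm (1 - w) ^ 4" using d by (intro power_mono) auto
  moreover have "norm (w - cnj w) \<le> 2"
    using norm_triangle_ineq4[of w "cnj w"] nw r by simp
  moreover have "0 \<le> 1 - r\<^sup>2" using r by (simp add: power_le_one)
  ultimately have "norm (w - cnj w) * (1 - r\<^sup>2) / norm (1 - w) ^ 4 \<le> 2 * (1 - r\<^sup>2) / (d / 2) ^ 4"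
    using d by (intro frac_le mult_right_mono) auto
  moreover have "norm (of_real (1 - r\<^sup>2) :: complex) = 1 - r\<^sup>2"
    unfolding norm_of_real using \<open>0 \<le> 1 - r\<^sup>2\<close> by simp
  ultimately show ?thesis
    unfolding abel_sum_closed_form[OF r z] w_def[symmetric]
    by (simp add: norm_mult norm_divide norm_power del: of_real_diff)
qed

lemma borel_measurable_cnj [measurable (raw)]:
  "f \<in> borel_measurable M \<Longrightarrow> (\<lambda>x. cnj (f x)) \<in> borel_measurable M"
  by (rule measurable_compose[where g=cnj], assumption, rule borel_measurable_continuous_onI)
     (intro continuous_intros)

lemma divide_le_divide_cross: "0 < b \<Longrightarrow> 0 < d \<Longrightarrow> a * d \<le> c * b \<Longrightarrow> a / b \<le> c / d" for a b c d :: real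
  by (simp add: divide_simps)

lemma sums_integral_kernel:
  fixes k :: "nat \<Rightarrow> 'a \<Rightarrow> complex"
  assumes k: "\<And>n. k n \<in> borel_measurable M" "\<And>n p. p \<in> space M \<Longrightarrow> norm (k n p) \<le> b n"
    and b: "summable b" and h: "integrable M h"
  shows "(\<lambda>n. \<integral>p. k n p * h p \<partial>M) sums (\<integral>p. (\<Sum>n. k n p) * h p \<partial>M)"
proof -
  note [measurable] = k(1)
  have [measurable]: "h \<in> borel_measurable M" using h by simp
  have le: "norm (k n p * h p) \<le> b n * norm (h p)" if "p \<in> space M" for n p
    using k(2)[OF that] by (simp add: norm_mult mult_right_mono)
  have int: "integrable M (\<lambda>p. k n p * h p)" for n
    by (rule Bochner_Integration.integrable_bound[of _ "\<lambda>p. b n * norm (h p)"])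
       (use h in \<open>auto intro!: AE_I2 order_trans[OF le]\<close>)
  have sm: "summable (\<lambda>n. norm (k n p))" if "p \<in> space M" for p
    by (rule summable_comparison_test[OF _ b]) (use k(2)[OF that] in auto)
  have "(\<lambda>n. \<integral>p. k n p * h p \<partial>M) sums (\<integral>p. (\<Sum>n. k n p * h p) \<partial>M)"
  proof (rule sums_integral[OF int])
    show "AE p in M. summable (\<lambda>n. norm (k n p * h p))"
      by (intro AE_I2) (simp add: norm_mult summable_mult2 sm)
    show "summable (\<lambda>n. \<integral>p. norm (k n p * h p) \<partial>M)"
    proof (rule summable_comparison_test[OF _ summable_mult2[OF b, of "\<integral>p. norm (h p) \<partial>M"]], intro exI allI impI)
      fix n
      have "(\<integral>p. norm (k n p * h p) \<partial>M) \<le> (\<integral>p. b n * norm (h p) \<partial>M)"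
        using int h le by (intro integral_mono) auto
      then show "norm (\<integral>p. norm (k n p * h p) \<partial>M) \<le> b n * (\<integral>p. norm (h p) \<partial>M)"
        by (simp add: abs_of_nonneg)
    qed
  qed
  also have "(\<integral>p. (\<Sum>n. k n p * h p) \<partial>M) = (\<integral>p. (\<Sum>n. k n p) * h p \<partial>M)"
  proof (rule Bochner_Integration.integral_cong[OF refl])
    fix p assume "p \<in> space M"
    from suminf_mult2[OF summable_norm_cancel[OF sm[OF this]], of "h p"]
    show "(\<Sum>n. k n p * h p) = (\<Sum>n. k n p) * h p" by simp
  qed
  finally show ?thesis .
qed

text \<open>
  The cube makes \<open>n * decay n\<close> summable with room to spare, and the factor \<open>64\<close> makes the sums in which
  \<open>decay\<close> occurs below smaller than the main term of the pairing with \<open>\<phi> - 1\<close>.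
\<close>

definition decay :: "nat \<Rightarrow> real" where
  "decay n = 1 / (64 * (real n + 1) ^ 3)"

text \<open>
  For such a phase the set \<open>{\<phi> = 1}\<close> fails operator synthesis. The negative powers decay as well,
  because they are the conjugates of the positive ones.
\<close>

locale oscillating_phase = M: prob_space M + N: prob_space N
  for M :: "'a measure" and N :: "'b measure" +
  fixes \<phi> :: "'a \<times> 'b \<Rightarrow> complex"
  assumes measurable_phase [measurable]: "\<phi> \<in> borel_measurable (M \<Otimes>\<^sub>M N)"
    and unimodular: "p \<in> space (M \<Otimes>\<^sub>M N) \<Longrightarrow> norm (\<phi> p) = 1"
    and powers_decay: "1 \<le> n \<Longrightarrow> kernel_norm_le M N (\<lambda>p. \<phi> p ^ n) (decay n)"
begin

sublocale pair_prob_space M N ..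

lemma bounded_kernel_power: "bounded_kernel M N (\<lambda>p. \<phi> p ^ n) 1"
  by (auto simp: bounded_kernel_def norm_power unimodular)

lemma bounded_kernel_cnj_power: "bounded_kernel M N (\<lambda>p. cnj (\<phi> p) ^ n) 1"
  by (auto simp: bounded_kernel_def norm_power unimodular)

lemma kernel_form_cnj:
  "kernel_form M N (\<lambda>p. cnj (K p)) u v = cnj (kernel_form M N K (\<lambda>x. cnj (u x)) (\<lambda>y. cnj (v y)))"
  unfolding kernel_form_def by (simp flip: Bochner_Integration.integral_cnj)

lemma cnj_powers_decay:
  assumes "1 \<le> n"
  shows "kernel_norm_le M N (\<lambda>p. cnj (\<phi> p) ^ n) (decay n)"
proof -
  have *: "(\<lambda>x. cnj (f x)) \<in> L2_space L" "L2_norm L (\<lambda>x. cnj (f x)) = L2_norm L f"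
    if "f \<in> L2_space L" for f and L :: "'c measure"
    using that by (auto simp: L2_space_def L2_norm_def)
  show ?thesis
    unfolding kernel_norm_le_def
  proof (intro ballI)
    fix u v assume uv: "u \<in> L2_space M" "v \<in> L2_space N"
    show "norm (kernel_form M N (\<lambda>p. cnj (\<phi> p) ^ n) u v) \<le> decay n * (L2_norm M u * L2_norm N v)"
      using powers_decay[OF assms] kernel_form_cnj[of "\<lambda>p. \<phi> p ^ n" u v] *(1)[OF uv(1)] *(1)[OF uv(2)]
      unfolding kernel_norm_le_def by (auto simp: *(2)[OF uv(1)] *(2)[OF uv(2)] dest!: bspec)
  qed
qed

lemma abel_integral_sums:
  assumes r: "0 \<le> r" "r < 1" and h: "integrable (M \<Otimes>\<^sub>M N) h"
  shows "(\<lambda>n. of_real (real n * r ^ n) * ((\<integral>p. \<phi> p ^ n * h p \<partial>(M \<Otimes>\<^sub>M N)) -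
      (\<integral>p. cnj (\<phi> p) ^ n * h p \<partial>(M \<Otimes>\<^sub>M N)))) sums (\<integral>p. abel_sum r (\<phi> p) * h p \<partial>(M \<Otimes>\<^sub>M N))"
proof -
  have "(\<lambda>n. \<integral>p. abel_coeff r (\<phi> p) n * h p \<partial>(M \<Otimes>\<^sub>M N)) sums
      (\<integral>p. (\<Sum>n. abel_coeff r (\<phi> p) n) * h p \<partial>(M \<Otimes>\<^sub>M N))"
    by (rule sums_integral_kernel[OF _ _ abel_weights_summable[OF r] h])
       (use r norm_abel_coeff unimodular in \<open>auto simp: abel_coeff_def[abs_def]\<close>)
  moreover have "(\<integral>p. abel_coeff r (\<phi> p) n * h p \<partial>(M \<Otimes>\<^sub>M N)) = of_real (real n * r ^ n) *
      ((\<integral>p. \<phi> p ^ n * h p \<partial>(M \<Otimes>\<^sub>M N)) - (\<integral>p. cnj (\<phi> p) ^ n * h p \<partial>(M \<Otimes>\<^sub>M N)))" for n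
  proof -
    have "(\<integral>p. abel_coeff r (\<phi> p) n * h p \<partial>(M \<Otimes>\<^sub>M N)) =
        (\<integral>p. of_real (real n * r ^ n) * (\<phi> p ^ n * h p - cnj (\<phi> p) ^ n * h p) \<partial>(M \<Otimes>\<^sub>M N))"
      by (simp only: abel_coeff_def left_diff_distrib mult.assoc)
    also have "\<dots> = of_real (real n * r ^ n) *
        (\<integral>p. \<phi> p ^ n * h p - cnj (\<phi> p) ^ n * h p \<partial>(M \<Otimes>\<^sub>M N))"
      by (rule integral_mult_right_zero)
    also have "(\<integral>p. \<phi> p ^ n * h p - cnj (\<phi> p) ^ n * h p \<partial>(M \<Otimes>\<^sub>M N)) =
        (\<integral>p. \<phi> p ^ n * h p \<partial>(M \<Otimes>\<^sub>M N)) - (\<integral>p. cnj (\<phi> p) ^ n * h p \<partial>(M \<Otimes>\<^sub>M N))"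
      by (intro Bochner_Integration.integral_diff integrable_bounded_kernel_mult(1)[OF bounded_kernel_power h]
          integrable_bounded_kernel_mult(1)[OF bounded_kernel_cnj_power h])
    finally show ?thesis .
  qed
  ultimately show ?thesis by (simp add: abel_sum_def)
qed

lemma bounded_kernel_abel:
  assumes r: "0 \<le> r" "r < 1"
  shows "bounded_kernel M N (\<lambda>p. abel_sum r (\<phi> p)) (\<Sum>n. 2 * (real n * r ^ n))"
  unfolding bounded_kernel_def
proof (intro conjI ballI)
  show "(\<lambda>p. abel_sum r (\<phi> p)) \<in> borel_measurable (M \<Otimes>\<^sub>M N)"
    unfolding abel_sum_def abel_coeff_def by measurable
  fix p assume "p \<in> space (M \<Otimes>\<^sub>M N)"
  then show "norm (abel_sum r (\<phi> p)) \<le> (\<Sum>n. 2 * (real n * r ^ n))"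
    unfolding abel_sum_def
    by (intro norm_suminf_le abel_weights_summable norm_abel_coeff r unimodular)
qed

text \<open>
  This series majorizes the error terms below, and its value is explicit.
\<close>

lemma telescoping_eighth: "(\<lambda>n. 1 / 8 * (1 / real (Suc n) - 1 / real (Suc (Suc n)))) sums (1 / 8)"
proof -
  have "(\<lambda>n. 1 / real (Suc n)) \<longlonglongrightarrow> 0" by (rule LIMSEQ_Suc) (rule lim_1_over_n)
  from sums_mult[OF telescope_sums'[OF this], of "1 / 8"] show ?thesis by simp
qed

text \<open>
  The norm of the kernel is at most \<open>(\<Sum>n. 2 * n * decay n)\<close>, whatever \<open>r\<close> is. This uniform bound turns the
  Abel means into functionals on \<open>\<Gamma>\<close> that are bounded uniformly.
\<close>

lemma kernel_norm_le_abel: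
  assumes r: "0 \<le> r" "r < 1"
  shows "kernel_norm_le M N (\<lambda>p. abel_sum r (\<phi> p)) 1"
  unfolding kernel_norm_le_def
proof (intro ballI)
  fix u v assume uv: "u \<in> L2_space M" "v \<in> L2_space N"
  define s where "s n = of_real (real n * r ^ n) *
     (kernel_form M N (\<lambda>p. \<phi> p ^ n) u v - kernel_form M N (\<lambda>p. cnj (\<phi> p) ^ n) u v)" for n
  define U where "U = L2_norm M u * L2_norm N v"
  have "0 \<le> U" by (simp add: U_def)
  have "s sums kernel_form M N (\<lambda>p. abel_sum r (\<phi> p)) u v"
    unfolding s_def kernel_form_def
    by (rule abel_integral_sums[OF r tensor_integrable(1)[OF M.prob_space_axioms N.prob_space_axioms uv]])
  then have s: "(\<lambda>n. s (Suc n)) sums kernel_form M N (\<lambda>p. abel_sum r (\<phi> p)) u v"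
    using sums_Suc_imp sums_Suc_iff[of s] by (simp add: s_def)
  have "norm (s (Suc n)) \<le> 1 / 8 * (1 / real (Suc n) - 1 / real (Suc (Suc n))) * U" for n
  proof -
    define m where "m = Suc n"
    have m: "1 \<le> m" by (simp add: m_def)
    have "norm (kernel_form M N (\<lambda>p. \<phi> p ^ m) u v - kernel_form M N (\<lambda>p. cnj (\<phi> p) ^ m) u v)
        \<le> decay m * U + decay m * U"
      using powers_decay[OF m] cnj_powers_decay[OF m] uv unfolding kernel_norm_le_def U_def
      by (intro order_trans[OF norm_triangle_ineq4] add_mono) auto
    moreover have "real m * r ^ m \<le> real m" using r by (simp add: mult_left_le power_le_one)
    ultimately have "norm (s m) \<le> real m * (decay m * U + decay m * U)"
      unfolding s_def norm_mult using r \<open>0 \<le> U\<close>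
      by (intro mult_mono) (auto simp: decay_def norm_mult norm_power)
    also have "\<dots> = (2 * real m * decay m) * U" by (simp add: algebra_simps)
    also have "2 * real m * decay m \<le> 1 / 8 * (1 / real (Suc n) - 1 / real (Suc (Suc n)))"
    proof -
      have "1 / 8 * (1 / real (Suc n) - 1 / real (Suc (Suc n))) = 1 / (8 * (real m * (real m + 1)))"
        by (simp add: m_def field_simps)
      moreover have "2 * real m / (64 * (real m + 1) ^ 3) \<le> 1 / (8 * (real m * (real m + 1)))"
      proof (rule divide_le_divide_cross)
        have "16 * (real m)\<^sup>2 * (real m + 1) \<le> 64 * (real m + 1)\<^sup>2 * (real m + 1)"
          by (intro mult_right_mono mult_mono power_mono) auto
        then show "2 * real m * (8 * (real m * (real m + 1))) \<le> 1 * (64 * (real m + 1) ^ 3)"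
          by (simp add: power2_eq_square power3_eq_cube algebra_simps)
      qed (use m in auto)
      then have "2 * real m * decay m \<le> 1 / (8 * (real m * (real m + 1)))"
        by (simp add: decay_def)
      ultimately show ?thesis by simp
    qed
    finally show ?thesis using \<open>0 \<le> U\<close> by (simp add: m_def mult_right_mono)
  qed
  then have "norm (\<Sum>n. s (Suc n)) \<le> (\<Sum>n. 1 / 8 * (1 / real (Suc n) - 1 / real (Suc (Suc n))) * U)"
    using summable_mult2[OF sums_summable[OF telescoping_eighth], of U]
    by (intro norm_suminf_le) auto
  also have "\<dots> = 1 / 8 * U"
    using sums_mult2[OF telescoping_eighth, of U] by (simp add: sums_iff)
  also have "\<dots> \<le> 1 * U" using \<open>0 \<le> U\<close> by simp
  finally show "norm (kernel_form M N (\<lambda>p. abel_sum r (\<phi> p)) u v) \<le> 1 * (L2_norm M u * L2_norm N v)"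
    using s by (simp add: sums_iff U_def)
qed

lemma norm_moment_le:
  assumes "1 \<le> n"
  shows "norm (\<integral>p. \<phi> p ^ n \<partial>(M \<Otimes>\<^sub>M N)) \<le> decay n"
proof -
  have one: "(\<lambda>x. 1) \<in> L2_space L" "L2_norm L (\<lambda>x. 1) = 1" if "prob_space L" for L :: "'c measure"
    using that L2_space_bounded[of L "\<lambda>x. 1" 1]
    by (auto simp: L2_norm_def prob_space.prob_space prob_space_def)
  show ?thesis
    using powers_decay[OF assms] one(1)[OF M.prob_space_axioms] one(1)[OF N.prob_space_axioms]
    unfolding kernel_norm_le_def kernel_form_def
    by (force simp: one(2) M.prob_space_axioms N.prob_space_axioms)
qed

text \<open>
  Writing \<open>m n\<close> for the integral of \<open>\<phi> ^ n\<close>, the \<open>n\<close>-th summand of the pairing is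
  \<open>n * r ^ n * (m (n + 1) - m n - cnj (m (n - 1)) + cnj (m n))\<close>. All moments except \<open>m 0 = 1\<close> are
  bounded by \<open>decay\<close>, so the pairing is \<open>- r\<close> up to a small error.
\<close>

lemma norm_abel_pairing_ge:
  assumes r: "1 / 2 \<le> r" "r < 1"
  shows "1 / 4 \<le> norm (\<integral>p. abel_sum r (\<phi> p) * (\<phi> p - 1) \<partial>(M \<Otimes>\<^sub>M N))"
proof -
  let ?P = "M \<Otimes>\<^sub>M N"
  define m where "m n = (\<integral>p. \<phi> p ^ n \<partial>?P)" for n
  have int1: "integrable ?P (\<lambda>p. \<phi> p ^ n)" "integrable ?P (\<lambda>p. cnj (\<phi> p) ^ n)" for n
    using integrable_bounded_kernel_mult(1)[OF bounded_kernel_power, of "\<lambda>_. 1" n]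
      integrable_bounded_kernel_mult(1)[OF bounded_kernel_cnj_power, of "\<lambda>_. 1" n] by simp_all
  have h: "integrable ?P (\<lambda>p. \<phi> p - 1)" using int1(1)[of 1] by simp
  define s where "s n = of_real (real n * r ^ n) *
      ((\<integral>p. \<phi> p ^ n * (\<phi> p - 1) \<partial>?P) - (\<integral>p. cnj (\<phi> p) ^ n * (\<phi> p - 1) \<partial>?P))" for n
  have "s sums (\<integral>p. abel_sum r (\<phi> p) * (\<phi> p - 1) \<partial>?P)"
    unfolding s_def by (rule abel_integral_sums[OF _ r(2) h]) (use r in simp)
  then have s: "(\<lambda>n. s (Suc n)) sums (\<integral>p. abel_sum r (\<phi> p) * (\<phi> p - 1) \<partial>?P)"
    using sums_Suc_iff[of s] by (simp add: s_def)
  have s_eq: "s (Suc n) = of_real (real (Suc n) * r ^ Suc n) *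
      (m (Suc (Suc n)) - m (Suc n) - cnj (m n) + cnj (m (Suc n)))" for n
  proof -
    have "(\<integral>p. \<phi> p ^ Suc n * (\<phi> p - 1) \<partial>?P) = (\<integral>p. \<phi> p ^ Suc (Suc n) - \<phi> p ^ Suc n \<partial>?P)"
      by (simp add: algebra_simps)
    also have "\<dots> = m (Suc (Suc n)) - m (Suc n)"
      unfolding m_def by (intro Bochner_Integration.integral_diff int1)
    finally have 1: "(\<integral>p. \<phi> p ^ Suc n * (\<phi> p - 1) \<partial>?P) = m (Suc (Suc n)) - m (Suc n)" .
    have unit: "cnj (\<phi> p) * \<phi> p = 1" if "p \<in> space ?P" for p
      using unimodular[OF that] complex_norm_square[of "\<phi> p"] by (simp add: mult.commute)
    have "(\<integral>p. cnj (\<phi> p) ^ Suc n * (\<phi> p - 1) \<partial>?P) = (\<integral>p. cnj (\<phi> p) ^ n - cnj (\<phi> p) ^ Suc n \<partial>?P)"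
      using unit by (intro Bochner_Integration.integral_cong refl) (simp add: algebra_simps)
    also have "\<dots> = cnj (m n) - cnj (m (Suc n))"
      unfolding m_def Bochner_Integration.integral_cnj[symmetric] complex_cnj_power
      by (intro Bochner_Integration.integral_diff int1)
    finally have 2: "(\<integral>p. cnj (\<phi> p) ^ Suc n * (\<phi> p - 1) \<partial>?P) = cnj (m n) - cnj (m (Suc n))" .
    show ?thesis unfolding s_def 1 2 by (simp add: algebra_simps)
  qed
  have m0: "m 0 = 1" using P.prob_space by (simp add: m_def)
  have md: "norm (m n) \<le> decay n" if "1 \<le> n" for n
    unfolding m_def by (rule norm_moment_le[OF that])
  \<comment> \<open>The summand for \<open>n = 1\<close> contains \<open>- r * cnj (m 0) = - r\<close>; it is the main term.\<close>
  define e where "e n = s (Suc n) + (if n = 0 then of_real r else 0)" for n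
  have e: "e sums ((\<integral>p. abel_sum r (\<phi> p) * (\<phi> p - 1) \<partial>?P) + of_real r)"
    unfolding e_def[abs_def] by (intro sums_add s) (use sums_single[of 0 "\<lambda>_. complex_of_real r"] in simp)
  have "norm (e n) \<le> 1 / 8 * (1 / real (Suc n) - 1 / real (Suc (Suc n)))" for n
  proof -
    define k where "k = Suc n"
    have dm: "decay (Suc k) \<le> decay n" "decay k \<le> decay n"
      by (auto simp: decay_def k_def intro!: divide_left_mono power_mono)
    have "e n = of_real (real k * r ^ k) *
      (m (Suc k) - m k - (if n = 0 then 0 else cnj (m n)) + cnj (m k))"
      by (cases n) (simp_all add: e_def s_eq k_def m0 algebra_simps)
    moreover have "norm (m (Suc k) - m k - (if n = 0 then 0 else cnj (m n)) + cnj (m k)) \<le>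
        decay n + decay n + decay n + decay n"
      using md[of n] md[of k] md[of "Suc k"] dm
      by (intro order_trans[OF norm_triangle_ineq] order_trans[OF norm_triangle_ineq4] add_mono)
         (auto simp: k_def decay_def)
    moreover have "real k * r ^ k \<le> real k" using r by (simp add: mult_left_le power_le_one)
    ultimately have "norm (e n) \<le> real k * (decay n + decay n + decay n + decay n)"
      using r by (simp only: norm_mult, intro mult_mono) (auto simp: decay_def norm_mult norm_power)
    also have "\<dots> = 1 / (16 * (real k)\<^sup>2)"
    proof -
      have "decay n = 1 / (64 * real k ^ 3)" "real k > 0" by (simp_all add: decay_def k_def add.commute)
      then show ?thesis by (simp add: power3_eq_cube power2_eq_square)
    qed
    also have "\<dots> \<le> 1 / (8 * (real k * (real k + 1)))"
    proof -
      have "1 \<le> real k" by (simp add: k_def)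
      then have "real k * 1 \<le> real k * real k" by (intro mult_left_mono) auto
      then have "8 * (real k * (real k + 1)) \<le> 16 * (real k)\<^sup>2"
        by (simp add: power2_eq_square algebra_simps)
      then show ?thesis by (intro divide_left_mono) (auto simp: k_def)
    qed
    also have "\<dots> = 1 / 8 * (1 / real (Suc n) - 1 / real (Suc (Suc n)))"
      by (simp add: k_def field_simps)
    finally show ?thesis .
  qed
  then have "norm (\<Sum>n. e n) \<le> (\<Sum>n. 1 / 8 * (1 / real (Suc n) - 1 / real (Suc (Suc n))))"
    by (intro norm_suminf_le sums_summable[OF telescoping_eighth])
  then have "norm ((\<integral>p. abel_sum r (\<phi> p) * (\<phi> p - 1) \<partial>?P) + of_real r) \<le> 1 / 8"
    using e telescoping_eighth by (simp add: sums_iff)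
  moreover have "norm (of_real r :: complex) = r" using r by simp
  ultimately show ?thesis
    using norm_triangle_ineq4[of "(\<integral>p. abel_sum r (\<phi> p) * (\<phi> p - 1) \<partial>?P) + of_real r"
      "\<integral>p. abel_sum r (\<phi> p) * (\<phi> p - 1) \<partial>?P"] r by simp
qed

end

section \<open>Compact sets on which measurable sets become relatively open\<close>

lemma compact_in_sets:
  fixes S :: "'a::t2_space set"
  assumes "sets M = sets (restrict_space borel S)" "compact C" "C \<subseteq> S"
  shows "C \<in> sets M"
proof -
  have "C \<in> sets borel" using assms(2) by (simp add: borel_compact)
  moreover have "C = S \<inter> C" using assms(3) by blast
  ultimately show ?thesis unfolding assms(1) sets_restrict_space by blast
qed

lemma compact_inner_approx:
  fixes S :: "'a::polish_space set"
  assumes M: "finite_measure M" "sets M = sets (restrict_space borel S)" and S: "S \<in> sets borel"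
    and A: "A \<in> sets M" and e: "0 < e"
  obtains C where "compact C" "C \<subseteq> A" "measure M (A - C) < e"
proof -
  interpret finite_measure M by fact
  have sp: "space M = S" using sets_eq_imp_space_eq[OF M(2)] by (simp add: space_restrict_space)
  have AS: "A \<subseteq> S" using sets.sets_into_space[OF A] sp by simp
  have Ab: "A \<in> sets borel"
    using A S by (auto simp: M(2) sets_restrict_space)
  define M' where "M' = distr M borel (\<lambda>x. x)"
  have id: "(\<lambda>x. x) \<in> measurable M borel"
    unfolding measurable_cong_sets[OF M(2) refl] by (rule measurable_restrict_space1) simp
  have em: "emeasure M' B = emeasure M B" if "B \<in> sets borel" "B \<subseteq> S" for B
    using that emeasure_distr[OF id, of B] sp by (simp add: M'_def Int_absorb2)
  interpret M': finite_measure M' unfolding M'_def by (rule finite_measure_distr[OF id])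
  have "emeasure M' A = (SUP K\<in>{K. K \<subseteq> A \<and> compact K}. emeasure M' K)"
    by (rule inner_regular) (simp_all add: M'_def Ab M'.emeasure_finite[unfolded M'_def])
  then obtain K where K: "K \<subseteq> A" "compact K" "emeasure M' A < emeasure M' K + ennreal e"
  proof -
    have fin: "(SUP K\<in>{K. K \<subseteq> A \<and> compact K}. emeasure M' K) \<noteq> \<infinity>"
      using \<open>emeasure M' A = _\<close> M'.emeasure_finite[of A] by (simp add: top_unique)
    show ?thesis
      using SUP_approx_ennreal[of e "{K. K \<subseteq> A \<and> compact K}" "emeasure M' A" "emeasure M'"]
        e fin \<open>emeasure M' A = _\<close> that by (force simp: top_unique)
  qed
  have Km: "K \<in> sets M" using compact_in_sets[OF M(2) K(2)] K(1) AS by blast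
  have "emeasure M A < emeasure M K + ennreal e"
    using K em[OF Ab AS] em[of K] AS by (auto simp: borel_compact)
  then have "measure M A < measure M K + e"
  proof -
    have "ennreal (measure M K) + ennreal e = ennreal (measure M K + e)" using e by simp
    with \<open>emeasure M A < emeasure M K + ennreal e\<close>
    have "ennreal (measure M A) < ennreal (measure M K + e)" by (simp add: emeasure_eq_measure)
    then show ?thesis by (metis ennreal_leI not_le)
  qed
  then have "measure M (A - K) < e"
    using finite_measure_Diff[OF A Km K(1)] by simp
  with K that show ?thesis by blast
qed

text \<open>
  Lusin's theorem for the indicator functions of countably many sets \<open>A n\<close>: inside each of \<open>A n\<close> and its
  complement choose a compact set that misses little, and intersect the unions of these pairs.
\<close>

lemma compact_where_relatively_open:
  fixes S :: "'a::polish_space set" and A :: "nat \<Rightarrow> 'a set"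
  assumes M: "finite_measure M" "sets M = sets (restrict_space borel S)" and S: "S \<in> sets borel"
    and A: "\<And>n. A n \<in> sets M" and Z: "Z \<in> sets M" "measure M (space M - Z) = 0" and e: "0 < e"
  obtains P where "compact P" "P \<subseteq> Z" "P \<in> sets M" "\<And>n. closed (P - A n)" "measure M (space M - P) < e"
proof -
  interpret finite_measure M by fact
  have sp: "space M = S" using sets_eq_imp_space_eq[OF M(2)] by (simp add: space_restrict_space)
  define d where "d n = e / 4 * (1 / 2) ^ Suc n" for n
  have d: "0 < d n" for n using e by (simp add: d_def)
  have "\<exists>C. compact C \<and> C \<subseteq> A n \<and> measure M (A n - C) < d n" for n
    using compact_inner_approx[OF M S A d] by metis
  then obtain C where C: "\<And>n. compact (C n)" "\<And>n. C n \<subseteq> A n" "\<And>n. measure M (A n - C n) < d n"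
    by metis
  have "\<exists>D. compact D \<and> D \<subseteq> space M - A n \<and> measure M ((space M - A n) - D) < d n" for n
    using compact_inner_approx[OF M S _ d, of "space M - A n" n] A by (metis sets.compl_sets)
  then obtain D where D: "\<And>n. compact (D n)" "\<And>n. D n \<subseteq> space M - A n"
      "\<And>n. measure M ((space M - A n) - D n) < d n"
    by metis
  obtain Z' where Z': "compact Z'" "Z' \<subseteq> Z" "measure M (Z - Z') < e / 4"
    by (rule compact_inner_approx[OF M S Z(1), of "e / 4"]) (use e in simp)
  define P where "P = Z' \<inter> (\<Inter>n. C n \<union> D n)"
  have ZS: "Z \<subseteq> S" using sets.sets_into_space[OF Z(1)] sp by simp
  have cl: "closed (C n \<union> D n)" for n using C(1) D(1) by (simp add: closed_Un compact_imp_closed)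
  have P: "compact P" unfolding P_def
    using Z'(1) cl by (intro compact_Int_closed closed_INT) auto
  have PZ: "P \<subseteq> Z" using Z'(2) by (auto simp: P_def)
  have Pm: "P \<in> sets M" using compact_in_sets[OF M(2) P] PZ ZS by blast
  have "P - A n = P \<inter> D n" for n
    using C(2)[of n] D(2)[of n] by (auto simp: P_def)
  then have cP: "closed (P - A n)" for n
    using P D(1) by (simp add: closed_Int compact_imp_closed)
  have Cm: "C n \<in> sets M" "D n \<in> sets M" "Z' \<in> sets M" for n
    using compact_in_sets[OF M(2) C(1)] compact_in_sets[OF M(2) D(1)] compact_in_sets[OF M(2) Z'(1)]
      C(2)[of n] D(2)[of n] Z'(2) ZS sets.sets_into_space[OF A[of n]] sp by blast+
  define B where "B n = (A n - C n) \<union> ((space M - A n) - D n)" for n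
  have Bm: "B n \<in> sets M" for n unfolding B_def using A Cm by auto
  have Bd: "measure M (B n) \<le> 2 * d n" for n
  proof -
    have "measure M (B n) \<le> measure M (A n - C n) + measure M ((space M - A n) - D n)"
      unfolding B_def by (intro measure_Un_le sets.Diff A Cm sets.top)
    then show ?thesis using C(3)[of n] D(3)[of n] by linarith
  qed
  have sums: "(\<lambda>n. 2 * d n) sums (e / 2)"
    using sums_mult[OF power_half_series, of "e / 2"] by (simp add: d_def)
  have sm: "summable (\<lambda>n. measure M (B n))"
    by (rule summable_comparison_test[OF _ sums_summable[OF sums]]) (use Bd in auto)
  have "measure M (\<Union>n. B n) \<le> (\<Sum>n. measure M (B n))"
    using Bm by (intro finite_measure_subadditive_countably sm) auto
  also have "\<dots> \<le> (\<Sum>n. 2 * d n)" by (intro suminf_le Bd sm sums_summable[OF sums])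
  also have "\<dots> = e / 2" using sums by (simp add: sums_iff)
  finally have UB: "measure M (\<Union>n. B n) \<le> e / 2" .
  have sub: "space M - P \<subseteq> ((space M - Z) \<union> (Z - Z')) \<union> (\<Union>n. B n)"
    by (auto simp: P_def B_def)
  have "measure M (space M - P) \<le> measure M (((space M - Z) \<union> (Z - Z')) \<union> (\<Union>n. B n))"
    using Bm Z Cm by (intro finite_measure_mono[OF sub]) auto
  also have "\<dots> \<le> measure M ((space M - Z) \<union> (Z - Z')) + measure M (\<Union>n. B n)"
    using Bm Z Cm by (intro measure_Un_le) auto
  also have "measure M ((space M - Z) \<union> (Z - Z')) \<le> measure M (space M - Z) + measure M (Z - Z')"
    using Z Cm by (intro measure_Un_le) auto
  finally have "measure M (space M - P) < e" using Z(2) Z'(3) UB e by simp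
  then show ?thesis by (rule that[OF P PZ Pm cP])
qed

text \<open>
  The previous lemma, applied to the finite measure with density \<open>(\<Sum>n<m. (norm (f n x))\<^sup>2)\<close>.
\<close>

lemma compact_small_L2_complement:
  fixes S :: "'a::polish_space set" and A :: "nat \<Rightarrow> 'a set" and f :: "nat \<Rightarrow> 'a \<Rightarrow> complex"
  assumes M: "finite_measure M" "sets M = sets (restrict_space borel S)" and S: "S \<in> sets borel"
    and A: "\<And>n. A n \<in> sets M" and Z: "Z \<in> sets M" "emeasure M (space M - Z) = 0" and e: "0 < e"
    and f: "\<And>n. f n \<in> L2_space M"
  shows "\<exists>P. compact P \<and> P \<subseteq> Z \<and> P \<in> sets M \<and> (\<forall>n. closed (P - A n)) \<and>
    (\<forall>n<m. L2_norm M (\<lambda>x. indicator (space M - P) x * f n x) \<le> e)"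
proof -
  interpret finite_measure M by fact
  have [measurable]: "f n \<in> borel_measurable M" for n by (rule L2_space_measurable[OF f])
  have fi: "integrable M (\<lambda>x. (norm (f n x))\<^sup>2)" for n using f[of n] by (simp add: L2_space_def)
  define w where "w x = (\<Sum>n<m. (norm (f n x))\<^sup>2)" for x
  have [measurable]: "w \<in> borel_measurable M" unfolding w_def by measurable
  have w0: "0 \<le> w x" for x by (simp add: w_def sum_nonneg)
  have wi: "integrable M w" unfolding w_def[abs_def] using fi by simp
  define L where "L = density M w"
  have emL: "emeasure L B = ennreal (\<integral>x. w x * indicator B x \<partial>M)" if "B \<in> sets M" for B
  proof -
    have "integrable M (\<lambda>x. w x * indicator B x)"
      using integrable_mult_indicator[OF that wi] by (simp add: mult.commute)
    then show ?thesis unfolding L_def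
      using that w0 by (subst emeasure_density) (auto simp: nn_integral_eq_integral[symmetric] ennreal_mult' ennreal_indicator)
  qed
  have sL: "sets L = sets M" "space L = space M" by (simp_all add: L_def)
  have finL: "finite_measure L"
    by (rule finite_measureI) (use emL[OF sets.top] in \<open>simp add: sL\<close>)
  have "space M - Z \<in> null_sets M" using Z by (auto simp: null_sets_def)
  then have "space M - Z \<in> null_sets L"
    unfolding L_def by (intro absolutely_continuousI_density[unfolded absolutely_continuous_def, THEN subsetD]) auto
  then have ZL: "measure L (space L - Z) = 0" by (simp add: sL measure_def null_setsD1)
  obtain P where P: "compact P" "P \<subseteq> Z" "P \<in> sets L" "\<And>n. closed (P - A n)" "measure L (space L - P) < e\<^sup>2"
    using compact_where_relatively_open[OF finL _ S, of A Z "e\<^sup>2"] A Z ZL M(2) e by (auto simp: sL)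
  have Pm: "P \<in> sets M" using P(3) by (simp add: sL)
  have small: "L2_norm M (\<lambda>x. indicator (space M - P) x * f n x) \<le> e" if "n < m" for n
  proof -
    have wB: "integrable M (\<lambda>x. w x * indicator (space M - P) x)"
      using integrable_mult_indicator[of "space M - P" M w] Pm wi by (simp add: mult.commute)
    have pt: "(norm (indicator (space M - P) x * f n x))\<^sup>2 \<le> w x * indicator (space M - P) x" for x
      using that member_le_sum[of n "{..<m}" "\<lambda>n. (norm (f n x))\<^sup>2"]
      by (auto simp: indicator_def w_def)
    have "(\<integral>x. (norm (indicator (space M - P) x * f n x))\<^sup>2 \<partial>M) \<le> (\<integral>x. w x * indicator (space M - P) x \<partial>M)"
    proof (rule integral_mono[OF _ wB pt])
      show "integrable M (\<lambda>x. (norm (indicator (space M - P) x * f n x))\<^sup>2)"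
        by (rule Bochner_Integration.integrable_bound[OF wB])
           (use pt Pm w0 in \<open>auto intro!: AE_I2 simp: abs_of_nonneg\<close>)
    qed
    also have "\<dots> = measure L (space L - P)"
      using emL[of "space M - P"] Pm w0 by (simp add: measure_def sL Bochner_Integration.integral_nonneg)
    also have "\<dots> \<le> e\<^sup>2" using P(5) by simp
    finally have "(L2_norm M (\<lambda>x. indicator (space M - P) x * f n x))\<^sup>2 \<le> e\<^sup>2"
      by (simp add: L2_norm_power2)
    then show ?thesis by (rule power2_le_imp_le) (use e in simp)
  qed
  show ?thesis using P(1,2) Pm P(4) small by blast
qed

section \<open>Representations of elements of \<open>\<Gamma>\<close>\<close>

lemma marginally_null_Un:
  assumes "marginally_null M N A" "marginally_null M N B"
  shows "marginally_null M N (A \<union> B)"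
proof -
  obtain X Y X' Y' where *: "X \<in> null_sets M" "Y \<in> null_sets N" "X' \<in> null_sets M" "Y' \<in> null_sets N"
    "A \<subseteq> (X \<times> space N) \<union> (space M \<times> Y)" "B \<subseteq> (X' \<times> space N) \<union> (space M \<times> Y')"
    using assms unfolding marginally_null_def by blast
  then show ?thesis unfolding marginally_null_def
    by (intro bexI[of _ "X \<union> X'"] bexI[of _ "Y \<union> Y'"]) auto
qed

lemma mae_mono:
  assumes "mae M N P" "\<And>p. p \<in> space M \<times> space N \<Longrightarrow> P p \<Longrightarrow> Q p"
  shows "mae M N Q"
proof -
  have "{p \<in> space M \<times> space N. \<not> Q p} \<subseteq> {p \<in> space M \<times> space N. \<not> P p}"
    using assms(2) by blast
  then show ?thesis using assms(1) unfolding mae_def marginally_null_def by (meson subset_trans)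
qed

lemma mae_conj:
  assumes "mae M N P" "mae M N Q"
  shows "mae M N (\<lambda>p. P p \<and> Q p)"
proof -
  have "{p \<in> space M \<times> space N. \<not> (P p \<and> Q p)} =
      {p \<in> space M \<times> space N. \<not> P p} \<union> {p \<in> space M \<times> space N. \<not> Q p}" by blast
  then show ?thesis
    using marginally_null_Un[OF assms[unfolded mae_def]] by (simp only: mae_def)
qed

lemma Gamma_rep_add:
  assumes F: "Gamma_rep M N f g F" and D: "Gamma_rep M N p q D"
  shows "Gamma_rep M N (interleave f p) (interleave g q) (\<lambda>z. F z + D z)"
  unfolding Gamma_rep_def
proof (intro conjI allI)
  show "interleave f p n \<in> L2_space M" "interleave g q n \<in> L2_space N" for n
    using F D by (auto simp: Gamma_rep_def interleave_def)
  have "(\<lambda>n. L2_norm M (interleave f p n) * L2_norm N (interleave g q n)) =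
    interleave (\<lambda>n. L2_norm M (f n) * L2_norm N (g n)) (\<lambda>n. L2_norm M (p n) * L2_norm N (q n))"
    by (auto simp: interleave_def)
  moreover have "summable (interleave (\<lambda>n. L2_norm M (f n) * L2_norm N (g n)) (\<lambda>n. L2_norm M (p n) * L2_norm N (q n)))"
    using F D unfolding Gamma_rep_def by (intro sums_summable[OF sums_interleave] summable_sums) auto
  ultimately show "summable (\<lambda>n. L2_norm M (interleave f p n) * L2_norm N (interleave g q n))"
    by simp
  have m: "mae M N (\<lambda>z. (case z of (x, y) \<Rightarrow> (\<lambda>n. f n x * g n y) sums F (x, y)) \<and>
      (case z of (x, y) \<Rightarrow> (\<lambda>n. p n x * q n y) sums D (x, y)))"
    using F D by (intro mae_conj) (auto simp: Gamma_rep_def)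
  show "mae M N (\<lambda>(x, y). (\<lambda>n. interleave f p n x * interleave g q n y) sums (F (x, y) + D (x, y)))"
  proof (rule mae_mono[OF m], clarify)
    fix x y assume "(\<lambda>n. f n x * g n y) sums F (x, y)" "(\<lambda>n. p n x * q n y) sums D (x, y)"
    moreover have "(\<lambda>n. interleave f p n x * interleave g q n y) =
        interleave (\<lambda>n. f n x * g n y) (\<lambda>n. p n x * q n y)" by (auto simp: interleave_def)
    ultimately show "(\<lambda>n. interleave f p n x * interleave g q n y) sums (F (x, y) + D (x, y))"
      by (simp add: sums_interleave)
  qed
qed

lemma Gamma_rep_uminus:
  assumes "Gamma_rep M N f g F"
  shows "Gamma_rep M N (\<lambda>n x. - f n x) g (\<lambda>z. - F z)"
  unfolding Gamma_rep_def
proof (intro conjI allI)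
  show "(\<lambda>x. - f n x) \<in> L2_space M" "g n \<in> L2_space N" for n
    using assms by (auto simp: Gamma_rep_def L2_space_def)
  show "summable (\<lambda>n. L2_norm M (\<lambda>x. - f n x) * L2_norm N (g n))"
    using assms by (simp add: Gamma_rep_def L2_norm_def)
  have "mae M N (\<lambda>(x, y). (\<lambda>n. f n x * g n y) sums F (x, y))"
    using assms by (simp add: Gamma_rep_def)
  then show "mae M N (\<lambda>(x, y). (\<lambda>n. - f n x * g n y) sums - F (x, y))"
    by (rule mae_mono) (use sums_minus in force)
qed

text \<open>
  The infimum that defines \<open>Gamma_norm\<close> says something only if it is taken over a nonempty set. Hence
  \<open>F\<close> and \<open>H\<close> are assumed to lie in \<open>\<Gamma>\<close>: representations of both combine to one of the difference.
\<close>

lemma Gamma_rep_of_norm_less: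
  assumes "F \<in> Gamma_space M N" "H \<in> Gamma_space M N" "Gamma_norm M N (\<lambda>z. F z - H z) < e"
  obtains p q where "Gamma_rep M N p q (\<lambda>z. F z - H z)" "(\<Sum>n. L2_norm M (p n) * L2_norm N (q n)) < e"
proof -
  obtain f g f' g' where "Gamma_rep M N f g F" "Gamma_rep M N f' g' H"
    using assms by (auto simp: Gamma_space_def)
  from Gamma_rep_add[OF this(1) Gamma_rep_uminus[OF this(2)]]
  have "\<exists>p q. Gamma_rep M N p q (\<lambda>z. F z - H z)" by auto
  then have "{\<Sum>n. L2_norm M (f n) * L2_norm N (g n) |f g. Gamma_rep M N f g (\<lambda>z. F z - H z)} \<noteq> {}"
    by blast
  from cInf_lessD[OF this assms(3)[unfolded Gamma_norm_def]] that show ?thesis by blast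
qed

context pair_prob_space
begin

lemma mae_imp_AE:
  assumes "mae M1 M2 P"
  shows "AE p in M1 \<Otimes>\<^sub>M M2. P p"
proof -
  obtain X Y where XY: "X \<in> null_sets M1" "Y \<in> null_sets M2"
    "{p \<in> space M1 \<times> space M2. \<not> P p} \<subseteq> (X \<times> space M2) \<union> (space M1 \<times> Y)"
    using assms unfolding mae_def marginally_null_def by blast
  have "(X \<times> space M2) \<union> (space M1 \<times> Y) \<in> null_sets (M1 \<Otimes>\<^sub>M M2)"
    using XY(1,2) by (intro null_sets.Un) (auto simp: null_sets_def M2.emeasure_pair_measure_Times)
  then show ?thesis
    by (rule AE_I') (use XY(3) in \<open>auto simp: space_pair_measure\<close>)
qed

lemma AE_summable_of_integrals:
  fixes h :: "nat \<Rightarrow> 'c \<Rightarrow> complex"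
  assumes h: "\<And>n. integrable Q (h n)" and s: "summable (\<lambda>n. \<integral>p. norm (h n p) \<partial>Q)"
  shows "AE p in Q. summable (\<lambda>n. norm (h n p))"
proof -
  have [measurable]: "h n \<in> borel_measurable Q" for n using h[of n] by simp
  have "(\<integral>\<^sup>+p. (\<Sum>n. ennreal (norm (h n p))) \<partial>Q) = (\<Sum>n. \<integral>\<^sup>+p. ennreal (norm (h n p)) \<partial>Q)"
    by (intro nn_integral_suminf) auto
  also have "\<dots> = (\<Sum>n. ennreal (\<integral>p. norm (h n p) \<partial>Q))"
    using h by (intro suminf_cong nn_integral_eq_integral) auto
  also have "\<dots> = ennreal (\<Sum>n. \<integral>p. norm (h n p) \<partial>Q)"
    by (intro suminf_ennreal2 s) simp
  finally have "AE p in Q. (\<Sum>n. ennreal (norm (h n p))) \<noteq> \<infinity>"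
    by (intro nn_integral_PInf_AE) auto
  then show ?thesis
    by eventually_elim (auto intro: summable_suminf_not_top)
qed

text \<open>
  Kernels act on elements of \<open>\<Gamma>\<close> by integration. A marginally null set is a null set of the product
  measure, so the value of the pairing is independent of the representation.
\<close>

lemma Gamma_rep_pairing:
  assumes rep: "Gamma_rep M1 M2 f g F" and F: "F \<in> borel_measurable (M1 \<Otimes>\<^sub>M M2)"
    and K: "bounded_kernel M1 M2 K B"
  shows "(\<lambda>n. kernel_form M1 M2 K (f n) (g n)) sums (\<integral>p. K p * F p \<partial>(M1 \<Otimes>\<^sub>M M2))"
    and "integrable (M1 \<Otimes>\<^sub>M M2) F"
proof -
  let ?P = "M1 \<Otimes>\<^sub>M M2"
  define t where "t n p = f n (fst p) * g n (snd p)" for n and p :: "'a \<times> 'b"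
  have L: "f n \<in> L2_space M1" "g n \<in> L2_space M2" for n using rep by (auto simp: Gamma_rep_def)
  have sm: "summable (\<lambda>n. L2_norm M1 (f n) * L2_norm M2 (g n))" using rep by (simp add: Gamma_rep_def)
  have t: "integrable ?P (t n)" "(\<integral>p. norm (t n p) \<partial>?P) \<le> L2_norm M1 (f n) * L2_norm M2 (g n)" for n
    using tensor_integrable[OF M1.prob_space_axioms M2.prob_space_axioms L(1)[of n] L(2)[of n]]
    by (simp_all add: t_def[abs_def])
  have tsm: "summable (\<lambda>n. \<integral>p. norm (t n p) \<partial>?P)"
    by (rule summable_comparison_test[OF _ sm]) (use t(2) in auto)
  have AEs: "AE p in ?P. (\<lambda>n. t n p) sums F p"
    using mae_imp_AE[of "\<lambda>(x, y). (\<lambda>n. f n x * g n y) sums F (x, y)"] rep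
    by (auto simp: Gamma_rep_def t_def split_beta)
  note abs = AE_summable_of_integrals[OF t(1) tsm]
  have "integrable ?P (\<lambda>p. \<Sum>n. t n p)"
    by (rule integrable_suminf[OF t(1) abs tsm])
  then show int: "integrable ?P F"
    by (rule integrable_cong_AE_imp[OF _ F]) (use AEs in \<open>auto simp: sums_iff\<close>)
  define b where "b n p = K p * t n p" for n p
  have Bn: "norm (b n p) \<le> B * norm (t n p)" if "p \<in> space ?P" for n p
    using K that by (simp add: b_def bounded_kernel_def norm_mult mult_right_mono)
  have bi: "integrable ?P (b n)" for n
    unfolding b_def by (rule integrable_bounded_kernel_mult(1)[OF K t(1)])
  have bsm: "summable (\<lambda>n. \<integral>p. norm (b n p) \<partial>?P)"
  proof (rule summable_comparison_test[OF _ summable_mult[OF tsm, of B]], intro exI allI impI)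
    fix n
    have "(\<integral>p. norm (b n p) \<partial>?P) \<le> (\<integral>p. B * norm (t n p) \<partial>?P)"
      using bi t(1) Bn by (intro integral_mono) auto
    then show "norm (\<integral>p. norm (b n p) \<partial>?P) \<le> B * (\<integral>p. norm (t n p) \<partial>?P)"
      by simp
  qed
  have "(\<lambda>n. \<integral>p. b n p \<partial>?P) sums (\<integral>p. (\<Sum>n. b n p) \<partial>?P)"
    by (rule sums_integral[OF bi AE_summable_of_integrals[OF bi bsm] bsm])
  also have "(\<integral>p. (\<Sum>n. b n p) \<partial>?P) = (\<integral>p. K p * F p \<partial>?P)"
  proof (rule integral_cong_AE)
    show "AE p in ?P. (\<Sum>n. b n p) = K p * F p"
      using AEs by eventually_elim (auto simp: b_def sums_iff suminf_mult)
    have [measurable]: "b n \<in> borel_measurable ?P" for n using bi[of n] by simp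
    show "(\<lambda>p. \<Sum>n. b n p) \<in> borel_measurable ?P" by measurable
    show "(\<lambda>p. K p * F p) \<in> borel_measurable ?P"
      using F K by (auto simp: bounded_kernel_def)
  qed
  finally show "(\<lambda>n. kernel_form M1 M2 K (f n) (g n)) sums (\<integral>p. K p * F p \<partial>?P)"
    by (simp add: b_def t_def kernel_form_def)
qed

end

section \<open>Level sets of phases without operator synthesis\<close>

lemma small_abel_radius:
  fixes d e :: real
  assumes "0 < d" "0 < e"
  obtains r where "1 / 2 \<le> r" "r < 1" "1 - r \<le> d / 2" "2 * (1 - r\<^sup>2) / (d / 2) ^ 4 \<le> e"
proof -
  define t where "t = min (1 / 2) (min (d / 2) (e * (d / 2) ^ 4 / 4))"
  have t: "0 < t" "t \<le> 1 / 2" "t \<le> d / 2" "t \<le> e * (d / 2) ^ 4 / 4"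
    using assms by (simp_all add: t_def)
  have "2 * (1 - (1 - t)\<^sup>2) \<le> 4 * t" by (simp add: power2_eq_square algebra_simps)
  also have "\<dots> \<le> e * (d / 2) ^ 4" using t(4) by simp
  finally have "2 * (1 - (1 - t)\<^sup>2) / (d / 2) ^ 4 \<le> e"
    using assms by (simp add: pos_divide_le_eq)
  with that[of "1 - t"] t show ?thesis by simp
qed

lemma compact_bounded_away:
  fixes \<phi> :: "'a::topological_space \<Rightarrow> complex"
  assumes "compact W" "continuous_on W \<phi>" "\<And>p. p \<in> W \<Longrightarrow> \<phi> p \<noteq> 1"
  shows "\<exists>d>0. \<forall>p\<in>W. d \<le> norm (\<phi> p - 1)"
proof (cases "W = {}")
  case True
  then show ?thesis by (auto intro: exI[of _ 1])
next
  case False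
  have "continuous_on W (\<lambda>p. norm (\<phi> p - 1))" using assms(2) by (intro continuous_intros)
  from continuous_attains_inf[OF assms(1) False this]
  obtain p where "p \<in> W" "\<And>q. q \<in> W \<Longrightarrow> norm (\<phi> p - 1) \<le> norm (\<phi> q - 1)" by blast
  with assms(3) show ?thesis by (intro exI[of _ "norm (\<phi> p - 1)"]) simp
qed

lemma kernel_form_cut:
  fixes M :: "'a measure" and N :: "'b measure"
  assumes "prob_space M" "prob_space N" and K: "bounded_kernel M N K B" and u: "u \<in> L2_space M" and v: "v \<in> L2_space N"
    and P: "P \<in> sets M" and Q: "Q \<in> sets N"
  shows "kernel_form M N K u v = kernel_form M N (\<lambda>p. K p * indicator (P \<times> Q) p) u v +
      kernel_form M N K (\<lambda>x. indicator (space M - P) x * u x) v +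
      kernel_form M N K (\<lambda>x. indicator P x * u x) (\<lambda>y. indicator (space N - Q) y * v y)"
proof -
  have cutL: "(\<lambda>x. indicator A x * w x) \<in> L2_space L" if "A \<in> sets L" "w \<in> L2_space L"
    for A L and w :: "'c \<Rightarrow> complex"
    using that by (intro L2_space_mult_bounded(1)) (auto simp: indicator_def)
  have i: "integrable (M \<Otimes>\<^sub>M N) (\<lambda>p. K p * (u' (fst p) * v' (snd p)))"
    if "u' \<in> L2_space M" "v' \<in> L2_space N" for u' v'
    by (intro integrable_bounded_kernel_mult(1)[OF K] tensor_integrable(1) assms that)
  note i1 = i[OF cutL[OF P u] cutL[OF Q v]]
    and i2 = i[OF cutL[OF sets.compl_sets[OF P] u] v]
    and i3 = i[OF cutL[OF P u] cutL[OF sets.compl_sets[OF Q] v]]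
  have "kernel_form M N K u v =
    (\<integral>p. K p * (indicator P (fst p) * u (fst p) * (indicator Q (snd p) * v (snd p))) +
      K p * (indicator (space M - P) (fst p) * u (fst p) * v (snd p)) +
      K p * (indicator P (fst p) * u (fst p) * (indicator (space N - Q) (snd p) * v (snd p))) \<partial>(M \<Otimes>\<^sub>M N))"
    unfolding kernel_form_def
    by (intro Bochner_Integration.integral_cong refl) (auto simp: space_pair_measure indicator_def)
  also have "\<dots> = (\<integral>p. K p * (indicator P (fst p) * u (fst p) * (indicator Q (snd p) * v (snd p))) \<partial>(M \<Otimes>\<^sub>M N)) +
      kernel_form M N K (\<lambda>x. indicator (space M - P) x * u x) v +
      kernel_form M N K (\<lambda>x. indicator P x * u x) (\<lambda>y. indicator (space N - Q) y * v y)"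
    unfolding kernel_form_def using i1 i2 i3 by simp
  also have "(\<integral>p. K p * (indicator P (fst p) * u (fst p) * (indicator Q (snd p) * v (snd p))) \<partial>(M \<Otimes>\<^sub>M N)) =
      kernel_form M N (\<lambda>p. K p * indicator (P \<times> Q) p) u v"
    unfolding kernel_form_def
    by (intro Bochner_Integration.integral_cong refl) (auto simp: indicator_def)
  finally show ?thesis .
qed

lemma suminf_le_head_tail:
  fixes a :: "nat \<Rightarrow> real"
  assumes b: "summable b" and a: "\<And>n. 0 \<le> a n" "\<And>n. a n \<le> b n"
  shows "summable a" "suminf a \<le> (\<Sum>n<m. a n) + (\<Sum>n. b (n + m))"
proof -
  show s: "summable a" by (rule summable_comparison_test[OF _ b]) (use a in auto)
  have "suminf a = (\<Sum>n. a (n + m)) + (\<Sum>n<m. a n)" by (rule suminf_split_initial_segment[OF s])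
  moreover have "(\<Sum>n. a (n + m)) \<le> (\<Sum>n. b (n + m))"
    using s b by (intro suminf_le a summable_ignore_initial_segment)
  ultimately show "suminf a \<le> (\<Sum>n<m. a n) + (\<Sum>n. b (n + m))" by simp
qed

text \<open>
  An element \<open>H\<close> of \<open>\<Gamma>\<close> that vanishes on a pseudo-open set \<open>G\<close> containing \<open>{\<phi> = 1}\<close> need not be supported
  where \<open>\<phi>\<close> stays away from \<open>1\<close>, as \<open>G\<close> need not be a neighbourhood of \<open>{\<phi> = 1}\<close>. But it is so on a product
  \<open>P \<times> Q\<close> of large compact sets, on which the rectangles that make up \<open>G\<close> are relatively open. On
  \<open>P \<times> Q\<close> the Abel means are small on the support of \<open>H\<close>, and outside \<open>P \<times> Q\<close> the uniform bound for
  their operator norms applies: there the first few \<open>f n\<close> and \<open>g n\<close> have small norms, and the tail of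
  the series for \<open>H\<close> is small anyway.
\<close>

lemma abel_pairing_small:
  fixes M :: "'a::polish_space measure" and N :: "'b::polish_space measure"
  assumes "oscillating_phase M N \<phi>"
    and M: "S \<in> sets borel" "sets M = sets (restrict_space borel S)"
    and N: "T \<in> sets borel" "sets N = sets (restrict_space borel T)"
    and S0: "S0 \<in> sets M" "emeasure M (space M - S0) = 0"
    and T0: "T0 \<in> sets N" "emeasure N (space N - T0) = 0"
    and cont: "continuous_on (S0 \<times> T0) \<phi>"
    and E: "{p \<in> S0 \<times> T0. \<phi> p = 1} \<subseteq> E"
    and G: "pseudo_open M N G" "E \<subseteq> G" "vanishes_on M N G H"
    and rep: "Gamma_rep M N f g H" and e: "0 < e"
  obtains r where "1 / 2 \<le> r" "r < 1" "summable (\<lambda>n. kernel_form M N (\<lambda>p. abel_sum r (\<phi> p)) (f n) (g n))"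
    "norm (\<Sum>n. kernel_form M N (\<lambda>p. abel_sum r (\<phi> p)) (f n) (g n)) \<le> e"
proof -
  interpret oscillating_phase M N \<phi> by fact
  have L: "f n \<in> L2_space M" "g n \<in> L2_space N" for n using rep by (auto simp: Gamma_rep_def)
  define fg where "fg n = L2_norm M (f n) * L2_norm N (g n)" for n
  have fg: "summable fg" using rep by (simp add: Gamma_rep_def fg_def[abs_def])
  then have fg2: "summable (\<lambda>n. 2 * fg n)" by (rule summable_mult)
  obtain m where m: "(\<Sum>n. 2 * fg (n + m)) < e / 3"
  proof -
    have "\<forall>\<^sub>F m in sequentially. dist (\<Sum>n. 2 * fg (n + m)) 0 < e / 3"
      using suminf_exist_split2[OF fg2] e by (intro tendstoD) simp_all
    then obtain m where "dist (\<Sum>n. 2 * fg (n + m)) 0 < e / 3"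
      unfolding eventually_sequentially by blast
    then have "(\<Sum>n. 2 * fg (n + m)) < e / 3" by (simp add: dist_real_def)
    then show ?thesis by (rule that)
  qed
  define c where "c = (\<Sum>n<m. L2_norm M (f n) + L2_norm N (g n))"
  have "0 \<le> c" by (simp add: c_def sum_nonneg)
  define \<eta> where "\<eta> = e / (3 * (c + 1))"
  have \<eta>: "0 < \<eta>" "\<eta> * c \<le> e / 3" using e \<open>0 \<le> c\<close> by (simp_all add: \<eta>_def field_simps)
  obtain A B where AB: "\<And>n::nat. A n \<in> sets M" "\<And>n. B n \<in> sets N"
    and null: "marginally_null M N ((G - (\<Union>n. A n \<times> B n)) \<union> ((\<Union>n. A n \<times> B n) - G))"
    using G(1) unfolding pseudo_open_def by blast
  from null obtain X Y where XY: "X \<in> null_sets M" "Y \<in> null_sets N"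
    "(G - (\<Union>n. A n \<times> B n)) \<union> ((\<Union>n. A n \<times> B n) - G) \<subseteq> X \<times> space N \<union> space M \<times> Y"
    unfolding marginally_null_def by blast
  have full: "R - Z \<in> sets L \<and> emeasure L (space L - (R - Z)) = 0"
    if "R \<in> sets L" "emeasure L (space L - R) = 0" "Z \<in> null_sets L" for R Z and L :: "'c measure"
  proof -
    have "space L - R \<in> null_sets L" using that by (auto simp: null_sets_def)
    then have "(space L - R) \<union> Z \<in> null_sets L" using that(3) by (rule null_sets.Un)
    moreover have "R - Z \<in> sets L" using that by auto
    moreover have "space L - (R - Z) \<subseteq> (space L - R) \<union> Z" by blast
    ultimately show ?thesis
      by (metis null_setsD1 null_sets_subset sets.compl_sets)
  qed
  have "\<exists>P. compact P \<and> P \<subseteq> S0 - X \<and> P \<in> sets M \<and> (\<forall>n. closed (P - A n)) \<and>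
      (\<forall>n<m. L2_norm M (\<lambda>x. indicator (space M - P) x * f n x) \<le> \<eta>)"
    using full[OF S0 XY(1)] AB(1) L(1) \<eta>(1)
    by (intro compact_small_L2_complement[OF M.finite_measure_axioms M(2,1)]) auto
  then obtain P where P: "compact P" "P \<subseteq> S0 - X" "P \<in> sets M" "\<And>n. closed (P - A n)"
    "\<And>n. n < m \<Longrightarrow> L2_norm M (\<lambda>x. indicator (space M - P) x * f n x) \<le> \<eta>"
    by blast
  have "\<exists>Q. compact Q \<and> Q \<subseteq> T0 - Y \<and> Q \<in> sets N \<and> (\<forall>n. closed (Q - B n)) \<and>
      (\<forall>n<m. L2_norm N (\<lambda>y. indicator (space N - Q) y * g n y) \<le> \<eta>)"
    using full[OF T0 XY(2)] AB(2) L(2) \<eta>(1)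
    by (intro compact_small_L2_complement[OF N.finite_measure_axioms N(2,1)]) auto
  then obtain Q where Q: "compact Q" "Q \<subseteq> T0 - Y" "Q \<in> sets N" "\<And>n. closed (Q - B n)"
    "\<And>n. n < m \<Longrightarrow> L2_norm N (\<lambda>y. indicator (space N - Q) y * g n y) \<le> \<eta>"
    by blast
  \<comment> \<open>On \<open>P \<times> Q\<close> the pseudo-open set is honestly relatively open, so \<open>W\<close> is compact, and there \<open>\<phi> \<noteq> 1\<close>.\<close>
  define W where "W = P \<times> Q - (\<Union>n. A n \<times> B n)"
  have "W = (P \<times> Q) \<inter> (\<Inter>n. (P - A n) \<times> Q \<union> P \<times> (Q - B n))"
    by (auto simp: W_def)
  moreover have "closed (\<Inter>n. (P - A n) \<times> Q \<union> P \<times> (Q - B n))"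
    using P Q by (intro closed_INT ballI closed_Un closed_Times) (auto intro: compact_imp_closed)
  ultimately have W: "compact W" using P(1) Q(1) by (simp add: compact_Int_closed compact_Times)
  have Wm: "W \<in> sets (M \<Otimes>\<^sub>M N)" unfolding W_def using P(3) Q(3) AB by (intro sets.Diff sets.countable_UN) auto
  have PQ: "P \<times> Q \<subseteq> S0 \<times> T0" using P(2) Q(2) by auto
  have sub: "P \<subseteq> space M" "Q \<subseteq> space N"
    using sets.sets_into_space[OF P(3)] sets.sets_into_space[OF Q(3)] by auto
  have inG: "p \<in> (\<Union>n. A n \<times> B n) \<longleftrightarrow> p \<in> G" if "p \<in> P \<times> Q" for p
  proof -
    have "p \<notin> X \<times> space N \<union> space M \<times> Y" using that P(2) Q(2) by auto
    then show ?thesis using XY(3) by blast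
  qed
  have "\<exists>d>0. \<forall>p\<in>W. d \<le> norm (\<phi> p - 1)"
  proof (rule compact_bounded_away[OF W])
    show "continuous_on W \<phi>" using PQ by (intro continuous_on_subset[OF cont]) (auto simp: W_def)
    show "\<phi> p \<noteq> 1" if "p \<in> W" for p
      using that PQ E G(2) inG[of p] by (auto simp: W_def)
  qed
  then obtain d where d: "0 < d" "\<And>p. p \<in> W \<Longrightarrow> d \<le> norm (\<phi> p - 1)" by blast
  \<comment> \<open>\<open>H\<close> itself is only determined up to marginally null sets; \<open>H'\<close> is a measurable version.\<close>
  define H' where "H' p = (\<Sum>n. f n (fst p) * g n (snd p))" for p
  note [measurable] = L2_space_measurable[OF L(1)] L2_space_measurable[OF L(2)]
  have H'm: "H' \<in> borel_measurable (M \<Otimes>\<^sub>M N)" unfolding H'_def by measurable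
  have sumsH: "mae M N (\<lambda>(x, y). (\<lambda>n. f n x * g n y) sums H (x, y))"
    using rep by (simp add: Gamma_rep_def)
  have rep': "Gamma_rep M N f g H'"
    using rep unfolding Gamma_rep_def
    by (auto intro!: mae_mono[OF sumsH] simp: H'_def sums_iff)
  have H'0: "AE p in M \<Otimes>\<^sub>M N. p \<in> G \<longrightarrow> H' p = 0"
    using mae_imp_AE[OF sumsH] mae_imp_AE[OF G(3)[unfolded vanishes_on_def]]
    by eventually_elim (auto simp: H'_def sums_iff split_beta)
  \<comment> \<open>The three quantities \<open>\<eta> * c\<close>, \<open>\<delta> * h\<close> and the tail beyond \<open>m\<close> each use up a third of \<open>e\<close>.\<close>
  define h where "h = (\<integral>p. norm (H' p) \<partial>(M \<Otimes>\<^sub>M N))"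
  have "0 \<le> h" by (simp add: h_def)
  define \<delta> where "\<delta> = e / (3 * (h + 1))"
  have \<delta>: "0 < \<delta>" "\<delta> * h \<le> e / 3" using e \<open>0 \<le> h\<close> by (simp_all add: \<delta>_def field_simps)
  obtain r where r: "1 / 2 \<le> r" "r < 1" "1 - r \<le> d / 2" "2 * (1 - r\<^sup>2) / (d / 2) ^ 4 \<le> \<delta>"
    using small_abel_radius[OF d(1) \<delta>(1)] .
  have r0: "0 \<le> r" using r by simp
  define K where "K p = abel_sum r (\<phi> p)" for p
  obtain b where K: "bounded_kernel M N K b" unfolding K_def using bounded_kernel_abel[OF r0 r(2)] by blast
  have K1: "kernel_norm_le M N K 1" unfolding K_def using kernel_norm_le_abel[OF r0 r(2)] .
  have [measurable]: "K \<in> borel_measurable (M \<Otimes>\<^sub>M N)" using K by (simp add: bounded_kernel_def)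
  have KPQ: "bounded_kernel M N (\<lambda>p. K p * indicator (P \<times> Q) p) (max b 0)"
    unfolding bounded_kernel_def
  proof (intro conjI ballI)
    show "(\<lambda>p. K p * indicator (P \<times> Q) p) \<in> borel_measurable (M \<Otimes>\<^sub>M N)"
      using P(3) Q(3) by measurable
    show "norm (K p * indicator (P \<times> Q) p) \<le> max b 0" if "p \<in> space (M \<Otimes>\<^sub>M N)" for p
      using K that by (auto simp: bounded_kernel_def indicator_def le_max_iff_disj)
  qed
  have KW: "bounded_kernel M N (\<lambda>p. K p * indicator W p) \<delta>"
    unfolding bounded_kernel_def
  proof (intro conjI ballI)
    show "(\<lambda>p. K p * indicator W p) \<in> borel_measurable (M \<Otimes>\<^sub>M N)"
      using Wm by measurable
    fix p assume "p \<in> space (M \<Otimes>\<^sub>M N)"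
    then have "norm (K p) \<le> \<delta>" if "p \<in> W"
      unfolding K_def using norm_abel_sum_le[OF r0 r(2) unimodular d(1) d(2)[OF that] r(3)] r(4) by linarith
    then show "norm (K p * indicator W p) \<le> \<delta>" using \<delta>(1) by (auto simp: indicator_def)
  qed
  have s1: "(\<lambda>n. kernel_form M N (\<lambda>p. K p * indicator (P \<times> Q) p) (f n) (g n)) sums
      (\<integral>p. K p * indicator (P \<times> Q) p * H' p \<partial>(M \<Otimes>\<^sub>M N))"
    by (rule Gamma_rep_pairing(1)[OF rep' H'm KPQ])
  have "(\<integral>p. K p * indicator (P \<times> Q) p * H' p \<partial>(M \<Otimes>\<^sub>M N)) =
      (\<integral>p. K p * indicator W p * H' p \<partial>(M \<Otimes>\<^sub>M N))"
  proof (rule integral_cong_AE)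
    show "AE p in M \<Otimes>\<^sub>M N. K p * indicator (P \<times> Q) p * H' p = K p * indicator W p * H' p"
      using H'0
    proof eventually_elim
      case (elim p)
      then show ?case using inG[of p] by (cases "p \<in> P \<times> Q") (auto simp: W_def indicator_def)
    qed
    show "(\<lambda>p. K p * indicator (P \<times> Q) p * H' p) \<in> borel_measurable (M \<Otimes>\<^sub>M N)"
      by (rule borel_measurable_times[OF conjunct1[OF KPQ[unfolded bounded_kernel_def]] H'm])
    show "(\<lambda>p. K p * indicator W p * H' p) \<in> borel_measurable (M \<Otimes>\<^sub>M N)"
      by (rule borel_measurable_times[OF conjunct1[OF KW[unfolded bounded_kernel_def]] H'm])
  qed
  also have "norm \<dots> \<le> \<delta> * h"
    unfolding h_def by (rule integrable_bounded_kernel_mult(2)[OF KW Gamma_rep_pairing(2)[OF rep' H'm KW]])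
  finally have main: "norm (\<integral>p. K p * indicator (P \<times> Q) p * H' p \<partial>(M \<Otimes>\<^sub>M N)) \<le> e / 3"
    using \<delta>(2) by simp
  \<comment> \<open>What is lost by cutting down to \<open>P \<times> Q\<close>.\<close>
  define R where "R n = kernel_form M N K (\<lambda>x. indicator (space M - P) x * f n x) (g n) +
      kernel_form M N K (\<lambda>x. indicator P x * f n x) (\<lambda>y. indicator (space N - Q) y * g n y)" for n
  define a where "a n = L2_norm M (\<lambda>x. indicator (space M - P) x * f n x) * L2_norm N (g n) +
      L2_norm M (f n) * L2_norm N (\<lambda>y. indicator (space N - Q) y * g n y)" for n
  have cutM: "(\<lambda>x. indicator A x * f n x) \<in> L2_space M" "L2_norm M (\<lambda>x. indicator A x * f n x) \<le> L2_norm M (f n)"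
    if "A \<in> sets M" for A n
    using that L2_space_mult_bounded[OF L(1), of "indicator A" n] by (auto simp: indicator_def)
  have cutN: "(\<lambda>y. indicator A y * g n y) \<in> L2_space N" "L2_norm N (\<lambda>y. indicator A y * g n y) \<le> L2_norm N (g n)"
    if "A \<in> sets N" for A n
    using that L2_space_mult_bounded[OF L(2), of "indicator A" n] by (auto simp: indicator_def)
  have cP: "space M - P \<in> sets M" "space N - Q \<in> sets N" using P(3) Q(3) by auto
  have Ra: "norm (R n) \<le> a n" for n
  proof -
    have "norm (kernel_form M N K (\<lambda>x. indicator (space M - P) x * f n x) (g n)) \<le>
        1 * (L2_norm M (\<lambda>x. indicator (space M - P) x * f n x) * L2_norm N (g n))"
      using K1 cutM(1)[OF cP(1)] L(2) unfolding kernel_norm_le_def by blast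
    moreover have "norm (kernel_form M N K (\<lambda>x. indicator P x * f n x) (\<lambda>y. indicator (space N - Q) y * g n y)) \<le>
        1 * (L2_norm M (\<lambda>x. indicator P x * f n x) * L2_norm N (\<lambda>y. indicator (space N - Q) y * g n y))"
      using K1 cutM(1)[OF P(3)] cutN(1)[OF cP(2)] unfolding kernel_norm_le_def by blast
    moreover have "L2_norm M (\<lambda>x. indicator P x * f n x) * L2_norm N (\<lambda>y. indicator (space N - Q) y * g n y) \<le>
        L2_norm M (f n) * L2_norm N (\<lambda>y. indicator (space N - Q) y * g n y)"
      by (intro mult_right_mono cutM(2) P(3)) simp
    ultimately show ?thesis unfolding R_def a_def
      by (intro order_trans[OF norm_triangle_ineq]) linarith
  qed
  have a0: "0 \<le> a n" for n by (simp add: a_def)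
  have a2: "a n \<le> 2 * fg n" for n
    unfolding a_def fg_def using cutM(2)[OF cP(1), of n] cutN(2)[OF cP(2), of n]
    by (smt (verit) L2_norm_nonneg mult_left_mono mult_right_mono)
  note asum = suminf_le_head_tail[OF fg2 a0 a2]
  have "(\<Sum>n<m. a n) \<le> (\<Sum>n<m. \<eta> * (L2_norm M (f n) + L2_norm N (g n)))"
  proof (rule sum_mono)
    fix n assume "n \<in> {..<m}"
    then have "L2_norm M (\<lambda>x. indicator (space M - P) x * f n x) * L2_norm N (g n) \<le> \<eta> * L2_norm N (g n)"
        "L2_norm M (f n) * L2_norm N (\<lambda>y. indicator (space N - Q) y * g n y) \<le> L2_norm M (f n) * \<eta>"
      using P(5) Q(5) by (auto intro!: mult_right_mono mult_left_mono)
    then show "a n \<le> \<eta> * (L2_norm M (f n) + L2_norm N (g n))"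
      unfolding a_def by (simp add: algebra_simps)
  qed
  also have "\<dots> = \<eta> * c" by (simp add: c_def sum_distrib_left)
  finally have "(\<Sum>n<m. a n) \<le> e / 3" using \<eta>(2) by simp
  then have "suminf a \<le> 2 * e / 3" using asum(2)[of m] m by simp
  moreover have "norm (\<Sum>n. R n) \<le> suminf a" by (rule norm_suminf_le[OF Ra asum(1)])
  ultimately have R: "norm (\<Sum>n. R n) \<le> 2 * e / 3" by simp
  have Rs: "summable R" by (rule summable_comparison_test[OF _ asum(1)]) (use Ra in auto)
  have split: "kernel_form M N K (f n) (g n) =
      kernel_form M N (\<lambda>p. K p * indicator (P \<times> Q) p) (f n) (g n) + R n" for n
    unfolding R_def using kernel_form_cut[OF M.prob_space_axioms N.prob_space_axioms K L(1)[of n] L(2)[of n] P(3) Q(3)] by simp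
  have "(\<lambda>n. kernel_form M N K (f n) (g n)) sums
      ((\<integral>p. K p * indicator (P \<times> Q) p * H' p \<partial>(M \<Otimes>\<^sub>M N)) + (\<Sum>n. R n))"
    unfolding split by (intro sums_add s1 summable_sums Rs)
  moreover have "norm ((\<integral>p. K p * indicator (P \<times> Q) p * H' p \<partial>(M \<Otimes>\<^sub>M N)) + (\<Sum>n. R n)) \<le> e"
    using norm_triangle_ineq[of "\<integral>p. K p * indicator (P \<times> Q) p * H' p \<partial>(M \<Otimes>\<^sub>M N)" "\<Sum>n. R n"] main R
    by simp
  ultimately show ?thesis
    using that[OF r(1,2)] by (simp add: K_def[abs_def] sums_iff)
qed

text \<open>
  The witness is \<open>\<phi> - 1\<close>. If it were close to some \<open>H\<close> in \<open>\<Gamma>\<close> vanishing on a pseudo-open set that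
  contains \<open>E\<close>, then its pairing with the Abel means would be small for some radius, against
  \<open>norm_abel_pairing_ge\<close>.
\<close>

theorem phase_level_set_not_synthesis:
  fixes M :: "'a::polish_space measure" and N :: "'b::polish_space measure"
  assumes phase: "oscillating_phase M N \<phi>"
    and M: "S \<in> sets borel" "sets M = sets (restrict_space borel S)"
    and N: "T \<in> sets borel" "sets N = sets (restrict_space borel T)"
    and S0: "S0 \<in> sets M" "emeasure M (space M - S0) = 0"
    and T0: "T0 \<in> sets N" "emeasure N (space N - T0) = 0"
    and cont: "continuous_on (S0 \<times> T0) \<phi>"
    and E: "\<And>p. p \<in> S0 \<times> T0 \<Longrightarrow> p \<in> E \<longleftrightarrow> \<phi> p = 1"
    and Gamma: "(\<lambda>p. \<phi> p - 1) \<in> Gamma_space M N"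
  shows "\<not> operator_synthesis M N E"
proof
  interpret oscillating_phase M N \<phi> by fact
  assume syn: "operator_synthesis M N E"
  have "space M - S0 \<in> null_sets M" "space N - T0 \<in> null_sets N"
    using S0 T0 by (auto simp: null_sets_def)
  moreover have "{p \<in> space M \<times> space N. (\<phi> p - 1) * indicator E p \<noteq> 0} \<subseteq>
      ((space M - S0) \<times> space N) \<union> (space M \<times> (space N - T0))"
    using E by (auto simp: indicator_def split: if_splits)
  ultimately have "vanishes_on M N E (\<lambda>p. \<phi> p - 1)"
    unfolding vanishes_on_def mae_def marginally_null_def by blast
  then have "(\<lambda>p. \<phi> p - 1) \<in> Phi0 M N E"
    using Gamma syn by (simp add: operator_synthesis_def Phi_def)
  then have "\<forall>\<epsilon>>0. \<exists>H\<in>{F \<in> Gamma_space M N. \<exists>G. pseudo_open M N G \<and> E \<subseteq> G \<and> vanishes_on M N G F}.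
      Gamma_norm M N (\<lambda>p. (\<phi> p - 1) - H p) < \<epsilon>"
    unfolding Phi0_def Gamma_closure_def by simp
  from this[rule_format, of "1 / 16"]
  have "\<exists>H\<in>{F \<in> Gamma_space M N. \<exists>G. pseudo_open M N G \<and> E \<subseteq> G \<and> vanishes_on M N G F}.
      Gamma_norm M N (\<lambda>p. (\<phi> p - 1) - H p) < 1 / 16" by simp
  then obtain H G where H: "H \<in> Gamma_space M N" "pseudo_open M N G" "E \<subseteq> G" "vanishes_on M N G H"
      "Gamma_norm M N (\<lambda>p. (\<phi> p - 1) - H p) < 1 / 16"
    by blast
  obtain f g where rep: "Gamma_rep M N f g H" using H(1) by (auto simp: Gamma_space_def)
  obtain p q where repD: "Gamma_rep M N p q (\<lambda>z. (\<phi> z - 1) - H z)"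
      and less: "(\<Sum>n. L2_norm M (p n) * L2_norm N (q n)) < 1 / 16"
    using Gamma_rep_of_norm_less[OF Gamma H(1,5)] .
  obtain r where r: "1 / 2 \<le> r" "r < 1" and
    s: "summable (\<lambda>n. kernel_form M N (\<lambda>p. abel_sum r (\<phi> p)) (f n) (g n))"
    "norm (\<Sum>n. kernel_form M N (\<lambda>p. abel_sum r (\<phi> p)) (f n) (g n)) \<le> 1 / 16"
    using abel_pairing_small[OF phase M N S0 T0 cont _ H(2,3,4) rep, of "1 / 16"] E by auto
  have r0: "0 \<le> r" using r by simp
  define K where "K p = abel_sum r (\<phi> p)" for p
  have K1: "kernel_norm_le M N K 1" unfolding K_def using kernel_norm_le_abel[OF r0 r(2)] .
  obtain b where K: "bounded_kernel M N K b" unfolding K_def using bounded_kernel_abel[OF r0 r(2)] by blast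
  have "Gamma_rep M N (interleave f p) (interleave g q) (\<lambda>z. \<phi> z - 1)"
    using Gamma_rep_add[OF rep repD] by simp
  from Gamma_rep_pairing(1)[OF this _ K]
  have "(\<lambda>n. kernel_form M N K (interleave f p n) (interleave g q n)) sums (\<integral>z. K z * (\<phi> z - 1) \<partial>(M \<Otimes>\<^sub>M N))"
    by simp
  moreover have "(\<lambda>n. kernel_form M N K (interleave f p n) (interleave g q n)) =
      interleave (\<lambda>n. kernel_form M N K (f n) (g n)) (\<lambda>n. kernel_form M N K (p n) (q n))"
    by (auto simp: interleave_def)
  ultimately have total: "interleave (\<lambda>n. kernel_form M N K (f n) (g n)) (\<lambda>n. kernel_form M N K (p n) (q n))
      sums (\<integral>z. K z * (\<phi> z - 1) \<partial>(M \<Otimes>\<^sub>M N))" by simp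
  have pq: "summable (\<lambda>n. L2_norm M (p n) * L2_norm N (q n))"
    using repD by (simp add: Gamma_rep_def)
  have le: "norm (kernel_form M N K (p n) (q n)) \<le> L2_norm M (p n) * L2_norm N (q n)" for n
    using K1 repD unfolding kernel_norm_le_def Gamma_rep_def by fastforce
  have sp: "summable (\<lambda>n. kernel_form M N K (p n) (q n))"
    by (rule summable_comparison_test[OF _ pq]) (use le in auto)
  have small: "norm (\<Sum>n. kernel_form M N K (p n) (q n)) \<le> 1 / 16"
    "norm (\<Sum>n. kernel_form M N K (f n) (g n)) \<le> 1 / 16"
    using norm_suminf_le[OF le pq] less s(2) by (simp_all add: K_def[abs_def])
  have "(\<integral>z. K z * (\<phi> z - 1) \<partial>(M \<Otimes>\<^sub>M N)) =
      (\<Sum>n. kernel_form M N K (f n) (g n)) + (\<Sum>n. kernel_form M N K (p n) (q n))"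
    using sums_unique2[OF total sums_interleave] s(1) sp by (simp add: K_def[abs_def] summable_sums)
  then have "norm (\<integral>z. K z * (\<phi> z - 1) \<partial>(M \<Otimes>\<^sub>M N)) \<le> 1 / 16 + 1 / 16"
    using norm_triangle_mono[OF small(2,1)] by simp
  moreover have "1 / 4 \<le> norm (\<integral>z. K z * (\<phi> z - 1) \<partial>(M \<Otimes>\<^sub>M N))"
    unfolding K_def by (rule norm_abel_pairing_ge[OF r])
  ultimately show False by simp
qed

section \<open>A phase on sequences of coin tosses\<close>

definition coin :: "(nat \<Rightarrow> bool) measure" where
  "coin = (\<Pi>\<^sub>M k\<in>UNIV. measure_pmf (bernoulli_pmf (1 / 2)))"

definition flip :: "nat \<Rightarrow> (nat \<Rightarrow> bool) \<Rightarrow> nat \<Rightarrow> bool" where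
  "flip k x = x(k := \<not> x k)"

interpretation coin_product: product_prob_space "\<lambda>_::nat. measure_pmf (bernoulli_pmf (1 / 2))" UNIV
  by unfold_locales

lemma prob_space_coin: "prob_space coin"
  unfolding coin_def by unfold_locales

lemma space_coin [simp]: "space coin = UNIV"
  by (simp add: coin_def space_PiM)

lemma measurable_coin_bit [measurable]: "Measurable.pred coin (\<lambda>x. x k)"
proof -
  have "(\<lambda>x. x k) \<in> measurable coin (measure_pmf (bernoulli_pmf (1 / 2)))"
    unfolding coin_def by (rule measurable_component_singleton) simp
  then show ?thesis by simp
qed

lemma measurable_into_coin:
  assumes "\<And>k. Measurable.pred M (\<lambda>x. f x k)"
  shows "f \<in> measurable M coin"
  unfolding coin_def using assms by (intro measurable_PiM_single') auto

lemma measurable_flip [measurable]: "flip k \<in> measurable coin coin"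
proof (rule measurable_into_coin)
  show "Measurable.pred coin (\<lambda>x. flip k x j)" for j
    by (cases "j = k") (simp_all add: flip_def)
qed

text \<open>
  Both measures agree on cylinder sets, because a fair coin is invariant under negation.
\<close>

lemma distr_flip: "distr coin coin (flip k) = coin"
proof -
  let ?B = "measure_pmf (bernoulli_pmf (1 / 2))"
  let ?M = "\<lambda>_::nat. ?B"
  have "map_pmf Not (bernoulli_pmf (1 / 2)) = bernoulli_pmf (1 / 2)"
  proof (rule pmf_eqI)
    fix b :: bool
    have "pmf (map_pmf Not (bernoulli_pmf (1 / 2))) (\<not> (\<not> b)) = pmf (bernoulli_pmf (1 / 2)) (\<not> b)"
      by (rule pmf_map_inj') (simp add: inj_def)
    then show "pmf (map_pmf Not (bernoulli_pmf (1 / 2))) b = pmf (bernoulli_pmf (1 / 2)) b"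
      by (cases b) simp_all
  qed
  then have not: "emeasure ?B (Not -` A) = emeasure ?B A" for A
    using emeasure_map_pmf[of Not "bernoulli_pmf (1 / 2)" A] by simp
  have "distr coin coin (flip k) = PiM UNIV ?M"
  proof (rule coin_product.PiM_eq)
    show "sets (distr coin coin (flip k)) = sets (PiM UNIV ?M)" by (simp add: coin_def)
    fix J :: "nat set" and F :: "nat \<Rightarrow> bool set"
    assume J: "finite J"
    define F' where "F' j = (if j = k then Not -` F j else F j)" for j
    have m: "prod_emb UNIV ?M J (Pi\<^sub>E J F) \<in> sets coin"
      unfolding coin_def using J by (intro sets_PiM_I) auto
    have "flip k -` prod_emb UNIV ?M J (Pi\<^sub>E J F) \<inter> space coin = prod_emb UNIV ?M J (Pi\<^sub>E J F')"
      by (auto simp: prod_emb_def flip_def F'_def PiE_iff space_PiM split: if_splits)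
    then have "emeasure (distr coin coin (flip k)) (prod_emb UNIV ?M J (Pi\<^sub>E J F)) =
        emeasure (PiM UNIV ?M) (prod_emb UNIV ?M J (Pi\<^sub>E J F'))"
      using m by (simp add: emeasure_distr) (simp add: coin_def)
    also have "\<dots> = (\<Prod>j\<in>J. emeasure ?B (F' j))"
      using J by (intro coin_product.emeasure_PiM_emb) auto
    also have "\<dots> = (\<Prod>j\<in>J. emeasure ?B (F j))"
      by (intro prod.cong) (auto simp: F'_def not)
    finally show "emeasure (distr coin coin (flip k)) (prod_emb UNIV ?M J (Pi\<^sub>E J F)) =
        (\<Prod>j\<in>J. emeasure ?B (F j))" .
  qed
  then show ?thesis by (simp add: coin_def)
qed

definition bit_phase :: "(nat \<Rightarrow> real) \<Rightarrow> (nat \<Rightarrow> bool) \<times> (nat \<Rightarrow> bool) \<Rightarrow> complex" where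
  "bit_phase a p = cis (\<Sum>k. a k * of_bool (fst p k \<and> snd p k))"

lemma bit_phase_summable:
  fixes a :: "nat \<Rightarrow> real"
  assumes "summable a" "\<And>k. 0 \<le> a k"
  shows "summable (\<lambda>k. a k * of_bool (P k))"
  by (rule summable_comparison_test[OF _ assms(1)]) (use assms(2) in auto)

lemma borel_measurable_cis [measurable (raw)]:
  "f \<in> borel_measurable M \<Longrightarrow> (\<lambda>x. cis (f x)) \<in> borel_measurable M"
  by (rule measurable_compose[where g=cis], assumption, rule borel_measurable_continuous_onI)
     (intro continuous_intros)

lemma bounded_kernel_bit_phase: "bounded_kernel coin coin (bit_phase a) 1"
  unfolding bounded_kernel_def
proof (intro conjI ballI)
  have [measurable]: "Measurable.pred (coin \<Otimes>\<^sub>M coin) (\<lambda>p. fst p k)"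
    "Measurable.pred (coin \<Otimes>\<^sub>M coin) (\<lambda>p. snd p k)" for k
    by (rule measurable_compose[OF measurable_fst measurable_coin_bit])
       (rule measurable_compose[OF measurable_snd measurable_coin_bit])
  show "bit_phase a \<in> borel_measurable (coin \<Otimes>\<^sub>M coin)"
    unfolding bit_phase_def[abs_def] of_bool_def by measurable
qed (simp add: bit_phase_def)

lemma bit_phase_extract:
  assumes a: "summable a" "\<And>k. 0 \<le> a k"
  shows "bit_phase a p = bit_phase (a(k := 0)) p * (if fst p k \<and> snd p k then cis (a k) else 1)"
proof -
  let ?b = "\<lambda>i. of_bool (fst p i \<and> snd p i) :: real"
  have "summable (\<lambda>i. (a(k := 0)) i)"
    by (rule summable_comparison_test[OF _ a(1)]) (use a(2) in auto)
  then have "(\<lambda>i. (a(k := 0)) i * ?b i) sums (\<Sum>i. (a(k := 0)) i * ?b i)"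
    using a(2) by (intro summable_sums bit_phase_summable) auto
  from sums_add[OF this sums_single[of k "\<lambda>i. a i * ?b i"]]
  have "(\<lambda>i. (a(k := 0)) i * ?b i + (if i = k then a i * ?b i else 0)) sums
      ((\<Sum>i. (a(k := 0)) i * ?b i) + a k * ?b k)" .
  moreover have "(\<lambda>i. (a(k := 0)) i * ?b i + (if i = k then a i * ?b i else 0)) = (\<lambda>i. a i * ?b i)"
    by auto
  ultimately have "(\<Sum>i. a i * ?b i) = (\<Sum>i. (a(k := 0)) i * ?b i) + a k * ?b k"
    by (simp add: sums_iff)
  then show ?thesis unfolding bit_phase_def by (simp flip: cis_mult)
qed

text \<open>
  The bits in \<open>J\<close> are split off one at a time. What remains after the last one is a unimodular kernel,
  of norm at most \<open>1\<close>.
\<close>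

lemma kernel_norm_le_bit_phase:
  assumes "finite J" "summable a" "\<And>k. 0 \<le> a k" "\<And>k. k \<in> J \<Longrightarrow> cos (a k) \<le> 0"
  shows "kernel_norm_le coin coin (bit_phase a) ((15 / 16) ^ card J)"
  using assms
proof (induction J arbitrary: a rule: finite_induct)
  case empty
  show ?case
    using kernel_norm_le_bounded[OF prob_space_coin prob_space_coin bounded_kernel_bit_phase] by simp
next
  case (insert k J)
  let ?a = "a(k := 0)"
  have a: "summable ?a"
    by (rule summable_comparison_test[OF _ insert.prems(1)]) (use insert.prems(2) in auto)
  have "kernel_norm_le coin coin (bit_phase ?a) ((15 / 16) ^ card J)"
    using insert by (intro insert.IH a) auto
  moreover have "bit_phase ?a (flip k x, y) = bit_phase ?a (x, y)"
      "bit_phase ?a (x, flip k y) = bit_phase ?a (x, y)" for x y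
    unfolding bit_phase_def by (intro arg_cong[where f = cis] suminf_cong; simp add: flip_def)+
  moreover have "norm (1 + cis (a k)) \<le> 3 / 2"
  proof (rule power2_le_imp_le)
    have "(norm (1 + cis (a k)))\<^sup>2 = 1 + 2 * cos (a k) + ((cos (a k))\<^sup>2 + (sin (a k))\<^sup>2)"
      unfolding cmod_power2 by (simp add: power2_eq_square algebra_simps)
    also have "\<dots> \<le> (3 / 2)\<^sup>2" using insert.prems(3)[of k] by (simp add: power2_eq_square)
    finally show "(norm (1 + cis (a k)))\<^sup>2 \<le> (3 / 2)\<^sup>2" .
  qed simp
  ultimately have "kernel_norm_le coin coin
      (\<lambda>p. bit_phase ?a p * (if fst p k \<and> snd p k then cis (a k) else 1)) (15 / 16 * (15 / 16) ^ card J)"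
    by (intro kernel_norm_le_bit[OF prob_space_coin measurable_flip[of k] distr_flip measurable_coin_bit
          _ bounded_kernel_bit_phase]) (simp_all add: flip_def)
  moreover have "(\<lambda>p. bit_phase ?a p * (if fst p k \<and> snd p k then cis (a k) else 1)) = bit_phase a"
    using bit_phase_extract[OF insert.prems(1,2)] by auto
  ultimately show ?case using insert.hyps by simp
qed

text \<open>
  The value \<open>pi / 2 ^ j\<close> is taken on the \<open>50 * (2 * j + 1)\<close> indices from \<open>50 * j\<^sup>2\<close> up to
  \<open>50 * (j + 1)\<^sup>2 - 1\<close>. The multiplicities have to grow, because the norm of \<open>\<phi> ^ n\<close> for \<open>n\<close> close to
  \<open>2 ^ j\<close> is estimated by the bits of this block only, and it has to beat a power of \<open>n\<close>.
\<close>

definition angle :: "nat \<Rightarrow> real" where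
  "angle k = pi / 2 ^ floor_sqrt (k div 50)"

lemma angle_pos: "0 < angle k"
  by (simp add: angle_def)

text \<open>
  For \<open>s = floor_sqrt (k div 50)\<close> one has \<open>k < 50 * (s + 1)\<^sup>2\<close>, so \<open>angle k\<close> is at most a constant
  times \<open>1 / (k + 1)\<^sup>2\<close>.
\<close>

lemma fourth_power_le: "(s + 1) ^ 4 \<le> 64 * 2 ^ s" for s :: nat
proof (cases "s \<le> 5")
  case True
  then have "s \<in> {0, 1, 2, 3, 4, 5}" by auto
  then show ?thesis by (auto simp: power4_eq_xxxx)
next
  case False
  then have "5 \<le> s" by simp
  then show ?thesis
  proof (induction s rule: dec_induct)
    case (step s)
    have "(6 * (s + 2)) ^ 4 \<le> (7 * (s + 1)) ^ 4" by (rule power_mono) (use step.hyps in auto)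
    then have "1296 * (s + 2) ^ 4 \<le> 2401 * (s + 1) ^ 4" unfolding power_mult_distrib by simp
    then have "(s + 2) ^ 4 \<le> 2 * (s + 1) ^ 4" by linarith
    also have "\<dots> \<le> 2 * (64 * 2 ^ s)" using step.IH by (rule mult_left_mono) simp
    finally show ?case by simp
  qed simp
qed

lemma summable_angle: "summable angle"
proof (rule summable_comparison_test, intro exI allI impI)
  show "summable (\<lambda>k. pi * 160000 * inverse (real (Suc k) ^ 2))"
    by (intro summable_mult summable_Suc_iff[of "\<lambda>k. inverse (real k ^ 2)", THEN iffD2]
        inverse_power_summable) simp
  fix k :: nat
  define s where "s = floor_sqrt (k div 50)"
  have "k div 50 < (Suc s)\<^sup>2" unfolding s_def by (rule Suc_floor_sqrt_power2_gt)
  then have "Suc k \<le> 50 * (s + 1)\<^sup>2" by (simp add: div_less_iff_less_mult mult.commute)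
  then have "(Suc k)\<^sup>2 \<le> (50 * (s + 1)\<^sup>2)\<^sup>2" by (rule power_mono) simp
  also have "\<dots> = 2500 * (s + 1) ^ 4" by (simp add: power_mult_distrib flip: power_mult)
  also have "\<dots> \<le> 2500 * (64 * 2 ^ s)" by (intro mult_left_mono fourth_power_le) simp
  finally have "real ((Suc k)\<^sup>2) \<le> real (2500 * (64 * 2 ^ s))" by (rule of_nat_mono)
  then have "1 / 2 ^ s \<le> 160000 / real (Suc k) ^ 2"
    by (simp add: divide_simps del: of_nat_Suc)
  then have "pi * (1 / 2 ^ s) \<le> pi * (160000 / real (Suc k) ^ 2)"
    by (intro mult_left_mono) simp_all
  then show "norm (angle k) \<le> pi * 160000 * inverse (real (Suc k) ^ 2)"
    by (simp add: angle_def s_def divide_inverse)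
qed

lemma kernel_norm_le_mono: "kernel_norm_le M N K c \<Longrightarrow> c \<le> d \<Longrightarrow> kernel_norm_le M N K d"
  unfolding kernel_norm_le_def
  by (meson L2_norm_nonneg mult_nonneg_nonneg mult_right_mono order_trans)

lemma bit_phase_power: "bit_phase angle p ^ n = bit_phase (\<lambda>k. real n * angle k) p"
proof -
  have "summable (\<lambda>k. angle k * of_bool (fst p k \<and> snd p k))"
    using angle_pos by (intro bit_phase_summable summable_angle less_imp_le)
  from suminf_mult[OF this, of "real n"] show ?thesis
    unfolding bit_phase_def Complex.DeMoivre by (simp add: mult.assoc)
qed

text \<open>
  For \<open>2 ^ (j - 1) \<le> n < 2 ^ j\<close> and the at least \<open>99 * j\<close> indices with angle \<open>pi / 2 ^ j\<close>, the number
  \<open>n * angle k\<close> lies between \<open>pi / 2\<close> and \<open>pi\<close>, so all these bits contribute.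
\<close>

lemma bit_phase_powers_decay:
  assumes "1 \<le> n"
  shows "kernel_norm_le coin coin (\<lambda>p. bit_phase angle p ^ n) (decay n)"
proof -
  obtain i where i: "2 ^ i \<le> n" "n < 2 ^ (i + 1)" using ex_power_ivl1[of 2 n] assms by auto
  define j where "j = i + 1"
  have j: "2 ^ j \<le> 2 * n" "n + 1 \<le> 2 ^ j" using i by (simp_all add: j_def)
  \<comment> \<open>Part of the block where \<open>angle k = pi / 2 ^ j\<close>; then \<open>n * angle k\<close> lies in \<open>{pi / 2..pi}\<close>.\<close>
  define J where "J = {50 * j\<^sup>2 ..< 50 * j\<^sup>2 + 99 * j}"
  have sq: "floor_sqrt (k div 50) = j" if "k \<in> J" for k
  proof (rule floor_sqrt_unique)
    have k: "50 * j\<^sup>2 \<le> k" "k < 50 * j\<^sup>2 + 99 * j" using that by (auto simp: J_def)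
    show "j\<^sup>2 \<le> k div 50" using k(1) by (simp add: less_eq_div_iff_mult_less_eq mult.commute)
    have "k < 50 * (Suc j)\<^sup>2" using k(2) by (simp add: power2_eq_square)
    then show "k div 50 < (Suc j)\<^sup>2" by (simp add: div_less_iff_less_mult mult.commute)
  qed
  have "cos (real n * angle k) \<le> 0" if "k \<in> J" for k
  proof -
    have "real (2 ^ j) \<le> real (2 * n)" "real n \<le> real (2 ^ j)"
      using j unfolding of_nat_le_iff by auto
    then have "1 / 2 \<le> real n / 2 ^ j" "real n / 2 ^ j \<le> 1" by (simp_all add: field_simps)
    then have "pi * (1 / 2) \<le> pi * (real n / 2 ^ j)" "pi * (real n / 2 ^ j) \<le> pi * 1"
      by (intro mult_left_mono; simp)+
    then have "pi / 2 \<le> real n * angle k" "real n * angle k \<le> pi"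
      using sq[OF that] by (simp_all add: angle_def mult.commute)
    from cos_monotone_0_pi_le[OF _ this] show ?thesis by simp
  qed
  then have "kernel_norm_le coin coin (bit_phase (\<lambda>k. real n * angle k)) ((15 / 16) ^ card J)"
    using angle_pos by (intro kernel_norm_le_bit_phase summable_mult summable_angle)
      (auto simp: J_def less_imp_le)
  moreover have "(15 / 16) ^ card J \<le> decay n"
  proof -
    have "(15 / 16 :: real) ^ card J = ((15 / 16) ^ 11) ^ (9 * j)"
      by (simp add: J_def flip: power_mult)
    \<comment> \<open>Eleven factors \<open>15 / 16\<close> multiply to less than \<open>1 / 2\<close>.\<close>
    also have "\<dots> \<le> (1 / 2) ^ (9 * j)" by (intro power_mono) (simp_all add: power_divide)
    also have "\<dots> = 1 / (2 ^ (6 * j) * (2 ^ j) ^ 3)"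
      by (simp add: power_divide flip: power_mult power_add)
    also have "\<dots> \<le> 1 / (64 * (real n + 1) ^ 3)"
    proof (intro divide_left_mono mult_mono power_mono)
      have "(64::real) * 1 \<le> 64 * 64 ^ i" by (intro mult_left_mono) simp_all
      then show "(64::real) \<le> 2 ^ (6 * j)" by (simp add: j_def power_mult power_add)
      have "real (n + 1) \<le> real (2 ^ j)" using j(2) unfolding of_nat_le_iff .
      then show "real n + 1 \<le> 2 ^ j" by simp
    qed auto
    finally show ?thesis by (simp add: decay_def)
  qed
  ultimately show ?thesis by (simp add: bit_phase_power kernel_norm_le_mono)
qed

section \<open>Spectral synthesis from approximations of the identity\<close>

lemma C_space_bounded:
  assumes X: "compact_space X" and f: "f \<in> C_space X"
  shows "bdd_above (insert 0 ((\<lambda>x. norm (f x)) ` topspace X))"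
proof -
  have "compactin euclidean (f ` topspace X)"
    using X f by (intro image_compactin[of X]) (auto simp: compact_space_def C_space_def)
  then have "bounded (f ` topspace X)" by (simp add: compact_imp_bounded)
  then obtain B where "\<And>x. x \<in> topspace X \<Longrightarrow> norm (f x) \<le> B" by (auto simp: bounded_iff)
  then show ?thesis by (auto intro!: bdd_aboveI[of _ "max B 0"] simp: le_max_iff_disj)
qed

lemma norm_le_sup_norm:
  assumes "compact_space X" "f \<in> C_space X" "x \<in> topspace X"
  shows "norm (f x) \<le> sup_norm X f"
  unfolding sup_norm_def using assms by (intro cSup_upper C_space_bounded) auto

lemma sup_norm_nonneg:
  assumes "compact_space X" "f \<in> C_space X"
  shows "0 \<le> sup_norm X f"
  unfolding sup_norm_def using assms by (intro cSup_upper C_space_bounded) auto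

lemma sup_norm_le:
  assumes "0 \<le> B" "\<And>x. x \<in> topspace X \<Longrightarrow> norm (f x) \<le> B"
  shows "sup_norm X f \<le> B"
  unfolding sup_norm_def by (rule cSup_least) (use assms in auto)

lemma V_norm_le:
  assumes X: "compact_space X" and Y: "compact_space Y" and rep: "V_rep X Y f g \<Phi>"
  shows "0 \<le> V_norm X Y \<Phi>" "V_norm X Y \<Phi> \<le> (\<Sum>i. sup_norm X (f i) * sup_norm Y (g i))"
proof -
  let ?A = "{\<Sum>i. sup_norm X (f i) * sup_norm Y (g i) |f g. V_rep X Y f g \<Phi>}"
  have nn: "0 \<le> a" if "a \<in> ?A" for a
    using that X Y by (auto simp: V_rep_def intro!: suminf_nonneg mult_nonneg_nonneg sup_norm_nonneg)
  have mem: "(\<Sum>i. sup_norm X (f i) * sup_norm Y (g i)) \<in> ?A" using rep by blast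
  show "0 \<le> V_norm X Y \<Phi>" unfolding V_norm_def using mem nn by (intro cInf_greatest) auto
  show "V_norm X Y \<Phi> \<le> (\<Sum>i. sup_norm X (f i) * sup_norm Y (g i))"
    unfolding V_norm_def by (rule cInf_lower[OF mem bdd_belowI[OF nn]])
qed

text \<open>
  Composition with \<open>\<theta> n \<times> \<kappa> n\<close> does not increase the norm of \<open>V(X,Y)\<close>, and converges to the identity on
  elementary tensors, hence on all of \<open>V(X,Y)\<close> by dominated convergence for series. A function that
  vanishes on \<open>E\<close> is turned into one that vanishes on the preimage of \<open>E\<close>, an open set containing \<open>E\<close>.
\<close>

theorem spectral_synthesis_by_inner_maps:
  fixes \<theta> :: "nat \<Rightarrow> 'a \<Rightarrow> 'a" and \<kappa> :: "nat \<Rightarrow> 'b \<Rightarrow> 'b"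
  assumes X: "compact_space X" and Y: "compact_space Y"
    and \<theta>: "\<And>n. continuous_map X X (\<theta> n)" and \<kappa>: "\<And>n. continuous_map Y Y (\<kappa> n)"
    and conv\<theta>: "\<And>f. f \<in> C_space X \<Longrightarrow> (\<lambda>n. sup_norm X (\<lambda>x. f x - f (\<theta> n x))) \<longlonglongrightarrow> 0"
    and conv\<kappa>: "\<And>g. g \<in> C_space Y \<Longrightarrow> (\<lambda>n. sup_norm Y (\<lambda>y. g y - g (\<kappa> n y))) \<longlonglongrightarrow> 0"
    and op: "\<And>n. openin (prod_topology X Y)
        {p \<in> topspace X \<times> topspace Y. (\<theta> n (fst p), \<kappa> n (snd p)) \<in> E}"
    and E: "E \<subseteq> topspace X \<times> topspace Y"
    and inv: "\<And>n x y. (x, y) \<in> E \<Longrightarrow> (\<theta> n x, \<kappa> n y) \<in> E"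
  shows "spectral_synthesis X Y E"
  unfolding spectral_synthesis_def
proof (intro ballI impI)
  fix \<Phi> assume \<Phi>: "\<Phi> \<in> V_space X Y" and zero: "\<forall>p\<in>E. \<Phi> p = 0"
  obtain f g where rep: "V_rep X Y f g \<Phi>" using \<Phi> by (auto simp: V_space_def)
  have f: "f i \<in> C_space X" and g: "g i \<in> C_space Y" for i using rep by (auto simp: V_rep_def)
  have sm: "summable (\<lambda>i. sup_norm X (f i) * sup_norm Y (g i))" using rep by (simp add: V_rep_def)
  define fn where "fn n i x = f i (\<theta> n x)" for n i x
  define gn where "gn n i y = g i (\<kappa> n y)" for n i y
  define \<Psi> where "\<Psi> n p = \<Phi> (\<theta> n (fst p), \<kappa> n (snd p))" for n p
  have \<theta>in: "\<theta> n x \<in> topspace X" if "x \<in> topspace X" for n x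
    using \<theta>[of n] that by (auto simp: continuous_map_def)
  have \<kappa>in: "\<kappa> n y \<in> topspace Y" if "y \<in> topspace Y" for n y
    using \<kappa>[of n] that by (auto simp: continuous_map_def)
  have fn: "fn n i \<in> C_space X" for n i
    using continuous_map_compose[OF \<theta>[of n], of euclidean "f i"] f[of i] by (simp add: C_space_def fn_def[abs_def] comp_def)
  have gn: "gn n i \<in> C_space Y" for n i
    using continuous_map_compose[OF \<kappa>[of n], of euclidean "g i"] g[of i] by (simp add: C_space_def gn_def[abs_def] comp_def)
  have nfn: "sup_norm X (fn n i) \<le> sup_norm X (f i)" for n i
    by (rule sup_norm_le) (use sup_norm_nonneg[OF X f] norm_le_sup_norm[OF X f] \<theta>in in \<open>auto simp: fn_def\<close>)
  have ngn: "sup_norm Y (gn n i) \<le> sup_norm Y (g i)" for n i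
    by (rule sup_norm_le) (use sup_norm_nonneg[OF Y g] norm_le_sup_norm[OF Y g] \<kappa>in in \<open>auto simp: gn_def\<close>)
  have df: "(\<lambda>x. f i x - fn n i x) \<in> C_space X" for n i
    using f[of i] fn[of n i] by (auto simp: C_space_def intro: continuous_map_diff)
  have dg: "(\<lambda>y. g i y - gn n i y) \<in> C_space Y" for n i
    using g[of i] gn[of n i] by (auto simp: C_space_def intro: continuous_map_diff)
  have ndf: "sup_norm X (\<lambda>x. f i x - fn n i x) \<le> 2 * sup_norm X (f i)" for n i
  proof (rule sup_norm_le)
    fix x assume x: "x \<in> topspace X"
    have "norm (f i x - fn n i x) \<le> norm (f i x) + norm (fn n i x)" by (rule norm_triangle_ineq4)
    also have "\<dots> \<le> 2 * sup_norm X (f i)"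
      using norm_le_sup_norm[OF X f x, of i] norm_le_sup_norm[OF X f \<theta>in[OF x], of i n] by (simp add: fn_def)
    finally show "norm (f i x - fn n i x) \<le> 2 * sup_norm X (f i)" .
  qed (use sup_norm_nonneg[OF X f] in simp)
  have ndg: "sup_norm Y (\<lambda>y. g i y - gn n i y) \<le> 2 * sup_norm Y (g i)" for n i
  proof (rule sup_norm_le)
    fix y assume y: "y \<in> topspace Y"
    have "norm (g i y - gn n i y) \<le> norm (g i y) + norm (gn n i y)" by (rule norm_triangle_ineq4)
    also have "\<dots> \<le> 2 * sup_norm Y (g i)"
      using norm_le_sup_norm[OF Y g y, of i] norm_le_sup_norm[OF Y g \<kappa>in[OF y], of i n] by (simp add: gn_def)
    finally show "norm (g i y - gn n i y) \<le> 2 * sup_norm Y (g i)" .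
  qed (use sup_norm_nonneg[OF Y g] in simp)
  have \<Psi>_rep: "V_rep X Y (fn n) (gn n) (\<Psi> n)" for n
    unfolding V_rep_def
  proof (intro conjI allI ballI fn gn)
    show "summable (\<lambda>i. sup_norm X (fn n i) * sup_norm Y (gn n i))"
    proof (rule summable_comparison_test[OF _ sm], intro exI allI impI)
      fix i
      show "norm (sup_norm X (fn n i) * sup_norm Y (gn n i)) \<le> sup_norm X (f i) * sup_norm Y (g i)"
        using sup_norm_nonneg[OF X fn] sup_norm_nonneg[OF Y gn] sup_norm_nonneg[OF X f] nfn ngn
        by (simp add: abs_mult mult_mono)
    qed
    show "(\<lambda>i. fn n i x * gn n i y) sums \<Psi> n (x, y)" if "x \<in> topspace X" "y \<in> topspace Y" for x y
      using rep \<theta>in[OF that(1)] \<kappa>in[OF that(2)] by (auto simp: V_rep_def fn_def gn_def \<Psi>_def)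
  qed
  have \<Psi>: "\<Psi> n \<in> V_space X Y" for n
  proof -
    have "continuous_map (prod_topology X Y) (prod_topology X Y) (\<lambda>p. (\<theta> n (fst p), \<kappa> n (snd p)))"
      unfolding continuous_map_paired
      by (intro conjI continuous_map_compose[OF continuous_map_fst \<theta>[of n], unfolded comp_def]
          continuous_map_compose[OF continuous_map_snd \<kappa>[of n], unfolded comp_def])
    from continuous_map_compose[OF this, of euclidean \<Phi>] have "\<Psi> n \<in> C_space (prod_topology X Y)"
      using \<Phi> by (simp add: V_space_def C_space_def \<Psi>_def[abs_def] comp_def)
    then show ?thesis using \<Psi>_rep by (auto simp: V_space_def)
  qed
  have near: "vanishes_near X Y E (\<Psi> n)" for n
    unfolding vanishes_near_def
    using op[of n] E inv zero
    by (intro exI[of _ "{p \<in> topspace X \<times> topspace Y. (\<theta> n (fst p), \<kappa> n (snd p)) \<in> E}"] conjI)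
       (auto simp: \<Psi>_def)
  define d where "d i n = sup_norm X (\<lambda>x. f i x - fn n i x) * sup_norm Y (g i) +
      sup_norm X (f i) * sup_norm Y (\<lambda>y. g i y - gn n i y)" for i n
  have d0: "0 \<le> d i n" for i n
    unfolding d_def using sup_norm_nonneg[OF X df] sup_norm_nonneg[OF Y dg] sup_norm_nonneg[OF X f] sup_norm_nonneg[OF Y g]
    by simp
  have d4: "d i n \<le> 4 * (sup_norm X (f i) * sup_norm Y (g i))" for i n
  proof -
    have "sup_norm X (\<lambda>x. f i x - fn n i x) * sup_norm Y (g i) \<le> 2 * sup_norm X (f i) * sup_norm Y (g i)"
      by (intro mult_right_mono ndf sup_norm_nonneg[OF Y g])
    moreover have "sup_norm X (f i) * sup_norm Y (\<lambda>y. g i y - gn n i y) \<le> sup_norm X (f i) * (2 * sup_norm Y (g i))"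
      by (intro mult_left_mono ndg sup_norm_nonneg[OF X f])
    ultimately show ?thesis unfolding d_def by simp
  qed
  have dsm: "summable (\<lambda>i. d i n)" for n
    by (rule summable_comparison_test[OF _ summable_mult[OF sm, of 4]]) (use d0 d4 in auto)
  have bound: "V_norm X Y (\<lambda>p. \<Phi> p - \<Psi> n p) \<le> (\<Sum>i. d i n)" "0 \<le> V_norm X Y (\<lambda>p. \<Phi> p - \<Psi> n p)" for n
  proof -
    \<comment> \<open>\<open>f \<otimes> g - f' \<otimes> g' = (f - f') \<otimes> g + f' \<otimes> (g - g')\<close>\<close>
    define F where "F = interleave (\<lambda>i x. f i x - fn n i x) (fn n)"
    define G where "G = interleave g (\<lambda>i y. g i y - gn n i y)"
    define a where "a i = sup_norm X (\<lambda>x. f i x - fn n i x) * sup_norm Y (g i)" for i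
    define b where "b i = sup_norm X (fn n i) * sup_norm Y (\<lambda>y. g i y - gn n i y)" for i
    have a0: "0 \<le> a i" and b0: "0 \<le> b i" for i
      unfolding a_def b_def using sup_norm_nonneg[OF X df] sup_norm_nonneg[OF Y dg] sup_norm_nonneg[OF X fn] sup_norm_nonneg[OF Y g]
      by simp_all
    have ab: "a i + b i \<le> d i n" for i
      unfolding a_def b_def d_def using mult_right_mono[OF nfn[of n i] sup_norm_nonneg[OF Y dg]] by simp
    have le: "norm (a i) \<le> d i n" "norm (b i) \<le> d i n" for i
      using a0[of i] b0[of i] ab[of i] by simp_all
    have as: "summable a" using summable_comparison_test[OF _ dsm[of n], of a] le(1) by blast
    have bs: "summable b" using summable_comparison_test[OF _ dsm[of n], of b] le(2) by blast
    have FG: "(\<lambda>i. sup_norm X (F i) * sup_norm Y (G i)) = interleave a b"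
      by (auto simp: F_def G_def a_def b_def interleave_def)
    have abs: "interleave a b sums (suminf a + suminf b)"
      by (intro sums_interleave summable_sums as bs)
    have repF: "V_rep X Y F G (\<lambda>p. \<Phi> p - \<Psi> n p)"
      unfolding V_rep_def
    proof (intro conjI allI ballI)
      show "F i \<in> C_space X" "G i \<in> C_space Y" for i
        using df fn g dg by (auto simp: F_def G_def interleave_def)
      show "summable (\<lambda>i. sup_norm X (F i) * sup_norm Y (G i))"
        unfolding FG using abs by (rule sums_summable)
      fix x y assume xy: "x \<in> topspace X" "y \<in> topspace Y"
      define s where "s i = (f i x - fn n i x) * g i y" for i
      define t where "t i = fn n i x * (g i y - gn n i y)" for i
      have "norm (s i) \<le> a i" for i
        unfolding s_def a_def norm_mult
        using norm_le_sup_norm[OF X df xy(1)] norm_le_sup_norm[OF Y g xy(2)] sup_norm_nonneg[OF X df]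
        by (intro mult_mono) auto
      then have ss: "summable s" using summable_comparison_test[OF _ as, of s] by blast
      have "norm (t i) \<le> b i" for i
        unfolding t_def b_def norm_mult
        using norm_le_sup_norm[OF X fn xy(1)] norm_le_sup_norm[OF Y dg xy(2)] sup_norm_nonneg[OF X fn]
        by (intro mult_mono) auto
      then have ts: "summable t" using summable_comparison_test[OF _ bs, of t] by blast
      have "(\<lambda>i. s i + t i) sums (\<Phi> (x, y) - \<Psi> n (x, y))"
      proof -
        have "(\<lambda>i. f i x * g i y - fn n i x * gn n i y) sums (\<Phi> (x, y) - \<Psi> n (x, y))"
          using rep \<Psi>_rep[of n] xy by (intro sums_diff) (auto simp: V_rep_def)
        then show ?thesis by (simp add: s_def t_def algebra_simps)
      qed
      then have "suminf s + suminf t = \<Phi> (x, y) - \<Psi> n (x, y)"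
        using suminf_add[OF ss ts] by (simp add: sums_iff)
      moreover have "(\<lambda>i. F i x * G i y) = interleave s t"
        by (auto simp: F_def G_def s_def t_def interleave_def)
      ultimately show "(\<lambda>i. F i x * G i y) sums (\<Phi> (x, y) - \<Psi> n (x, y))"
        using sums_interleave[OF summable_sums[OF ss] summable_sums[OF ts]] by simp
    qed
    have "(\<Sum>i. sup_norm X (F i) * sup_norm Y (G i)) = (\<Sum>i. a i + b i)"
      unfolding FG using abs suminf_add[OF as bs] by (simp add: sums_iff)
    also have "\<dots> \<le> (\<Sum>i. d i n)" by (intro suminf_le ab summable_add as bs dsm)
    finally show "V_norm X Y (\<lambda>p. \<Phi> p - \<Psi> n p) \<le> (\<Sum>i. d i n)"
      using V_norm_le(2)[OF X Y repF] by linarith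
    show "0 \<le> V_norm X Y (\<lambda>p. \<Phi> p - \<Psi> n p)" by (rule V_norm_le(1)[OF X Y repF])
  qed
  have lim: "(\<lambda>n. d i n) \<longlonglongrightarrow> 0" for i
    unfolding d_def fn_def gn_def
    using tendsto_add[OF tendsto_mult_left_zero[OF conv\<theta>[OF f[of i]], of "sup_norm Y (g i)"]
        tendsto_mult_right_zero[OF conv\<kappa>[OF g[of i]], of "sup_norm X (f i)"]] by simp
  have "\<forall>\<^sub>F (i, n) in at_top \<times>\<^sub>F sequentially. norm (d i n) \<le> 4 * (sup_norm X (f i) * sup_norm Y (g i))"
    by (rule always_eventually) (use d0 d4 in auto)
  from tannerys_theorem[OF lim this summable_mult[OF sm]] have "(\<lambda>n. \<Sum>i. d i n) \<longlonglongrightarrow> 0" by simp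
  then have "(\<lambda>n. V_norm X Y (\<lambda>p. \<Phi> p - \<Psi> n p)) \<longlonglongrightarrow> 0"
    by (rule tendsto_sandwich[OF _ _ tendsto_const, rotated 2]) (use bound in auto)
  then show "\<exists>\<Psi>. (\<forall>n. \<Psi> n \<in> V_space X Y \<and> vanishes_near X Y E (\<Psi> n)) \<and>
      (\<lambda>n. V_norm X Y (\<lambda>p. \<Phi> p - \<Psi> n p)) \<longlonglongrightarrow> 0"
    using \<Psi> near by blast
qed

section \<open>The binary tree with its boundary\<close>

lemma fun_tendsto_coordinatewise:
  fixes f :: "'c \<Rightarrow> 'i \<Rightarrow> 'b::topological_space"
  assumes "\<And>k. ((\<lambda>n. f n k) \<longlongrightarrow> l k) F"
  shows "(f \<longlongrightarrow> l) F"
proof -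
  have "limitin (product_topology (\<lambda>_. euclidean) UNIV) f l F"
    using assms by (simp add: limitin_componentwise)
  then show ?thesis by (simp add: euclidean_product_topology)
qed

definition branches :: "(nat \<Rightarrow> real) set" where
  "branches = {x. \<forall>k. x k \<in> {0, 1}}"

text \<open>
  A vertex of the binary tree is a finite word of bits. It is encoded as this word followed by twos
  only, and so the vertices along a branch converge to the branch.
\<close>

definition tree_space :: "(nat \<Rightarrow> real) set" where
  "tree_space = {x. (\<forall>k. x k \<in> {0, 1, 2}) \<and> (\<forall>k. x k = 2 \<longrightarrow> x (Suc k) = 2)}"

text \<open>
  The ancestor at level \<open>n\<close>; vertices at lower levels are fixed.
\<close>

definition prune :: "nat \<Rightarrow> (nat \<Rightarrow> real) \<Rightarrow> nat \<Rightarrow> real" where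
  "prune n x = (\<lambda>k. if k < n then x k else 2)"

lemma branch_cases:
  assumes "x \<in> branches"
  obtains "x k = 0" | "x k = 1"
  using assms unfolding branches_def by blast

lemma branch_neq_2: "x \<in> branches \<Longrightarrow> x k \<noteq> 2"
  by (erule branch_cases[of x k]) simp_all

lemma branches_subset: "branches \<subseteq> tree_space"
  unfolding tree_space_def using branch_neq_2 unfolding branches_def by blast

lemma closed_coordinate: "closed A \<Longrightarrow> closed {x :: nat \<Rightarrow> real. x k \<in> A}"
  using closed_vimage[OF _ continuous_on_product_coordinates, of A k] by (simp add: vimage_def)

lemma compact_tree_space: "compact tree_space"
proof -
  have "compactin (product_topology (\<lambda>_::nat. euclidean :: real topology) UNIV) (\<Pi>\<^sub>E k\<in>UNIV. {0, 1, 2})"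
    by (simp add: compactin_PiE)
  then have "compact (\<Pi>\<^sub>E k\<in>(UNIV::nat set). {0, 1, 2 :: real})"
    by (simp add: euclidean_product_topology)
  moreover have "closed (\<Inter>k. {x :: nat \<Rightarrow> real. x k \<in> {0, 1}} \<union> {x. x (Suc k) \<in> {2}})"
    by (intro closed_INT ballI closed_Un closed_coordinate finite_imp_closed) auto
  moreover have eq: "tree_space = (\<Pi>\<^sub>E k\<in>(UNIV::nat set). {0, 1, 2 :: real}) \<inter>
      (\<Inter>k. {x :: nat \<Rightarrow> real. x k \<in> {0, 1}} \<union> {x. x (Suc k) \<in> {2}})"
  proof -
    have "(x k = 2 \<longrightarrow> Q) \<longleftrightarrow> (x k \<in> {0, 1} \<or> Q)" if "x k \<in> {0, 1, 2}" for x :: "nat \<Rightarrow> real" and k Q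
      using that by auto
    then show ?thesis unfolding tree_space_def by (simp add: PiE_iff set_eq_iff) blast
  qed
  ultimately show ?thesis unfolding eq by (intro compact_Int_closed)
qed

lemma prune_in_tree_space: "x \<in> tree_space \<Longrightarrow> prune n x \<in> tree_space"
  by (auto simp: tree_space_def prune_def)

lemma continuous_on_prune: "continuous_on A (prune n)"
proof (rule continuous_on_coordinatewise_then_product)
  fix k
  have "continuous_on A (\<lambda>x :: nat \<Rightarrow> real. x k)"
    by (rule continuous_on_subset[OF continuous_on_product_coordinates]) simp
  then show "continuous_on A (\<lambda>x. prune n x k)" by (cases "k < n") (simp_all add: prune_def)
qed

text \<open>
  Otherwise there are points \<open>X N\<close>, and levels \<open>m N\<close> tending to infinity, at which the difference stays
  large. Along a subsequence the points and their pruned versions converge coordinatewise to the same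
  limit.
\<close>

lemma prune_converges_uniformly:
  assumes f: "continuous_on tree_space f" and e: "0 < e"
  shows "\<exists>N. \<forall>n\<ge>N. \<forall>x\<in>tree_space. norm (f x - f (prune n x) :: complex) \<le> e"
proof (rule ccontr)
  assume "\<not> ?thesis"
  then have "\<forall>N. \<exists>n x. N \<le> n \<and> x \<in> tree_space \<and> e < norm (f x - f (prune n x))"
    by (meson not_le)
  then obtain m X where mX: "\<And>N. N \<le> m N" "\<And>N. X N \<in> tree_space"
      "\<And>N. e < norm (f (X N) - f (prune (m N) (X N)))"
    by metis
  have "seq_compact tree_space" using compact_tree_space compact_eq_seq_compact_metric by blast
  then obtain l r where l: "l \<in> tree_space" "strict_mono r" "(X \<circ> r) \<longlonglongrightarrow> l"
    using mX(2) by (metis seq_compactE)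
  define Y where "Y N = prune (m (r N)) (X (r N))" for N
  have X: "(\<lambda>N. X (r N)) \<longlonglongrightarrow> l" using l(3) by (simp add: comp_def)
  have "Y \<longlonglongrightarrow> l"
  proof (rule fun_tendsto_coordinatewise)
    fix k
    have "continuous_on UNIV (\<lambda>x :: nat \<Rightarrow> real. x k)" by simp
    then have "(\<lambda>N. X (r N) k) \<longlonglongrightarrow> l k"
      using continuous_on_tendsto_compose[of UNIV "\<lambda>x. x k", OF _ X] by simp
    moreover have "\<forall>\<^sub>F N in sequentially. X (r N) k = Y N k"
      using eventually_gt_at_top[of k]
    proof eventually_elim
      case (elim N)
      have "N \<le> r N" using l(2) by (rule seq_suble)
      then have "k < m (r N)" using elim mX(1)[of "r N"] by linarith
      then show ?case by (simp add: Y_def prune_def)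
    qed
    ultimately show "(\<lambda>N. Y N k) \<longlonglongrightarrow> l k" by (rule Lim_transform_eventually)
  qed
  then have "(\<lambda>N. f (Y N)) \<longlonglongrightarrow> f l"
    by (rule continuous_on_tendsto_compose[OF f]) (use l mX(2) in \<open>auto simp: Y_def prune_in_tree_space\<close>)
  moreover have "(\<lambda>N. f (X (r N))) \<longlonglongrightarrow> f l"
    by (rule continuous_on_tendsto_compose[OF f X]) (use l mX(2) in auto)
  ultimately have "(\<lambda>N. norm (f (X (r N)) - f (Y N))) \<longlonglongrightarrow> norm (f l - f l)"
    by (intro tendsto_norm tendsto_diff)
  then have "e \<le> norm (f l - f l)"
    by (rule tendsto_lowerbound) (use mX(3) in \<open>auto simp: Y_def less_imp_le\<close>)
  with e show False by simp
qed

lemma openin_prune_determined: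
  assumes U: "U \<subseteq> tree_space \<times> tree_space"
    and det: "\<And>p q. p \<in> U \<Longrightarrow> q \<in> tree_space \<times> tree_space \<Longrightarrow> prune n (fst q) = prune n (fst p) \<Longrightarrow>
      prune n (snd q) = prune n (snd p) \<Longrightarrow> q \<in> U"
  shows "openin (prod_topology (top_of_set tree_space) (top_of_set tree_space)) U"
proof -
  define C where "C x0 = {x \<in> tree_space. prune n x = prune n x0}" for x0
  have "openin (top_of_set tree_space) (C x0)" if "x0 \<in> tree_space" for x0
  proof -
    have "open (\<Inter>k\<in>{..<n}. (\<lambda>x :: nat \<Rightarrow> real. x k) -` {x0 k - 1 / 2 <..< x0 k + 1 / 2})"
      by (intro open_INT ballI open_vimage continuous_on_product_coordinates) auto
    moreover have "C x0 = tree_space \<inter> (\<Inter>k\<in>{..<n}. (\<lambda>x. x k) -` {x0 k - 1 / 2 <..< x0 k + 1 / 2})"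
    proof (intro set_eqI iffI)
      fix x assume "x \<in> C x0"
      then have "x \<in> tree_space" "\<And>k. k < n \<Longrightarrow> x k = x0 k"
        by (auto simp: C_def prune_def fun_eq_iff split: if_splits)
      then show "x \<in> tree_space \<inter> (\<Inter>k\<in>{..<n}. (\<lambda>x. x k) -` {x0 k - 1 / 2 <..< x0 k + 1 / 2})" by auto
    next
      fix x assume x: "x \<in> tree_space \<inter> (\<Inter>k\<in>{..<n}. (\<lambda>x. x k) -` {x0 k - 1 / 2 <..< x0 k + 1 / 2})"
      have "x k = x0 k" if "k < n" for k
      proof -
        have "x k \<in> {0, 1, 2}" "x0 k \<in> {0, 1, 2}" "x0 k - 1 / 2 < x k" "x k < x0 k + 1 / 2"
          using x \<open>x0 \<in> tree_space\<close> that by (auto simp: tree_space_def)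
        then show ?thesis by auto
      qed
      then show "x \<in> C x0" using x by (auto simp: C_def prune_def)
    qed
    ultimately show ?thesis by (auto simp: openin_open)
  qed
  then have "openin (prod_topology (top_of_set tree_space) (top_of_set tree_space)) (C (fst p) \<times> C (snd p))"
    if "p \<in> U" for p
    using that U by (subst openin_prod_Times_iff) auto
  then have "openin (prod_topology (top_of_set tree_space) (top_of_set tree_space)) (\<Union>p\<in>U. C (fst p) \<times> C (snd p))"
    by (intro openin_Union) blast
  also have "(\<Union>p\<in>U. C (fst p) \<times> C (snd p)) = U"
    using U det by (auto simp: C_def)
  finally show ?thesis .
qed

text \<open>
  The points of \<open>shadow K\<close> are compatible with points of \<open>K\<close> in every finite window, where twos are
  compatible with every bit. Asking for this in finite windows only makes the set closed. The levels of
  the two components of a point may differ.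
\<close>

definition shadow :: "((nat \<Rightarrow> real) \<times> (nat \<Rightarrow> real)) set \<Rightarrow> ((nat \<Rightarrow> real) \<times> (nat \<Rightarrow> real)) set" where
  "shadow K = {(x, y) \<in> tree_space \<times> tree_space. \<forall>n. \<exists>(x', y')\<in>K. \<forall>k<n. x k \<in> {2, x' k} \<and> y k \<in> {2, y' k}}"

lemma shadow_prune:
  assumes "(x, y) \<in> shadow K"
  shows "(prune n x, prune n y) \<in> shadow K"
proof -
  have "\<exists>(x', y')\<in>K. \<forall>k<m. prune n x k \<in> {2, x' k} \<and> prune n y k \<in> {2, y' k}" for m
  proof -
    obtain x' y' where "(x', y') \<in> K" "\<forall>k<m. x k \<in> {2, x' k} \<and> y k \<in> {2, y' k}"
      using assms unfolding shadow_def by blast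
    then show ?thesis by (intro bexI[of _ "(x', y')"]) (simp_all add: prune_def)
  qed
  then show ?thesis
    using assms prune_in_tree_space unfolding shadow_def by blast
qed

lemma closedin_shadow: "closedin (prod_topology (top_of_set tree_space) (top_of_set tree_space)) (shadow K)"
proof -
  define Q where "Q n = {(x, y) \<in> tree_space \<times> tree_space.
      \<not> (\<exists>(x', y')\<in>K. \<forall>k<n. x k \<in> {2, x' k} \<and> y k \<in> {2, y' k})}" for n
  have "openin (prod_topology (top_of_set tree_space) (top_of_set tree_space)) (Q n)" for n
  proof (rule openin_prune_determined[of _ n])
    show "Q n \<subseteq> tree_space \<times> tree_space" by (auto simp: Q_def)
    fix p q assume pq: "p \<in> Q n" "q \<in> tree_space \<times> tree_space" "prune n (fst q) = prune n (fst p)" "prune n (snd q) = prune n (snd p)"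
    then have "\<And>k. k < n \<Longrightarrow> fst q k = fst p k \<and> snd q k = snd p k"
      by (metis prune_def)
    then show "q \<in> Q n" using pq(1,2) by (cases p; cases q) (simp add: Q_def cong: conj_cong)
  qed
  then have "openin (prod_topology (top_of_set tree_space) (top_of_set tree_space)) (\<Union>n. Q n)"
    by (intro openin_Union) auto
  moreover have "tree_space \<times> tree_space - shadow K = (\<Union>n. Q n)"
    unfolding shadow_def Q_def by blast
  ultimately show ?thesis by (auto simp: closedin_def shadow_def)
qed

section \<open>The phase on pairs of branches\<close>

definition tree_phase :: "(nat \<Rightarrow> real) \<times> (nat \<Rightarrow> real) \<Rightarrow> complex" where
  "tree_phase p = cis (\<Sum>k. angle k * (fst p k * snd p k))"

lemma branch_product_bound:
  assumes "x \<in> branches" "y \<in> branches"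
  shows "0 \<le> x k * y k" "x k * y k \<le> 1"
  by (rule branch_cases[OF assms(1), of k]; rule branch_cases[OF assms(2), of k]; simp)+

lemma continuous_on_tree_phase: "continuous_on (branches \<times> branches) tree_phase"
proof -
  have "uniform_limit (branches \<times> branches) (\<lambda>n p. \<Sum>k<n. angle k * (fst p k * snd p k))
      (\<lambda>p. \<Sum>k. angle k * (fst p k * snd p k)) sequentially"
  proof (rule Weierstrass_m_test[OF _ summable_angle])
    fix k and p :: "(nat \<Rightarrow> real) \<times> (nat \<Rightarrow> real)" assume "p \<in> branches \<times> branches"
    then have "0 \<le> fst p k * snd p k" "fst p k * snd p k \<le> 1"
      using branch_product_bound[of "fst p" "snd p" k] by auto
    then show "norm (angle k * (fst p k * snd p k)) \<le> angle k"
      using angle_pos[of k] by (simp add: mult_left_le abs_mult[of "angle k"] abs_of_nonneg)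
  qed
  moreover have "continuous_on (branches \<times> branches) (\<lambda>p. \<Sum>k<n. angle k * (fst p k * snd p k))" for n
    by (intro continuous_intros continuous_on_compose2[OF continuous_on_product_coordinates]) auto
  ultimately have "continuous_on (branches \<times> branches) (\<lambda>p. \<Sum>k. angle k * (fst p k * snd p k))"
    by (intro uniform_limit_theorem[where F = sequentially]) auto
  then show ?thesis unfolding tree_phase_def[abs_def] by (intro continuous_intros)
qed

text \<open>
  On pairs of branches, \<open>shadow K\<close> is the closure of \<open>K\<close>, and the level set \<open>K\<close> is closed.
\<close>

lemma shadow_on_branches:
  assumes p: "p \<in> branches \<times> branches"
  shows "p \<in> shadow {p \<in> branches \<times> branches. tree_phase p = 1} \<longleftrightarrow> tree_phase p = 1"
proof
  assume "tree_phase p = 1"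
  then show "p \<in> shadow {p \<in> branches \<times> branches. tree_phase p = 1}"
    using p branches_subset unfolding shadow_def
    by (cases p) (auto intro!: bexI[of _ p])
next
  obtain x y where xy: "p = (x, y)" "x \<in> branches" "y \<in> branches" using p by auto
  have b: "x k \<noteq> 2" "y k \<noteq> 2" for k
    using xy(2,3) branch_neq_2 by auto
  assume "p \<in> shadow {p \<in> branches \<times> branches. tree_phase p = 1}"
  then have "\<forall>n. \<exists>q. q \<in> branches \<times> branches \<and> tree_phase q = 1 \<and> (\<forall>k<n. x k = fst q k \<and> y k = snd q k)"
  proof (intro allI)
    fix n
    obtain x' y' where *: "(x', y') \<in> branches \<times> branches" "tree_phase (x', y') = 1"
        "\<forall>k<n. x k \<in> {2, x' k} \<and> y k \<in> {2, y' k}"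
      using \<open>p \<in> shadow _\<close> unfolding shadow_def xy(1) by blast
    then show "\<exists>q. q \<in> branches \<times> branches \<and> tree_phase q = 1 \<and> (\<forall>k<n. x k = fst q k \<and> y k = snd q k)"
      using b by (intro exI[of _ "(x', y')"]) auto
  qed
  then obtain q where q: "\<And>n. q n \<in> branches \<times> branches" "\<And>n. tree_phase (q n) = 1"
      "\<And>n k. k < n \<Longrightarrow> x k = fst (q n) k \<and> y k = snd (q n) k"
    by metis
  have "(\<lambda>n. fst (q n)) \<longlonglongrightarrow> x"
  proof (rule fun_tendsto_coordinatewise)
    fix k
    have "\<forall>\<^sub>F n in sequentially. x k = fst (q n) k"
      using eventually_gt_at_top[of k] by eventually_elim (use q(3) in blast)
    then show "(\<lambda>n. fst (q n) k) \<longlonglongrightarrow> x k" by (rule Lim_transform_eventually[OF tendsto_const])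
  qed
  moreover have "(\<lambda>n. snd (q n)) \<longlonglongrightarrow> y"
  proof (rule fun_tendsto_coordinatewise)
    fix k
    have "\<forall>\<^sub>F n in sequentially. y k = snd (q n) k"
      using eventually_gt_at_top[of k] by eventually_elim (use q(3) in blast)
    then show "(\<lambda>n. snd (q n) k) \<longlonglongrightarrow> y k" by (rule Lim_transform_eventually[OF tendsto_const])
  qed
  ultimately have "(\<lambda>n. (fst (q n), snd (q n))) \<longlonglongrightarrow> (x, y)" by (rule tendsto_Pair)
  then have "q \<longlonglongrightarrow> p" by (simp add: xy(1))
  then have "(\<lambda>n. tree_phase (q n)) \<longlonglongrightarrow> tree_phase p"
    by (rule continuous_on_tendsto_compose[OF continuous_on_tree_phase]) (use p q(1) in auto)
  then show "tree_phase p = 1" using q(2) by (simp add: LIMSEQ_const_iff)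
qed

text \<open>
  Expanding the product gives a sum over the subsets of \<open>{..<N}\<close>, which \<open>set_decode\<close> enumerates by the
  numbers below \<open>2 ^ N\<close>.
\<close>

lemma sum_over_finite_sets:
  fixes z :: "nat \<Rightarrow> 'a::comm_ring_1"
  shows "(\<Sum>n<2 ^ N. \<Prod>k\<in>set_decode n. z k) = (\<Prod>k<N. 1 + z k)"
proof (induction N)
  case (Suc N)
  have dec: "(\<Prod>k\<in>set_decode (2 ^ N + n). z k) = z N * (\<Prod>k\<in>set_decode n. z k)" if "n < 2 ^ N" for n
  proof -
    have "N \<notin> set_decode n" using that by (simp add: set_decode_def)
    then show ?thesis by (simp add: set_decode_plus_power_2)
  qed
  have "{..<2 ^ Suc N} = {..<2 ^ N} \<union> (\<lambda>n. 2 ^ N + n) ` {..<2 ^ N :: nat}"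
  proof (intro set_eqI iffI)
    fix n :: nat assume "n \<in> {..<2 ^ Suc N}"
    then show "n \<in> {..<2 ^ N} \<union> (\<lambda>n. 2 ^ N + n) ` {..<2 ^ N}"
      by (cases "n < 2 ^ N") (auto intro!: image_eqI[of _ _ "n - 2 ^ N"])
  qed auto
  then have "(\<Sum>n<2 ^ Suc N. \<Prod>k\<in>set_decode n. z k) =
      (\<Sum>n<2 ^ N. \<Prod>k\<in>set_decode n. z k) + (\<Sum>n\<in>(\<lambda>n. 2 ^ N + n) ` {..<2 ^ N}. \<Prod>k\<in>set_decode n. z k)"
    by (simp only:) (rule sum.union_disjoint; auto)
  also have "(\<Sum>n\<in>(\<lambda>n. 2 ^ N + n) ` {..<2 ^ N}. \<Prod>k\<in>set_decode n. z k) =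
      (\<Sum>n<2 ^ N. z N * (\<Prod>k\<in>set_decode n. z k))"
    by (subst sum.reindex) (auto simp: dec intro!: sum.cong)
  finally show ?case using Suc.IH by (simp add: sum_distrib_left[symmetric] algebra_simps)
qed simp

lemma summable_angle_products: "summable (\<lambda>n. \<Prod>k\<in>set_decode n. angle k)"
proof (rule summableI_nonneg_bounded)
  show nonneg: "0 \<le> (\<Prod>k\<in>set_decode n. angle k)" for n
    using angle_pos by (intro prod_nonneg) (auto simp: less_imp_le)
  fix n
  have "(\<Sum>i<n. \<Prod>k\<in>set_decode i. angle k) \<le> (\<Sum>i<2 ^ n. \<Prod>k\<in>set_decode i. angle k)"
    using nonneg less_exp[of n] by (intro sum_mono2) auto
  also have "\<dots> = (\<Prod>k<n. 1 + angle k)" by (rule sum_over_finite_sets)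
  also have "\<dots> \<le> (\<Prod>k<n. exp (angle k))"
    using angle_pos by (intro prod_mono) (auto simp: less_imp_le add_nonneg_nonneg)
  also have "\<dots> = exp (\<Sum>k<n. angle k)" by (simp add: exp_sum)
  also have "\<dots> \<le> exp (\<Sum>k. angle k)"
    using angle_pos by (simp add: sum_le_suminf summable_angle less_imp_le)
  finally show "(\<Sum>i<n. \<Prod>k\<in>set_decode i. angle k) \<le> exp (\<Sum>k. angle k)" .
qed

lemma norm_cis_minus_one_le: "norm (cis t - 1) \<le> \<bar>t\<bar>"
proof (rule power2_le_imp_le)
  have "(norm (cis t - 1))\<^sup>2 = 2 - 2 * cos t"
  proof -
    have "(cos t - 1)\<^sup>2 + (sin t)\<^sup>2 = ((cos t)\<^sup>2 + (sin t)\<^sup>2) + 1 - 2 * cos t"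
      by (simp add: power2_diff)
    then show ?thesis by (simp add: cmod_power2)
  qed
  also have "\<dots> = 4 * (sin (t / 2))\<^sup>2"
    using cos_double_sin[of "t / 2"] by simp
  also have "\<dots> \<le> 4 * (\<bar>t / 2\<bar>)\<^sup>2"
    using power_mono[OF abs_sin_x_le_abs_x[of "t / 2"], of 2] by simp
  finally show "(norm (cis t - 1))\<^sup>2 \<le> \<bar>t\<bar>\<^sup>2" by (simp add: power_divide)
qed simp

text \<open>
  For bits, \<open>cis (angle k * x k * y k) = 1 + (cis (angle k) - 1) * x k * y k\<close>. Multiplying out the
  infinite product yields a series of elementary tensors, one for each finite set of indices.
\<close>

lemma tree_phase_expansion:
  assumes x: "x \<in> branches" and y: "y \<in> branches"
  shows "(\<lambda>n. (\<Prod>k\<in>set_decode n. (cis (angle k) - 1) * of_real (x k)) * (\<Prod>k\<in>set_decode n. of_real (y k)))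
    sums tree_phase (x, y)"
proof -
  define z where "z k = (cis (angle k) - 1) * of_real (x k * y k)" for k
  have eq: "(\<Prod>k\<in>set_decode n. (cis (angle k) - 1) * of_real (x k)) * (\<Prod>k\<in>set_decode n. of_real (y k)) =
      (\<Prod>k\<in>set_decode n. z k)" for n
    unfolding prod.distrib[symmetric] z_def by (simp add: mult.assoc)
  have nz: "norm (z k) \<le> angle k" for k
  proof -
    have "norm (z k) \<le> angle k * 1"
      unfolding z_def norm_mult
      using norm_cis_minus_one_le[of "angle k"] angle_pos[of k] branch_product_bound[OF x y, of k]
      by (intro mult_mono) (auto simp: abs_mult abs_of_nonneg simp flip: of_real_mult)
    then show ?thesis by simp
  qed
  have norm_le: "norm (\<Prod>k\<in>set_decode n. z k) \<le> (\<Prod>k\<in>set_decode n. angle k)" for n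
    unfolding prod_norm[symmetric] by (intro prod_mono) (use nz in auto)
  have sz: "summable (\<lambda>n. \<Prod>k\<in>set_decode n. z k)"
    by (rule summable_comparison_test[OF _ summable_angle_products]) (use norm_le in blast)
  then have s: "(\<lambda>m. \<Sum>n<m. \<Prod>k\<in>set_decode n. z k) \<longlonglongrightarrow> (\<Sum>n. \<Prod>k\<in>set_decode n. z k)"
    by (rule summable_LIMSEQ)
  \<comment> \<open>Along the partial sums of length \<open>2 ^ N\<close> the series is a finite product.\<close>
  have "strict_mono (\<lambda>N. 2 ^ N :: nat)" by (simp add: strict_mono_def)
  from LIMSEQ_subseq_LIMSEQ[OF s this]
  have "(\<lambda>N. \<Prod>k<N. 1 + z k) \<longlonglongrightarrow> (\<Sum>n. \<Prod>k\<in>set_decode n. z k)"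
    by (simp add: comp_def sum_over_finite_sets)
  moreover have "1 + z k = cis (angle k * (x k * y k))" for k
    by (rule branch_cases[OF x, of k]; rule branch_cases[OF y, of k]; simp add: z_def)
  then have "(\<Prod>k<N. 1 + z k) = cis (\<Sum>k<N. angle k * (x k * y k))" for N
    by (induction N) (simp_all add: cis_mult)
  moreover have "(\<lambda>N. cis (\<Sum>k<N. angle k * (x k * y k))) \<longlonglongrightarrow> tree_phase (x, y)"
  proof -
    have "summable (\<lambda>k. angle k * (x k * y k))"
    proof (rule summable_comparison_test[OF _ summable_angle], intro exI allI impI)
      fix k
      have "angle k * (x k * y k) \<le> angle k * 1"
        using branch_product_bound[OF x y, of k] angle_pos[of k] by (intro mult_left_mono) simp_all
      moreover have "0 \<le> angle k * (x k * y k)"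
        by (rule mult_nonneg_nonneg[OF less_imp_le[OF angle_pos] branch_product_bound(1)[OF x y]])
      ultimately show "norm (angle k * (x k * y k)) \<le> angle k" by simp
    qed
    note lim = summable_LIMSEQ[OF this]
    have "continuous_on UNIV cis" by (intro continuous_intros)
    from continuous_on_tendsto_compose[OF this lim] show ?thesis
      by (simp add: tree_phase_def)
  qed
  ultimately have "(\<Sum>n. \<Prod>k\<in>set_decode n. z k) = tree_phase (x, y)"
    by (simp add: LIMSEQ_unique)
  then show ?thesis
    unfolding eq using sz by (simp add: sums_iff)
qed

section \<open>The coin measure on the branches\<close>

lemma kernel_norm_le_distr:
  assumes C: "prob_space C" and h: "h \<in> measurable C R" and K: "K \<in> borel_measurable (R \<Otimes>\<^sub>M R)"
    and le: "kernel_norm_le C C (\<lambda>p. K (h (fst p), h (snd p))) c"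
  shows "kernel_norm_le (distr C R h) (distr C R h) K c"
  unfolding kernel_norm_le_def
proof (intro ballI)
  interpret prob_space C by fact
  interpret D: prob_space "distr C R h" using h by (rule prob_space_distr)
  note [measurable] = h K
  fix u v assume "u \<in> L2_space (distr C R h)" "v \<in> L2_space (distr C R h)"
  moreover have L: "w \<circ> h \<in> L2_space C \<and> L2_norm C (w \<circ> h) = L2_norm (distr C R h) w"
    if "w \<in> L2_space (distr C R h)" for w
  proof -
    have [measurable]: "w \<in> borel_measurable R" using that by (simp add: L2_space_def)
    have "integrable C (\<lambda>x. (norm (w (h x)))\<^sup>2)"
      using that h by (simp add: L2_space_def integrable_distr_eq)
    then show ?thesis
      by (simp add: L2_space_def L2_norm_def integral_distr[OF h] comp_def)
  qed
  ultimately have uv: "u \<circ> h \<in> L2_space C" "v \<circ> h \<in> L2_space C"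
      "L2_norm C (u \<circ> h) = L2_norm (distr C R h) u" "L2_norm C (v \<circ> h) = L2_norm (distr C R h) v"
    and [measurable]: "u \<in> borel_measurable R" "v \<in> borel_measurable R"
    by (auto simp: L2_space_def)
  have "distr C R h \<Otimes>\<^sub>M distr C R h = distr (C \<Otimes>\<^sub>M C) (R \<Otimes>\<^sub>M R) (\<lambda>(x, y). (h x, h y))"
    by (rule pair_measure_distr[OF h h D.sigma_finite_measure_axioms])
  then have "kernel_form (distr C R h) (distr C R h) K u v =
      kernel_form C C (\<lambda>p. K (h (fst p), h (snd p))) (u \<circ> h) (v \<circ> h)"
    unfolding kernel_form_def by (simp add: integral_distr case_prod_beta')
  then show "norm (kernel_form (distr C R h) (distr C R h) K u v) \<le>
      c * (L2_norm (distr C R h) u * L2_norm (distr C R h) v)"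
    using le uv unfolding kernel_norm_le_def by (metis (no_types, lifting))
qed

lemma finite_Borel_measureI:
  fixes S :: "'a::topological_space set"
  assumes "finite_measure M" "sets M = sets (restrict_space borel S)" "S \<in> sets borel"
  shows "finite_Borel_measure (top_of_set S) M"
proof -
  have "space M = S" using sets_eq_imp_space_eq[OF assms(2)] by (simp add: space_restrict_space)
  moreover have "sets M = sigma_sets S {U. openin (top_of_set S) U}"
  proof -
    have "sets (restrict_space borel S) = (\<inter>) S ` sigma_sets UNIV {U. open U}"
      by (simp add: sets_restrict_space borel_def)
    also have "\<dots> = sigma_sets S ((\<inter>) S ` {U. open U})"
      by (rule sigma_sets_Int) (use assms(3) in \<open>simp_all add: borel_def\<close>)
    also have "(\<inter>) S ` {U. open U} = {U. openin (top_of_set S) U}"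
      by (auto simp: openin_open)
    finally show ?thesis using assms(2) by simp
  qed
  ultimately show ?thesis using assms(1) by (simp add: finite_Borel_measure_def)
qed

definition branch :: "(nat \<Rightarrow> bool) \<Rightarrow> nat \<Rightarrow> real" where
  "branch b k = of_bool (b k)"

definition branch_measure :: "(nat \<Rightarrow> real) measure" where
  "branch_measure = distr coin (restrict_space borel tree_space) branch"

lemma branch_in_branches: "branch b \<in> branches"
  by (auto simp: branch_def branches_def)

lemma tree_space_borel: "tree_space \<in> sets borel"
  by (intro borel_closed compact_imp_closed compact_tree_space)

lemma measurable_branch: "branch \<in> measurable coin (restrict_space borel tree_space)"
proof (rule measurable_restrict_space2)
  show "branch \<in> space coin \<rightarrow> tree_space" using branch_in_branches branches_subset by blast
  show "branch \<in> borel_measurable coin"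
    unfolding branch_def[abs_def] of_bool_def by (rule measurable_coordinatewise_then_product) measurable
qed

lemma sets_branch_measure: "sets branch_measure = sets (restrict_space borel tree_space)"
  and space_branch_measure: "space branch_measure = tree_space"
  by (simp_all add: branch_measure_def space_restrict_space)

lemma prob_space_branch_measure: "prob_space branch_measure"
  unfolding branch_measure_def by (rule prob_space.prob_space_distr[OF prob_space_coin measurable_branch])

lemma branches_full: "branches \<in> sets branch_measure" "branch_measure (space branch_measure - branches) = 0"
proof -
  have "closed (\<Inter>k. {x :: nat \<Rightarrow> real. x k \<in> {0, 1}})"
    by (intro closed_INT ballI closed_coordinate finite_imp_closed) auto
  moreover have eq: "branches = (\<Inter>k. {x :: nat \<Rightarrow> real. x k \<in> {0, 1}})" by (auto simp: branches_def)
  ultimately have "branches \<in> sets borel" by (simp add: borel_closed)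
  then show m: "branches \<in> sets branch_measure"
    unfolding sets_branch_measure sets_restrict_space using branches_subset by blast
  have "branch -` (space branch_measure - branches) \<inter> space coin = {}"
    using branch_in_branches by auto
  moreover have "space branch_measure - branches \<in> sets (restrict_space borel tree_space)"
    using sets.compl_sets[OF m] sets_branch_measure by simp
  ultimately show "branch_measure (space branch_measure - branches) = 0"
    unfolding branch_measure_def by (subst emeasure_distr[OF measurable_branch]) simp_all
qed

lemma measurable_coordinate [measurable]: "(\<lambda>x. x k) \<in> borel_measurable branch_measure"
  unfolding measurable_cong_sets[OF sets_branch_measure refl]
  by (intro measurable_restrict_space1 borel_measurable_continuous_onI continuous_on_product_coordinates)

lemma measurable_tree_phase: "tree_phase \<in> borel_measurable (branch_measure \<Otimes>\<^sub>M branch_measure)"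
proof -
  have [measurable]: "(\<lambda>p. fst p k) \<in> borel_measurable (branch_measure \<Otimes>\<^sub>M branch_measure)"
      "(\<lambda>p. snd p k) \<in> borel_measurable (branch_measure \<Otimes>\<^sub>M branch_measure)" for k
    by (rule measurable_compose[OF measurable_fst measurable_coordinate])
       (rule measurable_compose[OF measurable_snd measurable_coordinate])
  show ?thesis unfolding tree_phase_def[abs_def] by measurable
qed

lemma oscillating_tree_phase: "oscillating_phase branch_measure branch_measure tree_phase"
proof -
  interpret prob_space branch_measure by (rule prob_space_branch_measure)
  show ?thesis
  proof unfold_locales
    show "tree_phase \<in> borel_measurable (branch_measure \<Otimes>\<^sub>M branch_measure)"
      by (rule measurable_tree_phase)
    show "norm (tree_phase p) = 1" for p by (simp add: tree_phase_def)
    fix n :: nat assume n: "1 \<le> n"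
    let ?R = "restrict_space borel tree_space"
    have "sets (branch_measure \<Otimes>\<^sub>M branch_measure) = sets (?R \<Otimes>\<^sub>M ?R)"
      by (intro sets_pair_measure_cong sets_branch_measure)
    from measurable_cong_sets[OF this refl]
    have "tree_phase \<in> borel_measurable (?R \<Otimes>\<^sub>M ?R)" using measurable_tree_phase by blast
    then have m: "(\<lambda>p. tree_phase p ^ n) \<in> borel_measurable (?R \<Otimes>\<^sub>M ?R)" by measurable
    have "tree_phase (branch b, branch c) = bit_phase angle (b, c)" for b c
      unfolding tree_phase_def bit_phase_def by (simp add: branch_def of_bool_conj)
    then have "kernel_norm_le coin coin (\<lambda>p. tree_phase (branch (fst p), branch (snd p)) ^ n) (decay n)"
      using bit_phase_powers_decay[OF n] by simp
    from kernel_norm_le_distr[OF prob_space_coin measurable_branch m this]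
    show "kernel_norm_le branch_measure branch_measure (\<lambda>p. tree_phase p ^ n) (decay n)"
      by (simp add: branch_measure_def)
  qed
qed

lemma L2_AE_bounded:
  assumes M: "prob_space M" and [measurable]: "u \<in> borel_measurable M" and AE: "AE x in M. norm (u x) \<le> B"
    and "0 \<le> B"
  shows "u \<in> L2_space M" "L2_norm M u \<le> B"
proof -
  interpret prob_space M by fact
  have le: "AE x in M. (norm (u x))\<^sup>2 \<le> B\<^sup>2"
    using AE by eventually_elim (simp add: power_mono)
  have int: "integrable M (\<lambda>x. (norm (u x))\<^sup>2)"
    by (rule integrable_const_bound[of _ "B\<^sup>2"]) (use le in auto)
  then show "u \<in> L2_space M" by (simp add: L2_space_def)
  have "(\<integral>x. (norm (u x))\<^sup>2 \<partial>M) \<le> (\<integral>x. B\<^sup>2 \<partial>M)"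
    by (rule integral_mono_AE[OF int _ le]) simp
  then have "(L2_norm M u)\<^sup>2 \<le> B\<^sup>2" by (simp add: L2_norm_power2 prob_space)
  then show "L2_norm M u \<le> B" by (rule power2_le_imp_le) fact
qed

lemma tree_phase_in_Gamma: "(\<lambda>p. tree_phase p - 1) \<in> Gamma_space branch_measure branch_measure"
proof -
  let ?M = branch_measure
  interpret prob_space ?M by (rule prob_space_branch_measure)
  define u where "u n x = (\<Prod>k\<in>set_decode n. (cis (angle k) - 1) * complex_of_real (x k))" for n and x :: "nat \<Rightarrow> real"
  define v where "v n y = (\<Prod>k\<in>set_decode n. complex_of_real (y k))" for n and y :: "nat \<Rightarrow> real"
  define w where "w n = (\<Prod>k\<in>set_decode n. angle k)" for n
  have AEb: "AE x in ?M. x \<in> branches"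
    by (rule AE_I[of _ _ "space ?M - branches"]) (use branches_full in auto)
  have [measurable]: "u n \<in> borel_measurable ?M" "v n \<in> borel_measurable ?M" for n
    unfolding u_def v_def by measurable
  have w0: "0 \<le> w n" for n unfolding w_def using angle_pos by (intro prod_nonneg) (auto simp: less_imp_le)
  have ub: "norm (u n x) \<le> w n" if "x \<in> branches" for n x
  proof -
    have "norm ((cis (angle k) - 1) * complex_of_real (x k)) \<le> angle k" for k
      using norm_cis_minus_one_le[of "angle k"] angle_pos[of k]
      by (rule_tac branch_cases[OF that, of k]) (simp_all add: norm_mult)
    then show ?thesis unfolding u_def w_def prod_norm[symmetric] by (intro prod_mono) auto
  qed
  have vb: "norm (v n y) \<le> 1" if "y \<in> branches" for n y
  proof -
    have "norm (complex_of_real (y k)) \<le> 1" for k by (rule branch_cases[OF that, of k]) simp_all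
    then show ?thesis unfolding v_def prod_norm[symmetric] by (intro prod_le_1) auto
  qed
  have uL: "u n \<in> L2_space ?M" "L2_norm ?M (u n) \<le> w n" for n
    using AEb ub w0 by (auto intro!: L2_AE_bounded prob_space_branch_measure elim!: eventually_mono)
  have vL: "v n \<in> L2_space ?M" "L2_norm ?M (v n) \<le> 1" for n
    using AEb vb by (auto intro!: L2_AE_bounded prob_space_branch_measure elim!: eventually_mono)
  \<comment> \<open>The summand for the empty set of bits is \<open>1\<close>; dropping it represents \<open>\<phi> - 1\<close>.\<close>
  have "Gamma_rep ?M ?M (\<lambda>n. u (Suc n)) (\<lambda>n. v (Suc n)) (\<lambda>p. tree_phase p - 1)"
    unfolding Gamma_rep_def
  proof (intro conjI allI uL(1) vL(1))
    have sw: "summable (\<lambda>n. w (Suc n))"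
      using summable_angle_products unfolding w_def summable_Suc_iff[of "\<lambda>n. \<Prod>k\<in>set_decode n. angle k"] .
    show "summable (\<lambda>n. L2_norm ?M (u (Suc n)) * L2_norm ?M (v (Suc n)))"
    proof (rule summable_comparison_test[OF _ sw], intro exI allI impI)
      fix n
      have "L2_norm ?M (u (Suc n)) * L2_norm ?M (v (Suc n)) \<le> w (Suc n) * 1"
        by (intro mult_mono uL vL w0) simp
      then show "norm (L2_norm ?M (u (Suc n)) * L2_norm ?M (v (Suc n))) \<le> w (Suc n)" by simp
    qed
    have "space ?M - branches \<in> null_sets ?M" using branches_full by (auto simp: null_sets_def)
    moreover have "{p \<in> space ?M \<times> space ?M. \<not> (case p of (x, y) \<Rightarrow> (\<lambda>n. u (Suc n) x * v (Suc n) y) sums (tree_phase (x, y) - 1))}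
        \<subseteq> (space ?M - branches) \<times> space ?M \<union> space ?M \<times> (space ?M - branches)"
    proof -
      have "(\<lambda>n. u (Suc n) x * v (Suc n) y) sums (tree_phase (x, y) - 1)"
        if "x \<in> branches" "y \<in> branches" for x y
        using tree_phase_expansion[OF that] unfolding sums_Suc_iff[of "\<lambda>n. u n x * v n y"]
        by (simp add: u_def v_def)
      then show ?thesis by blast
    qed
    ultimately show "mae ?M ?M (\<lambda>(x, y). (\<lambda>n. u (Suc n) x * v (Suc n) y) sums (tree_phase (x, y) - 1))"
      unfolding mae_def marginally_null_def by blast
  qed
  then show ?thesis by (auto simp: Gamma_space_def)
qed

section \<open>The example\<close>

lemma spectral_synthesis_shadow: "spectral_synthesis (top_of_set tree_space) (top_of_set tree_space) (shadow K)"
proof (rule spectral_synthesis_by_inner_maps[of _ _ prune prune])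
  have X: "compact_space (top_of_set tree_space)"
    by (simp add: compact_space_subtopology compact_tree_space)
  show "compact_space (top_of_set tree_space)" "compact_space (top_of_set tree_space)" by (rule X)+
  show c: "continuous_map (top_of_set tree_space) (top_of_set tree_space) (prune n)" for n
    using continuous_on_prune prune_in_tree_space by (auto simp: continuous_map_in_subtopology)
  then show "continuous_map (top_of_set tree_space) (top_of_set tree_space) (prune n)" for n .
  show conv: "(\<lambda>n. sup_norm (top_of_set tree_space) (\<lambda>x. f x - f (prune n x))) \<longlonglongrightarrow> 0"
    if f: "f \<in> C_space (top_of_set tree_space)" for f
  proof (rule LIMSEQ_I)
    fix e :: real assume "0 < e"
    have fc: "continuous_on tree_space f" using f by (simp add: C_space_def)
    have nn: "0 \<le> sup_norm (top_of_set tree_space) (\<lambda>x. f x - f (prune n x))" for n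
    proof (rule sup_norm_nonneg[OF X])
      have "continuous_on tree_space (\<lambda>x. f (prune n x))"
        by (rule continuous_on_compose2[OF fc continuous_on_prune]) (use prune_in_tree_space in auto)
      then show "(\<lambda>x. f x - f (prune n x)) \<in> C_space (top_of_set tree_space)"
        using fc by (simp add: C_space_def continuous_on_diff)
    qed
    obtain N where N: "\<And>n x. N \<le> n \<Longrightarrow> x \<in> tree_space \<Longrightarrow> norm (f x - f (prune n x)) \<le> e / 2"
      using prune_converges_uniformly[OF fc, of "e / 2"] \<open>0 < e\<close> by auto
    have "norm (sup_norm (top_of_set tree_space) (\<lambda>x. f x - f (prune n x)) - 0) < e" if "N \<le> n" for n
    proof -
      have "sup_norm (top_of_set tree_space) (\<lambda>x. f x - f (prune n x)) \<le> e / 2"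
        using N[OF that] \<open>0 < e\<close> by (intro sup_norm_le) auto
      then show ?thesis using nn[of n] \<open>0 < e\<close> by simp
    qed
    then show "\<exists>N. \<forall>n\<ge>N. norm (sup_norm (top_of_set tree_space) (\<lambda>x. f x - f (prune n x)) - 0) < e" by blast
  qed
  then show "(\<lambda>n. sup_norm (top_of_set tree_space) (\<lambda>x. f x - f (prune n x))) \<longlonglongrightarrow> 0"
    if "f \<in> C_space (top_of_set tree_space)" for f using that .
  show "shadow K \<subseteq> topspace (top_of_set tree_space) \<times> topspace (top_of_set tree_space)"
    by (auto simp: shadow_def)
  show "(prune n x, prune n y) \<in> shadow K" if "(x, y) \<in> shadow K" for n x y
    using that by (rule shadow_prune)
  show "openin (prod_topology (top_of_set tree_space) (top_of_set tree_space))
      {p \<in> topspace (top_of_set tree_space) \<times> topspace (top_of_set tree_space).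
        (prune n (fst p), prune n (snd p)) \<in> shadow K}" for n
    by (rule openin_prune_determined[of _ n]) auto
qed

theorem proposition6p1:
  shows "\<exists>(X :: (nat \<Rightarrow> real) topology) (Y :: (nat \<Rightarrow> real) topology) E \<mu> \<nu>.
           compact_space X \<and> metrizable_space X \<and>
           compact_space Y \<and> metrizable_space Y \<and>
           closedin (prod_topology X Y) E \<and>
           finite_Borel_measure X \<mu> \<and> finite_Borel_measure Y \<nu> \<and>
           spectral_synthesis X Y E \<and>
           \<not> operator_synthesis \<mu> \<nu> E"
proof -
  let ?X = "top_of_set tree_space"
  let ?E = "shadow {p \<in> branches \<times> branches. tree_phase p = 1}"
  have "compact_space ?X" by (simp add: compact_space_subtopology compact_tree_space)
  moreover have "metrizable_space ?X" by (intro metrizable_space_subtopology metrizable_space_euclidean)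
  moreover have "closedin (prod_topology ?X ?X) ?E" by (rule closedin_shadow)
  moreover have "finite_Borel_measure ?X branch_measure"
    using prob_space_branch_measure
    by (intro finite_Borel_measureI sets_branch_measure tree_space_borel) (simp add: prob_space_def)
  moreover have "spectral_synthesis ?X ?X ?E" by (rule spectral_synthesis_shadow)
  moreover have "\<not> operator_synthesis branch_measure branch_measure ?E"
    by (rule phase_level_set_not_synthesis[OF oscillating_tree_phase tree_space_borel sets_branch_measure
          tree_space_borel sets_branch_measure branches_full branches_full continuous_on_tree_phase
          shadow_on_branches tree_phase_in_Gamma])
  ultimately show ?thesis by blast
qed

end
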